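(* Let $D$ be a $2$-dimensional regular local ring with maximal ideal $\mathfrak{m}_D=(x,y)D$ and with an algebraically closed coefficient field $k$. Let $$A=D\Big[\Big\{\tfrac{y^2}{x+ay}: a\in k\Big\}\cup\Big\{\tfrac{x^2}{y}\Big\}\Big],\quad \mathfrak{m}=\Big(x,y,\Big\{\tfrac{y^2}{x+ay}: a\in k\Big\}\cup\Big\{\tfrac{x^2}{y}\Big\}\Big)A,\quad C=A_{\mathfrak{m}}.$$ For $a\in k$ let $\alpha_a=D[\frac{x+ay}{y}]_{(y,\frac{x+ay}{y})}$, $\beta_a=\alpha_a[\frac{y^2}{x+ay}]_{(\frac{x+ay}{y},\frac{y^2}{x+ay})}$, and let $\alpha'=D[\frac{y}{x}]_{(x,\frac{y}{x})}$, $\beta'=\alpha'[\frac{x^2}{y}]_{(\frac{y}{x},\frac{x^2}{y})}$ (localizations at the ideals generated by the indicated elements). Then $C=\bigcap_{a\in k}\beta_a\cap\beta'$, and $C$ is a non-Noetherian local domain which is an intersection of rings in $Q(D)$.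
   Context: A coefficient field of $D$ is a subfield $k\subseteq D$ mapping isomorphically onto $D/\mathfrak{m}_D$. $Q(D)$ denotes the set of all $2$-dimensional regular local rings $\alpha$ with $D\subseteq\alpha\subseteq F$, where $F$ is the quotient field of $D$. *)

theory Defs
  imports "HOL-Computational_Algebra.Polynomial"
begin

text \<open>All rings are subrings of an ambient field, the type 'a :: field,
which plays the role of the quotient field F of D.\<close>

definition subring :: "'a::field set \<Rightarrow> bool" where
  "subring R \<longleftrightarrow> 0 \<in> R \<and> 1 \<in> R \<and>
     (\<forall>a\<in>R. \<forall>b\<in>R. a + b \<in> R \<and> a - b \<in> R \<and> a * b \<in> R)"

definition subfield :: "'a::field set \<Rightarrow> bool" where
  "subfield K \<longleftrightarrow> subring K \<and> (\<forall>a\<in>K. a \<noteq> 0 \<longrightarrow> inverse a \<in> K)"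

definition ideal_in :: "'a::field set \<Rightarrow> 'a set \<Rightarrow> bool" where
  "ideal_in R I \<longleftrightarrow> I \<subseteq> R \<and> 0 \<in> I \<and> (\<forall>a\<in>I. \<forall>b\<in>I. a + b \<in> I) \<and>
     (\<forall>r\<in>R. \<forall>a\<in>I. r * a \<in> I)"

definition ideal_gen :: "'a::field set \<Rightarrow> 'a set \<Rightarrow> 'a set" where
  "ideal_gen R S = \<Inter> {I. ideal_in R I \<and> S \<subseteq> I}"

definition prime_in :: "'a::field set \<Rightarrow> 'a set \<Rightarrow> bool" where
  "prime_in R P \<longleftrightarrow> ideal_in R P \<and> P \<noteq> R \<and>
     (\<forall>a\<in>R. \<forall>b\<in>R. a * b \<in> P \<longrightarrow> a \<in> P \<or> b \<in> P)"

definition maximal_in :: "'a::field set \<Rightarrow> 'a set \<Rightarrow> bool" where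
  "maximal_in R M \<longleftrightarrow> ideal_in R M \<and> M \<noteq> R \<and>
     (\<forall>J. ideal_in R J \<and> M \<subseteq> J \<longrightarrow> J = M \<or> J = R)"

definition local_ring :: "'a::field set \<Rightarrow> bool" where
  "local_ring R \<longleftrightarrow> subring R \<and> (\<exists>!M. maximal_in R M)"

definition max_ideal :: "'a::field set \<Rightarrow> 'a set" where
  "max_ideal R = (THE M. maximal_in R M)"

definition noetherian :: "'a::field set \<Rightarrow> bool" where
  "noetherian R \<longleftrightarrow> subring R \<and>
     (\<forall>I. ideal_in R I \<longrightarrow> (\<exists>S. finite S \<and> S \<subseteq> R \<and> I = ideal_gen R S))"

definition prime_chain :: "'a::field set \<Rightarrow> nat \<Rightarrow> bool" where
  "prime_chain R n \<longleftrightarrow> (\<exists>P :: nat \<Rightarrow> 'a set.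
     (\<forall>i\<le>n. prime_in R (P i)) \<and> (\<forall>i<n. P i \<subset> P (Suc i)))"

definition krull_dim_eq :: "'a::field set \<Rightarrow> nat \<Rightarrow> bool" where
  "krull_dim_eq R n \<longleftrightarrow> prime_chain R n \<and> \<not> prime_chain R (Suc n)"

definition regular_local2 :: "'a::field set \<Rightarrow> bool" where
  "regular_local2 R \<longleftrightarrow> local_ring R \<and> noetherian R \<and> krull_dim_eq R 2 \<and>
     (\<exists>u\<in>R. \<exists>v\<in>R. max_ideal R = ideal_gen R {u, v})"

definition quotient_field_is_univ :: "'a::field set \<Rightarrow> bool" where
  "quotient_field_is_univ D \<longleftrightarrow> (\<forall>z. \<exists>a\<in>D. \<exists>b\<in>D. b \<noteq> 0 \<and> z = a / b)"

text \<open>k is a subfield of D mapping isomorphically onto D / m.\<close>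
definition coefficient_field :: "'a::field set \<Rightarrow> 'a set \<Rightarrow> bool" where
  "coefficient_field D k \<longleftrightarrow> subfield k \<and> k \<subseteq> D \<and>
     (\<forall>d\<in>D. \<exists>!c\<in>k. d - c \<in> max_ideal D)"

definition alg_closed_subfield :: "'a::field set \<Rightarrow> bool" where
  "alg_closed_subfield k \<longleftrightarrow> subfield k \<and>
     (\<forall>p :: 'a poly. (\<forall>i. coeff p i \<in> k) \<and> degree p > 0 \<longrightarrow> (\<exists>c\<in>k. poly p c = 0))"

definition adjoin :: "'a::field set \<Rightarrow> 'a set \<Rightarrow> 'a set" where
  "adjoin R S = \<Inter> {T. subring T \<and> R \<union> S \<subseteq> T}"

definition localize :: "'a::field set \<Rightarrow> 'a set \<Rightarrow> 'a set" where
  "localize R P = {r / s | r s. r \<in> R \<and> s \<in> R \<and> s \<notin> P}"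

definition Qset :: "'a::field set \<Rightarrow> 'a set set" where
  "Qset D = {\<alpha>. D \<subseteq> \<alpha> \<and> regular_local2 \<alpha>}"

end

theory Submission
  imports Defs
begin

text \<open>
  Write t = x / y. Each ring of the intersection arises from D by two quadratic transforms with
  parameters (u, v), namely (x + a y, y) or (y, x). It is again two-dimensional regular, with
  parameters u / v and v^2 / u, and it dominates A localized at m, because the generators of m are
  multiples of v^2 / u.

  Let f lie in the intersection. Since D is factorial, f = p / q in lowest terms, and then q becomes
  a unit times a monomial in u / v and v^2 / u in each of the rings. Let g = y^e Q(t) be the initial
  form of q. Comparing orders along the two exceptional curves shows that q / g is a unit
  everywhere, so p / g and q / g lie in the intersection as well. An element h / g of the
  intersection with h in D belongs to A: it is a sum of terms y^r P(t) / Q(t), where membership in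
  the rings says exactly that P / Q has poles of order at most r at the points of k and at most 2 r
  at infinity. By partial fractions such a term is a polynomial in y, y t, y t^2 and y / (t + a),
  all of which lie in A. Hence f = (p / g) / (q / g) lies in C.

  In the ring attached to a, the element y divides y^2 / (x + b y) for every b other than a, but not
  for b = a. This prevents the ideal of all elements divisible by y in almost all of these rings
  from being finitely generated.
\<close>

section \<open>Subrings and ideals of a field\<close>

text \<open>The bounds r and 2 r come from writing y in local coordinates. At the point -a one has y
  = slope * z with slope = t + a, so y^r vanishes to order r along slope = 0 and compensates a pole
  of order r. At infinity v = x and slope = y / x, so y = slope^2 * z and the allowance doubles. D
  is not assumed complete, so the expansion of h into forms has to stop. It does because deg Q is at
  most e, the order of g: for forms of degree e + r with r at least e, the pole conditions hold
  vacuously and the degree condition automatically. Membership in the rings is therefore needed only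
  for the forms of degree below 2 e, and everything of order 2 e over g is in A. Most of the ring
  theory rests on \<open>expansion\<close>: modulo v, an element outside v R is a unit times a power
  of u. It drives the height bound, the primality of v and the reduction to lowest terms.
  Factoriality enters only in the shape that the denominators of one fraction form a principal
  ideal.\<close>

lemma subring_zero: "subring R \<Longrightarrow> 0 \<in> R"
  and subring_one: "subring R \<Longrightarrow> 1 \<in> R"
  and subring_add: "subring R \<Longrightarrow> a \<in> R \<Longrightarrow> b \<in> R \<Longrightarrow> a + b \<in> R"
  and subring_diff: "subring R \<Longrightarrow> a \<in> R \<Longrightarrow> b \<in> R \<Longrightarrow> a - b \<in> R"
  and subring_mult: "subring R \<Longrightarrow> a \<in> R \<Longrightarrow> b \<in> R \<Longrightarrow> a * b \<in> R"
  by (auto simp: subring_def)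

lemma subring_uminus: "subring R \<Longrightarrow> a \<in> R \<Longrightarrow> - a \<in> R"
  using subring_diff[of R 0 a] subring_zero[of R] by simp

lemma subring_power: "subring R \<Longrightarrow> a \<in> R \<Longrightarrow> a ^ n \<in> R"
  by (induction n) (auto intro: subring_one subring_mult)

lemmas subring_closed =
  subring_zero subring_one subring_add subring_diff subring_mult subring_uminus subring_power

lemma ideal_inD:
  assumes "ideal_in R I"
  shows "I \<subseteq> R" "0 \<in> I" "\<And>a b. a \<in> I \<Longrightarrow> b \<in> I \<Longrightarrow> a + b \<in> I"
    "\<And>r a. r \<in> R \<Longrightarrow> a \<in> I \<Longrightarrow> r * a \<in> I" "\<And>r a. r \<in> R \<Longrightarrow> a \<in> I \<Longrightarrow> a * r \<in> I"
  using assms by (auto simp: ideal_in_def mult.commute)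

lemma ideal_in_diff:
  assumes "subring R" "ideal_in R I" "a \<in> I" "b \<in> I"
  shows "a - b \<in> I"
proof -
  have "a + (- 1) * b \<in> I"
    using assms by (intro ideal_inD) (auto intro: subring_closed)
  then show ?thesis by simp
qed

lemma ideal_in_self: "subring R \<Longrightarrow> ideal_in R R"
  by (auto simp: ideal_in_def intro: subring_closed)

lemma ideal_in_zero: "subring R \<Longrightarrow> ideal_in R {0}"
  by (auto simp: ideal_in_def intro: subring_closed)

lemma ideal_in_eq_ring: "subring R \<Longrightarrow> ideal_in R I \<Longrightarrow> 1 \<in> I \<Longrightarrow> I = R"
  using ideal_inD(1)[of R I] ideal_inD(4)[of R I _ 1] by auto

lemma ideal_gen_superset: "S \<subseteq> ideal_gen R S"
  by (auto simp: ideal_gen_def)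

lemma ideal_gen_least: "ideal_in R I \<Longrightarrow> S \<subseteq> I \<Longrightarrow> ideal_gen R S \<subseteq> I"
  by (auto simp: ideal_gen_def)

lemma ideal_in_ideal_gen:
  assumes "subring R" "S \<subseteq> R"
  shows "ideal_in R (ideal_gen R S)"
proof -
  have "ideal_gen R S \<subseteq> R"
    using assms by (intro ideal_gen_least ideal_in_self)
  then show ?thesis
    by (auto simp: ideal_gen_def ideal_in_def)
qed

section \<open>Principal and two-generated ideals in explicit form\<close>

definition principal :: "'a::field set \<Rightarrow> 'a \<Rightarrow> 'a set" where
  "principal R v = {a * v | a. a \<in> R}"

definition span2 :: "'a::field set \<Rightarrow> 'a \<Rightarrow> 'a \<Rightarrow> 'a set" where
  "span2 R u v = {a * u + b * v | a b. a \<in> R \<and> b \<in> R}"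

lemma principalI: "a \<in> R \<Longrightarrow> a * v \<in> principal R v" "a \<in> R \<Longrightarrow> v * a \<in> principal R v"
  by (auto simp: principal_def mult.commute)

lemma principalE: assumes "r \<in> principal R v" obtains a where "a \<in> R" "r = a * v"
  using assms by (auto simp: principal_def)

lemma span2I: "a \<in> R \<Longrightarrow> b \<in> R \<Longrightarrow> a * u + b * v \<in> span2 R u v"
  by (auto simp: span2_def)

lemma span2E: assumes "r \<in> span2 R u v" obtains a b where "a \<in> R" "b \<in> R" "r = a * u + b * v"
  using assms by (auto simp: span2_def)

lemma ideal_in_span2:
  assumes R: "subring R" "u \<in> R" "v \<in> R"
  shows "ideal_in R (span2 R u v)"
proof -
  have "0 * u + 0 * v \<in> span2 R u v"
    using R by (intro span2I) (auto intro: subring_closed)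
  moreover have "a + b \<in> span2 R u v" if ab: "a \<in> span2 R u v" "b \<in> span2 R u v" for a b
  proof -
    obtain a1 a2 where a: "a1 \<in> R" "a2 \<in> R" "a = a1 * u + a2 * v"
      using ab(1) by (rule span2E)
    obtain b1 b2 where b: "b1 \<in> R" "b2 \<in> R" "b = b1 * u + b2 * v"
      using ab(2) by (rule span2E)
    note * = a b
    have "(a1 + b1) * u + (a2 + b2) * v \<in> span2 R u v"
      using * R by (intro span2I) (auto intro: subring_closed)
    then show ?thesis using * by (simp add: algebra_simps)
  qed
  moreover have "r * a \<in> span2 R u v" if r: "r \<in> R" and a: "a \<in> span2 R u v" for a r
  proof -
    obtain a1 a2 where *: "a1 \<in> R" "a2 \<in> R" "a = a1 * u + a2 * v"
      using a by (rule span2E)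
    have "(r * a1) * u + (r * a2) * v \<in> span2 R u v"
      using * R r by (intro span2I) (auto intro: subring_closed)
    then show ?thesis using * by (simp add: algebra_simps)
  qed
  moreover have "span2 R u v \<subseteq> R"
    using R by (auto elim!: span2E intro!: subring_closed)
  ultimately show ?thesis by (auto simp: ideal_in_def)
qed

lemma span2_commute: "span2 R u v = span2 R v u"
  unfolding span2_def by (auto simp: add.commute) (metis add.commute)+

lemma principal_eq_span2: "subring R \<Longrightarrow> principal R v = span2 R v v"
proof (intro equalityI subsetI)
  fix r assume R: "subring R"
  { assume "r \<in> principal R v"
    then obtain a where "a \<in> R" "r = a * v + 0 * v" by (auto elim: principalE)
    then show "r \<in> span2 R v v" using span2I[of a R 0 v v] subring_zero[OF R] by simp }
  { assume "r \<in> span2 R v v"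
    then obtain a b where "a \<in> R" "b \<in> R" "r = (a + b) * v"
      by (auto elim!: span2E simp: algebra_simps)
    then show "r \<in> principal R v" using R by (auto intro: principalI subring_closed) }
qed

lemma ideal_in_principal: "subring R \<Longrightarrow> v \<in> R \<Longrightarrow> ideal_in R (principal R v)"
  by (simp add: principal_eq_span2 ideal_in_span2)

lemma principal_subset: "subring R \<Longrightarrow> v \<in> R \<Longrightarrow> principal R v \<subseteq> R"
  using ideal_in_principal ideal_inD(1) by blast

lemma ideal_gen_pair:
  assumes R: "subring R" "u \<in> R" "v \<in> R"
  shows "ideal_gen R {u, v} = span2 R u v"
proof
  have "1 * u + 0 * v \<in> span2 R u v" "0 * u + 1 * v \<in> span2 R u v"
    by (rule span2I; simp add: R subring_zero subring_one)+
  then show "ideal_gen R {u, v} \<subseteq> span2 R u v"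
    by (intro ideal_gen_least ideal_in_span2 R) auto
  have "ideal_in R (ideal_gen R {u, v})"
    using R by (intro ideal_in_ideal_gen) auto
  then show "span2 R u v \<subseteq> ideal_gen R {u, v}"
    using ideal_gen_superset[of "{u, v}" R]
    by (auto elim!: span2E intro!: ideal_inD(3,4)[of R])
qed

lemma ideal_in_add:
  assumes R: "subring R" and I: "ideal_in R I" and J: "ideal_in R J"
  shows "ideal_in R {a + b | a b. a \<in> I \<and> b \<in> J}" (is "ideal_in R ?S")
  unfolding ideal_in_def
proof (intro conjI ballI)
  show "?S \<subseteq> R"
    using ideal_inD(1)[OF I] ideal_inD(1)[OF J] R by (auto intro: subring_closed)
  show "0 \<in> ?S"
    using ideal_inD(2)[OF I] ideal_inD(2)[OF J] by force
next
  fix s t assume "s \<in> ?S" "t \<in> ?S"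
  then obtain a b c d where *: "s = a + b" "t = c + d" "a \<in> I" "b \<in> J" "c \<in> I" "d \<in> J"
    by auto
  have "s + t = (a + c) + (b + d)" using * by simp
  then show "s + t \<in> ?S" using * ideal_inD(3)[OF I, of a c] ideal_inD(3)[OF J, of b d] by blast
next
  fix r s assume "r \<in> R" "s \<in> ?S"
  then obtain a b where *: "s = a + b" "a \<in> I" "b \<in> J" by auto
  have "r * s = r * a + r * b" using * by (simp add: distrib_left)
  then show "r * s \<in> ?S"
    using * \<open>r \<in> R\<close> ideal_inD(4)[OF I, of r a] ideal_inD(4)[OF J, of r b] by blast
qed

section \<open>Noetherian rings\<close>

lemma noetherian_subring: "noetherian R \<Longrightarrow> subring R"
  by (simp add: noetherian_def)

lemma noetherian_acc:
  fixes I :: "nat \<Rightarrow> 'a::field set"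
  assumes R: "noetherian R" and I: "\<And>n. ideal_in R (I n)" and mono: "\<And>n. I n \<subseteq> I (Suc n)"
  shows "\<exists>N. \<forall>n\<ge>N. I n = I N"
proof -
  have le: "I i \<subseteq> I j" if "i \<le> j" for i j
    using mono that by (rule lift_Suc_mono_le)
  have "ideal_in R (\<Union>n. I n)"
    unfolding ideal_in_def
  proof (intro conjI ballI)
    show "(\<Union>n. I n) \<subseteq> R" "0 \<in> (\<Union>n. I n)" using ideal_inD(1,2)[OF I] by auto
    fix a b assume "a \<in> (\<Union>n. I n)" "b \<in> (\<Union>n. I n)"
    then obtain i j where "a \<in> I i" "b \<in> I j" by auto
    then have "a \<in> I (max i j)" "b \<in> I (max i j)"
      using le[of i "max i j"] le[of j "max i j"] by auto
    then show "a + b \<in> (\<Union>n. I n)" using ideal_inD(3)[OF I] by blast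
  next
    fix r a assume "r \<in> R" "a \<in> (\<Union>n. I n)"
    then show "r * a \<in> (\<Union>n. I n)" using ideal_inD(4)[OF I] by blast
  qed
  then obtain S where S: "finite S" "(\<Union>n. I n) = ideal_gen R S"
    using R unfolding noetherian_def by blast
  have "\<forall>s\<in>S. \<exists>n. s \<in> I n"
    using S(2) ideal_gen_superset[of S R] by blast
  then obtain h where h: "\<And>s. s \<in> S \<Longrightarrow> s \<in> I (h s)" by metis
  define N where "N = Max (insert 0 (h ` S))"
  have "h s \<le> N" if "s \<in> S" for s
    using that S(1) by (auto simp: N_def)
  then have "S \<subseteq> I N" using h le by blast
  then have "(\<Union>n. I n) \<subseteq> I N"
    unfolding S(2) by (intro ideal_gen_least I)
  then have "I n = I N" if "n \<ge> N" for n
    using le[OF that] by blast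
  then show ?thesis by blast
qed

text \<open>For \<^term>\<open>N = {0}\<close> this is Krull's intersection theorem for a principal ideal, for
  \<^term>\<open>X\<close> an ideal it is Nakayama's lemma.\<close>

lemma noetherian_descent:
  fixes R :: "'a::field set"
  assumes R: "noetherian R" and N: "ideal_in R N" and v: "v \<in> R"
    and inv: "\<And>r. r \<in> R \<Longrightarrow> inverse (1 - r * v) \<in> R \<and> 1 - r * v \<noteq> 0"
    and X: "X \<subseteq> R" and step: "\<And>x. x \<in> X \<Longrightarrow> \<exists>x'\<in>X. x - v * x' \<in> N"
  shows "X \<subseteq> N"
proof
  note sR = noetherian_subring[OF R]
  fix x assume "x \<in> X"
  obtain nx where nx: "\<And>x. x \<in> X \<Longrightarrow> nx x \<in> X \<and> x - v * nx x \<in> N"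
    using step by metis
  define s where "s n = (nx ^^ n) x" for n
  have sX: "s n \<in> X" for n
    by (induction n) (auto simp: s_def \<open>x \<in> X\<close> nx)
  have ss: "s n - v * s (Suc n) \<in> N" for n
    using nx[OF sX[of n]] by (simp add: s_def)
  \<comment> \<open>These ideals \<open>N + R * s n\<close> ascend, because \<open>s n\<close> is
    \<open>v * s (Suc n)\<close> modulo \<open>N\<close>.\<close>
  define I where "I n = {a + b | a b. a \<in> N \<and> b \<in> principal R (s n)}" for n
  have II: "ideal_in R (I n)" for n
    unfolding I_def using sX X by (intro ideal_in_add sR N ideal_in_principal) auto
  have NI: "a \<in> I n" if "a \<in> N" for a n
  proof -
    have "0 \<in> principal R (s n)"
      using sX X by (intro ideal_inD(2)[OF ideal_in_principal] sR) auto
    then show ?thesis unfolding I_def using that by force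
  qed
  have sI: "r * s n \<in> I n" if "r \<in> R" for r n
    unfolding I_def using principalI[OF that, of "s n"] ideal_inD(2)[OF N] by force
  have "s n \<in> I (Suc n)" for n
    using ideal_inD(3)[OF II NI[OF ss[of n]] sI[OF v, of "Suc n"]] by simp
  then have "principal R (s n) \<subseteq> I (Suc n)" for n
    by (auto elim!: principalE intro: ideal_inD(4)[OF II])
  then have mono: "I n \<subseteq> I (Suc n)" for n
    unfolding I_def[of n] using NI ideal_inD(3)[OF II] by blast
  obtain M where M: "\<forall>n\<ge>M. I n = I M"
    using noetherian_acc[of R I, OF R II mono] by blast
  have "s (Suc M) \<in> I M"
    using M[rule_format, of "Suc M"] sI[OF subring_one[OF sR], of "Suc M"] by simp
  then obtain a r where ar: "a \<in> N" "r \<in> R" "s (Suc M) = a + r * s M"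
    unfolding I_def by (auto elim: principalE)
  \<comment> \<open>At the stable index, \<open>s (Suc M)\<close> is \<open>r * s M\<close> modulo
    \<open>N\<close>, hence \<open>r * v * s (Suc M)\<close>; so the unit \<open>1 - r * v\<close>
    carries \<open>s (Suc M)\<close> into \<open>N\<close>.\<close>
  have "a + r * (s M - v * s (Suc M)) \<in> N"
    by (rule ideal_inD(3)[OF N ar(1) ideal_inD(4)[OF N ar(2) ss]])
  then have "s (Suc M) * (1 - r * v) \<in> N"
    using ar(3) by (simp add: algebra_simps)
  then have "inverse (1 - r * v) * (s (Suc M) * (1 - r * v)) \<in> N"
    using inv[OF ar(2)] by (simp add: ideal_inD(4)[OF N])
  moreover have "inverse (1 - r * v) * (s (Suc M) * (1 - r * v)) = s (Suc M)"
    using inv[OF ar(2)] by (metis mult.left_commute left_inverse mult.right_neutral)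
  ultimately have *: "s (Suc M) \<in> N" by simp
  \<comment> \<open>Membership is carried back down to \<open>s 0 = x\<close>. Truncated subtraction
    makes the index stay at 0 once \<open>i\<close> reaches \<open>M'\<close>.\<close>
  have "s (M' - i) \<in> N" if "s M' \<in> N" for M' i
  proof (induction i)
    case (Suc i)
    show ?case
    proof (cases "i < M'")
      case True
      then have eq: "M' - i = Suc (M' - Suc i)" by auto
      have "(s (M' - Suc i) - v * s (M' - i)) + v * s (M' - i) \<in> N"
        using ss[of "M' - Suc i"] ideal_inD(4)[OF N v Suc] unfolding eq by (rule ideal_inD(3)[OF N])
      then show ?thesis by simp
    next
      case False
      then show ?thesis using Suc by auto
    qed
  qed (use that in auto)
  from this[OF *, of "Suc M"] show "x \<in> N" by (simp add: s_def)
qed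

text \<open>Choosing strictly larger proper ideals again and again would violate the ascending chain
  condition, so no appeal to Zorn's lemma is made.\<close>

lemma noetherian_maximal_above:
  assumes R: "noetherian R" and I: "ideal_in R I" "I \<noteq> R"
  shows "\<exists>M. maximal_in R M \<and> I \<subseteq> M"
proof (rule ccontr)
  assume no: "\<nexists>M. maximal_in R M \<and> I \<subseteq> M"
  define F where "F J \<longleftrightarrow> ideal_in R J \<and> J \<noteq> R \<and> I \<subseteq> J" for J
  have "\<exists>J'. F J' \<and> J \<subset> J'" if FJ: "F J" for J
  proof -
    have "\<not> maximal_in R J" using no FJ by (auto simp: F_def)
    then obtain J' where "ideal_in R J'" "J \<subseteq> J'" "J' \<noteq> J" "J' \<noteq> R"
      using FJ unfolding F_def maximal_in_def by auto
    then show ?thesis using FJ by (intro exI[of _ J']) (auto simp: F_def)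
  qed
  then obtain nx where nx: "\<And>J. F J \<Longrightarrow> F (nx J) \<and> J \<subset> nx J" by metis
  define s where "s n = (nx ^^ n) I" for n
  have F: "F (s n)" for n
    by (induction n) (use I nx in \<open>auto simp: s_def F_def\<close>)
  have less: "s n \<subset> s (Suc n)" for n using nx[OF F[of n]] by (simp add: s_def)
  have ideal: "ideal_in R (s n)" for n using F[of n] by (simp add: F_def)
  obtain N where N: "\<forall>n\<ge>N. s n = s N"
    using noetherian_acc[of R s, OF R ideal psubset_imp_subset[OF less]] by blast
  show False using less[of N] N[rule_format, of "Suc N"] by auto
qed

section \<open>Local rings\<close>

lemma maximal_in_iff_of_units:
  assumes R: "subring R" and M: "ideal_in R M" "1 \<notin> M"
    and unit: "\<And>r. r \<in> R \<Longrightarrow> r \<notin> M \<Longrightarrow> inverse r \<in> R"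
  shows "maximal_in R N \<longleftrightarrow> N = M"
proof -
  have sub: "J \<subseteq> M" if J: "ideal_in R J" "J \<noteq> R" for J
  proof
    fix r assume r: "r \<in> J"
    show "r \<in> M"
    proof (rule ccontr)
      assume "r \<notin> M"
      then have "r \<noteq> 0" "inverse r \<in> R"
        using ideal_inD(2)[OF M(1)] unit ideal_inD(1)[OF J(1)] r by auto
      then have "1 \<in> J" using ideal_inD(4)[OF J(1) _ r, of "inverse r"] by simp
      then show False using J ideal_in_eq_ring[OF R] by blast
    qed
  qed
  have MR: "M \<noteq> R" using M subring_one[OF R] by auto
  show ?thesis
  proof
    assume "maximal_in R N"
    then show "N = M" using sub[of N] M MR unfolding maximal_in_def by blast
  next
    assume "N = M"
    then show "maximal_in R N" using sub M MR unfolding maximal_in_def by blast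
  qed
qed

lemma local_ring_of_units:
  assumes "subring R" "ideal_in R M" "1 \<notin> M"
    and "\<And>r. r \<in> R \<Longrightarrow> r \<notin> M \<Longrightarrow> inverse r \<in> R"
  shows "local_ring R" "max_ideal R = M"
  using maximal_in_iff_of_units[OF assms] assms(1) by (auto simp: local_ring_def max_ideal_def)

lemma noetherian_local_units:
  assumes R: "noetherian R" "local_ring R" and r: "r \<in> R" "r \<notin> max_ideal R"
  shows "inverse r \<in> R"
proof (rule ccontr)
  assume no: "inverse r \<notin> R"
  note sR = noetherian_subring[OF R(1)]
  have "r \<noteq> 0" using no subring_zero[OF sR] by auto
  then have "1 \<notin> principal R r"
    using no by (auto elim!: principalE) (metis inverse_unique mult.commute)
  then have "principal R r \<noteq> R" using subring_one[OF sR] by auto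
  then obtain N where N: "maximal_in R N" "principal R r \<subseteq> N"
    using noetherian_maximal_above[OF R(1) ideal_in_principal[OF sR r(1)]] by blast
  have "max_ideal R = N"
    using R(2) N(1) unfolding local_ring_def max_ideal_def by (metis the1_equality)
  then show False using N(2) r principalI(1)[OF subring_one[OF sR], of r] by auto
qed

lemma local_ring_maximal: "local_ring R \<Longrightarrow> maximal_in R (max_ideal R)"
  unfolding local_ring_def max_ideal_def by (blast intro: theI')

section \<open>Local rings with a two-generated maximal ideal\<close>

text \<open>Locality is encoded as invertibility of everything outside \<open>span2 R u v\<close>.
  This is the form in which it can be checked directly for a localization and in which it is
  applied.\<close>

locale local2 =
  fixes R :: "'a::field set" and u v :: 'a
  assumes noeth: "noetherian R"
    and u: "u \<in> R" and v: "v \<in> R"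
    and unit: "\<And>r. r \<in> R \<Longrightarrow> r \<notin> span2 R u v \<Longrightarrow> inverse r \<in> R"
    and proper: "1 \<notin> span2 R u v"
begin

lemma sub: "subring R"
  using noeth by (rule noetherian_subring)

lemmas closed = subring_closed[OF sub]

lemma ideal_max: "ideal_in R (span2 R u v)"
  using sub u v by (rule ideal_in_span2)

lemma in_max: "a \<in> R \<Longrightarrow> a * u \<in> span2 R u v" "a \<in> R \<Longrightarrow> a * v \<in> span2 R u v"
  using span2I[of a R 0 u v] span2I[of 0 R a u v] closed by auto

lemma principal_max: "principal R u \<subseteq> span2 R u v" "principal R v \<subseteq> span2 R u v"
  using in_max by (auto elim!: principalE)

lemma proper_ideal_max:
  assumes J: "ideal_in R J" "J \<noteq> R"
  shows "J \<subseteq> span2 R u v"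
proof
  fix r assume r: "r \<in> J"
  show "r \<in> span2 R u v"
  proof (rule ccontr)
    assume "r \<notin> span2 R u v"
    then have "r \<noteq> 0" "inverse r \<in> R"
      using ideal_inD(2)[OF ideal_max] unit ideal_inD(1)[OF J(1)] r by auto
    then have "1 \<in> J" using ideal_inD(4)[OF J(1) _ r, of "inverse r"] by simp
    then show False using J ideal_in_eq_ring[OF sub] by blast
  qed
qed

lemma nonunit_max: "r \<in> R \<Longrightarrow> r \<notin> span2 R u v \<longleftrightarrow> r \<noteq> 0 \<and> inverse r \<in> R"
  using unit proper ideal_inD(2,4)[OF ideal_max] by (metis left_inverse)

lemma one_minus_unit:
  assumes "m \<in> span2 R u v"
  shows "inverse (1 - m) \<in> R \<and> 1 - m \<noteq> 0"
proof -
  have mR: "m \<in> R" using assms ideal_inD(1)[OF ideal_max] by auto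
  have "1 - m \<notin> span2 R u v"
  proof
    assume "1 - m \<in> span2 R u v"
    then have "(1 - m) + m \<in> span2 R u v" using assms by (intro ideal_inD(3)[OF ideal_max])
    then show False using proper by simp
  qed
  then show ?thesis using nonunit_max[of "1 - m"] mR by (auto intro: closed)
qed

lemma descent:
  assumes "ideal_in R N" "X \<subseteq> R" "w = u \<or> w = v"
    and "\<And>x. x \<in> X \<Longrightarrow> \<exists>x'\<in>X. x - w * x' \<in> N"
  shows "X \<subseteq> N"
proof (rule noetherian_descent[OF noeth assms(1)])
  show "w \<in> R" using assms(3) u v by auto
  show "inverse (1 - r * w) \<in> R \<and> 1 - r * w \<noteq> 0" if "r \<in> R" for r
    using assms(3) in_max that by (intro one_minus_unit) auto
qed (use assms in auto)

lemma ideal_v: "ideal_in R (principal R v)"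
  using sub v by (rule ideal_in_principal)

text \<open>The maximal ideal of R / vR is generated by u. An element without such an expansion is a
  non-unit, hence \<open>a * u + b * v\<close>, and \<open>a\<close> has no expansion either; so the
  set of these elements lies in u times itself plus v R, and the descent puts it into v R. The power
  of u may itself lie in v R here: uniqueness of n needs regularity.\<close>

lemma expansion:
  assumes "r \<in> R" "r \<notin> principal R v"
  shows "\<exists>e n h. e \<in> R \<and> inverse e \<in> R \<and> e \<noteq> 0 \<and> h \<in> R \<and> r = e * u ^ n + v * h"
proof (rule ccontr)
  define P where "P r \<longleftrightarrow> (\<exists>e n h. e \<in> R \<and> inverse e \<in> R \<and> e \<noteq> 0 \<and> h \<in> R \<and> r = e * u ^ n + v * h)"
    for r
  assume "\<not> ?thesis"
  then have "\<not> P r" by (simp add: P_def)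
  define X where "X = {r\<in>R. \<not> P r}"
  have "X \<subseteq> principal R v"
  proof (rule descent[where w = u])
    fix r assume "r \<in> X"
    then have r: "r \<in> R" "\<not> P r" by (auto simp: X_def)
    have "r \<in> span2 R u v"
    proof (rule ccontr)
      assume "r \<notin> span2 R u v"
      then have "inverse r \<in> R" "r \<noteq> 0" using nonunit_max r by auto
      moreover have "r = r * u ^ 0 + v * 0" by simp
      ultimately have "P r" unfolding P_def using r closed(1) by blast
      then show False using r by simp
    qed
    then obtain a b where ab: "a \<in> R" "b \<in> R" "r = a * u + b * v" by (rule span2E)
    have "\<not> P a"
    proof
      assume "P a"
      then obtain e n h where *: "e \<in> R" "inverse e \<in> R" "e \<noteq> 0" "h \<in> R" "a = e * u ^ n + v * h"
        unfolding P_def by blast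
      have "r = e * u ^ Suc n + v * (h * u + b)" using ab * by (simp add: algebra_simps)
      moreover have "h * u + b \<in> R" using * ab u by (intro closed)
      ultimately have "P r" unfolding P_def using * by blast
      then show False using r by simp
    qed
    then show "\<exists>x'\<in>X. r - u * x' \<in> principal R v"
      using ab principalI(1)[of b R v] by (intro bexI[of _ a]) (auto simp: X_def mult.commute)
  qed (auto simp: X_def ideal_v)
  then show False using assms \<open>\<not> P r\<close> by (auto simp: X_def)
qed

text \<open>Krull's principal ideal theorem for the image of \<^term>\<open>v\<close> modulo \<^term>\<open>P\<close>. The usual
  symbolic powers of \<^term>\<open>Q\<close> are replaced by the contractions of the powers of one fixed
  element of \<^term>\<open>Q\<close> outside \<^term>\<open>P\<close> from the localization at \<^term>\<open>Q\<close>.\<close>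

lemma height_one:
  assumes P: "prime_in R P" and Q: "prime_in R Q" "P \<subset> Q" "Q \<noteq> span2 R u v"
    and f: "f \<in> P" and ab: "a \<in> R" "b \<in> R" "u ^ d = v * a + f * b"
  shows False
proof -
  have iP: "ideal_in R P" and iQ: "ideal_in R Q" and QR: "Q \<noteq> R"
    and primP: "\<And>a b. a \<in> R \<Longrightarrow> b \<in> R \<Longrightarrow> a * b \<in> P \<Longrightarrow> a \<in> P \<or> b \<in> P"
    and primQ: "\<And>a b. a \<in> R \<Longrightarrow> b \<in> R \<Longrightarrow> a * b \<in> Q \<Longrightarrow> a \<in> Q \<or> b \<in> Q"
    using P Q by (auto simp: prime_in_def)
  have one: "1 \<notin> Q" using QR iQ ideal_in_eq_ring[OF sub] by blast
  have PR: "p \<in> R" if "p \<in> P" for p using ideal_inD(1)[OF iP] that by auto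
  have powQ: "x \<in> Q" if "x \<in> R" "x ^ n \<in> Q" for x n
    using that(2)
  proof (induction n)
    case (Suc n)
    then show ?case using primQ[OF that(1) closed(7)[OF that(1), of n]] by auto
  qed (use one in auto)
  have powP: "x ^ n \<notin> P" if "x \<in> R" "x \<notin> P" for x n
  proof (induction n)
    case (Suc n)
    then show ?case using primP[OF that(1) closed(7)[OF that(1), of n]] that(2) by auto
  qed (use one Q(2) in auto)
  \<comment> \<open>Otherwise Q would contain \<open>u ^ d\<close>, hence u, and would be the
    maximal ideal.\<close>
  have vQ: "v \<notin> Q"
  proof
    assume vQ: "v \<in> Q"
    have "u ^ d \<in> Q" unfolding ab(3) using Q(2) vQ f ab iQ by (intro ideal_inD) auto
    then have "u \<in> Q" using powQ u by blast
    then have "span2 R u v \<subseteq> Q"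
      using vQ by (auto elim!: span2E intro!: ideal_inD(3,4)[OF iQ])
    then show False using proper_ideal_max[OF iQ QR] Q(3) by blast
  qed
  obtain g where g: "g \<in> Q" "g \<notin> P" using Q(2) by blast
  have gR: "g \<in> R" using g ideal_inD(1)[OF iQ] by auto
  define Z where "Z n = {r\<in>R. \<exists>s\<in>R - Q. \<exists>a\<in>R. \<exists>p\<in>P. s * r = g ^ n * a + p}" for n
  have ZI: "r \<in> Z n" if "r \<in> R" "s \<in> R" "s \<notin> Q" "a \<in> R" "p \<in> P" "s * r = g ^ n * a + p" for r s a p n
    using that by (auto simp: Z_def)
  have PZ: "p \<in> Z n" if "p \<in> P" for p n
    by (rule ZI[of _ 1 0 p]) (use that PR one closed in auto)
  have iZ: "ideal_in R (Z n)" for n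
    unfolding ideal_in_def
  proof (intro conjI ballI)
    show "Z n \<subseteq> R" by (auto simp: Z_def)
    show "0 \<in> Z n" using PZ ideal_inD(2)[OF iP] by blast
  next
    fix r1 r2 assume "r1 \<in> Z n" "r2 \<in> Z n"
    then obtain s1 a1 p1 s2 a2 p2 where *: "r1 \<in> R" "s1 \<in> R" "s1 \<notin> Q" "a1 \<in> R" "p1 \<in> P"
      "s1 * r1 = g ^ n * a1 + p1" "r2 \<in> R" "s2 \<in> R" "s2 \<notin> Q" "a2 \<in> R" "p2 \<in> P" "s2 * r2 = g ^ n * a2 + p2"
      unfolding Z_def by blast
    have "(s1 * s2) * (r1 + r2) = s2 * (s1 * r1) + s1 * (s2 * r2)" by (simp add: algebra_simps)
    also have "\<dots> = g ^ n * (s2 * a1 + s1 * a2) + (s2 * p1 + s1 * p2)"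
      using * by (simp add: algebra_simps)
    finally have eq: "(s1 * s2) * (r1 + r2) = g ^ n * (s2 * a1 + s1 * a2) + (s2 * p1 + s1 * p2)" .
    have "s2 * p1 + s1 * p2 \<in> P" using * ideal_inD(3,4)[OF iP] by blast
    moreover have "s1 * s2 \<notin> Q" using primQ[of s1 s2] * by blast
    moreover have "r1 + r2 \<in> R" "s1 * s2 \<in> R" "s2 * a1 + s1 * a2 \<in> R" using * by (auto intro: closed)
    ultimately show "r1 + r2 \<in> Z n" using eq ZI by blast
  next
    fix r r1 assume "r \<in> R" "r1 \<in> Z n"
    then obtain s1 a1 p1 where *: "r \<in> R" "r1 \<in> R" "s1 \<in> R" "s1 \<notin> Q" "a1 \<in> R" "p1 \<in> P"
      "s1 * r1 = g ^ n * a1 + p1" unfolding Z_def by blast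
    have "s1 * (r * r1) = g ^ n * (r * a1) + r * p1"
      using * by (metis (no_types, opaque_lifting) distrib_left mult.left_commute)
    moreover have "r * r1 \<in> R" "r * a1 \<in> R" "r * p1 \<in> P" using * ideal_inD(4)[OF iP] by (auto intro: closed)
    ultimately show "r * r1 \<in> Z n" using * ZI by blast
  qed
  have dec: "Z (Suc n) \<subseteq> Z n" for n
  proof
    fix r assume "r \<in> Z (Suc n)"
    then obtain s1 a1 p1 where *: "r \<in> R" "s1 \<in> R" "s1 \<notin> Q" "a1 \<in> R" "p1 \<in> P"
      "s1 * r = g ^ Suc n * a1 + p1" unfolding Z_def by blast
    then have "s1 * r = g ^ n * (g * a1) + p1" by (simp add: algebra_simps)
    moreover have "g * a1 \<in> R" using * gR by (auto intro: closed)
    ultimately show "r \<in> Z n" using * ZI by blast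
  qed
  \<comment> \<open>\<open>e n\<close> is the smallest power of u occurring in \<open>Z n\<close>
    modulo v. It is at most d for every n, because P lies in all the \<open>Z n\<close>, so it
    cannot increase strictly forever.\<close>
  define E where "E n i \<longleftrightarrow> (\<exists>z\<in>Z n. \<exists>h\<in>R. u ^ i = z + v * h)" for n i
  define e where "e n = (LEAST i. E n i)" for n
  have Ed: "E n d" for n
  proof -
    have "b * f \<in> Z n" using PZ[OF f] ab by (intro ideal_inD(4)[OF iZ])
    then show ?thesis unfolding E_def using ab
      by (intro bexI[of _ "b * f"] bexI[of _ a]) (auto simp: algebra_simps)
  qed
  have ed: "e n \<le> d" and Ee: "E n (e n)" for n
    using Ed by (auto simp: e_def intro: Least_le LeastI)
  have "\<exists>n. e (Suc n) \<le> e n"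
  proof (rule ccontr)
    assume "\<nexists>n. e (Suc n) \<le> e n"
    then have *: "e n < e (Suc n)" for n by (meson not_le)
    have "n \<le> e n" for n
      by (induction n) (use * in \<open>auto simp: Suc_le_eq intro: le_less_trans\<close>)
    from this[of "Suc d"] ed[of "Suc d"] show False by simp
  qed
  then obtain n where n: "e (Suc n) \<le> e n" by blast
  \<comment> \<open>When the smallest power does not grow from n to \<open>Suc n\<close>, every
    element of \<open>Z n\<close> agrees with one of \<open>Z (Suc n)\<close> modulo v.\<close>
  have Zsub: "\<exists>z\<in>Z (Suc n). \<exists>h\<in>R. r = z + v * h" if r: "r \<in> Z n" for r
  proof (cases "r \<in> principal R v")
    case True
    then obtain h where "h \<in> R" "r = 0 + v * h" by (auto elim!: principalE)
    then show ?thesis using ideal_inD(2)[OF iZ] by blast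
  next
    case False
    have rR: "r \<in> R" using r ideal_inD(1)[OF iZ] by auto
    obtain c i h where c: "c \<in> R" "inverse c \<in> R" "c \<noteq> 0" "h \<in> R" "r = c * u ^ i + v * h"
      using expansion[OF rR False] by blast
    have "u ^ i = inverse c * r + v * (- (inverse c * h))"
      using c by (simp add: field_simps)
    moreover have "inverse c * r \<in> Z n" using c r by (intro ideal_inD(4)[OF iZ])
    moreover have "- (inverse c * h) \<in> R" using c by (intro closed)
    ultimately have "E n i" unfolding E_def by blast
    then have "e n \<le> i" by (simp add: e_def Least_le)
    obtain z k where z: "z \<in> Z (Suc n)" "k \<in> R" "u ^ e (Suc n) = z + v * k"
      using Ee[of "Suc n"] unfolding E_def by blast
    define t where "t = c * u ^ (i - e (Suc n))"
    have t: "t \<in> R" using c u by (auto simp: t_def intro: closed)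
    have "c * u ^ i = t * u ^ e (Suc n)"
      using n \<open>e n \<le> i\<close> by (simp add: t_def mult.assoc flip: power_add)
    then have "r = t * z + v * (t * k + h)" using c z by (simp add: algebra_simps)
    moreover have "t * z \<in> Z (Suc n)" using t z by (intro ideal_inD(4)[OF iZ])
    moreover have "t * k + h \<in> R" using t z c by (intro closed)
    ultimately show ?thesis by blast
  qed
  have "Z n \<subseteq> Z (Suc n)"
  proof (rule descent[where w = v, OF iZ])
    show "Z n \<subseteq> R" using ideal_inD(1)[OF iZ] .
    fix r assume r: "r \<in> Z n"
    then obtain z h where z: "z \<in> Z (Suc n)" "h \<in> R" "r = z + v * h" using Zsub by blast
    have "r - z \<in> Z n" using z dec r ideal_in_diff[OF sub iZ] by blast
    then have "v * h \<in> Z n" using z by simp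
    then obtain s a p where *: "s \<in> R" "s \<notin> Q" "a \<in> R" "p \<in> P" "s * (v * h) = g ^ n * a + p"
      unfolding Z_def by blast
    \<comment> \<open>As v is outside Q it can be absorbed into the denominator \<open>s\<close>, so
      \<open>h\<close> remains in \<open>Z n\<close>. This is what makes the Nakayama argument
      close.\<close>
    have "h \<in> Z n"
      by (rule ZI[of _ "s * v" a p]) (use * z v vQ primQ in \<open>auto intro: closed simp: mult.assoc\<close>)
    then show "\<exists>x'\<in>Z n. r - v * x' \<in> Z (Suc n)"
      using z by (intro bexI[of _ h]) auto
  qed simp
  moreover have "g ^ n \<in> Z n"
    by (rule ZI[of _ 1 1 0]) (use gR one ideal_inD(2)[OF iP] in \<open>auto intro: closed\<close>)
  ultimately obtain s a p where *: "s \<in> R" "s \<notin> Q" "a \<in> R" "p \<in> P" "s * g ^ n = g ^ Suc n * a + p"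
    unfolding Z_def by blast
  \<comment> \<open>Cancelling \<open>g ^ n\<close>, which is nonzero modulo the prime P, leaves s
    in g R + P and so in Q.\<close>
  have "g ^ n * (s - g * a) = p" using * by (simp add: algebra_simps)
  then have "s - g * a \<in> P"
    using * gR powP[OF gR g(2), of n] primP[of "g ^ n" "s - g * a"] by (auto intro: closed)
  moreover have "g * a \<in> Q" using * g by (intro ideal_inD(5)[OF iQ])
  ultimately have "(s - g * a) + g * a \<in> Q" using Q(2) by (intro ideal_inD(3)[OF iQ]) auto
  then show False using * by simp
qed

text \<open>Two elements outside v R expand as units times \<open>u ^ i\<close> and
  \<open>u ^ j\<close> modulo v. Their product is a unit times \<open>u ^ (i + j)\<close>, which by
  hypothesis is still nonzero modulo v.\<close>

lemma prime_principal_of_powers: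
  assumes pow: "\<And>n. u ^ n \<notin> principal R v"
    and ab: "a \<in> R" "b \<in> R" "a * b \<in> principal R v"
  shows "a \<in> principal R v \<or> b \<in> principal R v"
proof (rule ccontr)
  assume no: "\<not> ?thesis"
  obtain c i h where c: "c \<in> R" "inverse c \<in> R" "c \<noteq> 0" "h \<in> R" "a = c * u ^ i + v * h"
    using expansion[OF ab(1)] no by blast
  obtain d j k where d: "d \<in> R" "inverse d \<in> R" "d \<noteq> 0" "k \<in> R" "b = d * u ^ j + v * k"
    using expansion[OF ab(2)] no by blast
  obtain t where t: "t \<in> R" "a * b = t * v" using ab(3) by (rule principalE)
  have "a * b = (c * d) * u ^ (i + j) + v * (h * b + c * u ^ i * k)"
    using c d by (simp add: algebra_simps power_add)
  then have "u ^ (i + j) = inverse c * inverse d * (t - (h * b + c * u ^ i * k)) * v"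
    using t c d by (simp add: field_simps)
  moreover have "inverse c * inverse d * (t - (h * b + c * u ^ i * k)) \<in> R"
    using c d t ab u by (intro closed)
  ultimately show False using pow[of "i + j"] principalI(1) by metis
qed

end

section \<open>Two-dimensional regular local rings\<close>

text \<open>Regularity is stated as v, u being a regular sequence. In contrast to a condition on
  chains of primes, this is easy to carry over to a quadratic transform; dimension two is recovered
  in \<open>krull_dim\<close>.\<close>

locale regular2 = local2 +
  assumes v0: "v \<noteq> 0"
    and regular: "\<And>s. s \<in> R \<Longrightarrow> u * s \<in> principal R v \<Longrightarrow> s \<in> principal R v"
begin

lemma one_notin_v: "1 \<notin> principal R v"
  using principal_max proper by auto

lemma u_pow: "u ^ n \<notin> principal R v"
  by (induction n) (use one_notin_v regular u in \<open>auto intro: closed\<close>)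

lemma u0: "u \<noteq> 0"
  using u_pow[of 1] ideal_inD(2)[OF ideal_v] by auto

lemma v_prime: "a \<in> R \<Longrightarrow> b \<in> R \<Longrightarrow> a * b \<in> principal R v \<Longrightarrow> a \<in> principal R v \<or> b \<in> principal R v"
  using prime_principal_of_powers[OF u_pow] by blast

text \<open>From \<open>v * s = a * u\<close> one gets v dividing a, and cancelling v leaves u
  dividing s. With this, all facts proved about v are available for u.\<close>

lemma swap: "regular2 R v u"
proof
  show "noetherian R" "v \<in> R" "u \<in> R" "u \<noteq> 0" using noeth u v u0 by auto
  show "1 \<notin> span2 R v u" "\<And>r. r \<in> R \<Longrightarrow> r \<notin> span2 R v u \<Longrightarrow> inverse r \<in> R"
    using proper unit by (auto simp: span2_commute)
  fix s assume s: "s \<in> R" "v * s \<in> principal R u"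
  then obtain a where a: "a \<in> R" "v * s = a * u" by (auto elim: principalE)
  then have "u * a \<in> principal R v" using principalI(2)[OF s(1), of v] by (simp add: mult.commute)
  then have "a \<in> principal R v" using a regular by blast
  then obtain b where "b \<in> R" "a = b * v" by (rule principalE)
  then show "s \<in> principal R u" using a v0 principalI(1)[of b R u] by (auto simp: ac_simps)
qed

text \<open>The elements of infinite v-order form a set contained in v times itself, so the descent
  modulo \<open>{0}\<close> leaves only 0.\<close>

lemma v_adic:
  assumes "r \<in> R" "r \<noteq> 0"
  shows "\<exists>n s. s \<in> R \<and> s \<notin> principal R v \<and> r = v ^ n * s"
proof (rule ccontr)
  define P where "P r \<longleftrightarrow> (\<exists>n s. s \<in> R \<and> s \<notin> principal R v \<and> r = v ^ n * s)" for r
  assume "\<not> ?thesis"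
  then have "\<not> P r" by (simp add: P_def)
  define X where "X = {r\<in>R. \<not> P r}"
  have "X \<subseteq> {0}"
  proof (rule descent[where w = v, OF ideal_in_zero[OF sub]])
    fix r assume "r \<in> X"
    then have r: "r \<in> R" "\<not> P r" by (auto simp: X_def)
    then have "r \<in> principal R v" unfolding P_def by (metis mult_1 power_0)
    then obtain s where s: "s \<in> R" "r = s * v" by (rule principalE)
    have "\<not> P s"
    proof
      assume "P s"
      then obtain n t where "t \<in> R" "t \<notin> principal R v" "s = v ^ n * t" unfolding P_def by blast
      then have "t \<in> R \<and> t \<notin> principal R v \<and> r = v ^ Suc n * t" using s by simp
      then have "P r" unfolding P_def by blast
      then show False using r by simp
    qed
    then show "\<exists>x'\<in>X. r - v * x' \<in> {0}" using s by (intro bexI[of _ s]) (auto simp: X_def)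
  qed (auto simp: X_def)
  then show False using assms \<open>\<not> P r\<close> by (auto simp: X_def)
qed

lemma prime_in_principal_v: "prime_in R (principal R v)"
  unfolding prime_in_def using ideal_v one_notin_v closed(2) v_prime by auto

lemma prime_in_max: "prime_in R (span2 R u v)"
proof -
  have "a * b \<notin> span2 R u v" if "a \<in> R" "b \<in> R" "a \<notin> span2 R u v" "b \<notin> span2 R u v" for a b
    using that nonunit_max[of a] nonunit_max[of b] nonunit_max[of "a * b"]
    by (auto intro: closed)
  then show ?thesis unfolding prime_in_def using ideal_max proper closed(2) by auto
qed

lemma prime_in_zero: "prime_in R {0}"
  unfolding prime_in_def using ideal_in_zero[OF sub] closed(2) by force

text \<open>An element of \<open>P 1\<close> outside v R puts a power of u into v R +
  \<open>P 1\<close>, which \<open>height_one\<close> forbids as \<open>P 2\<close> lies strictly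
  between \<open>P 1\<close> and the maximal ideal. If v is not in \<open>P 1\<close>, such an
  element arises by removing all factors v from a nonzero element of \<open>P 1\<close>. If v is in
  \<open>P 1\<close>, expanding an element of \<open>P 2\<close> outside \<open>P 1\<close> puts u
  into \<open>P 2\<close>, which is then maximal.\<close>

lemma no_prime_chain_3: "\<not> prime_chain R 3"
proof
  assume "prime_chain R 3"
  then obtain P where P: "\<forall>i\<le>3. prime_in R (P i)" "\<forall>i<3. P i \<subset> P (Suc i)"
    unfolding prime_chain_def by blast
  have lt: "P 0 \<subset> P 1" "P 1 \<subset> P 2" "P 2 \<subset> P 3"
    using P(2)[rule_format, of 0] P(2)[rule_format, of 1] P(2)[rule_format, of 2]
    by (auto simp: numeral_eq_Suc)
  have pr: "prime_in R (P 0)" "prime_in R (P 1)" "prime_in R (P 2)" "prime_in R (P 3)"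
    using P(1) by auto
  have P3: "P 3 \<subseteq> span2 R u v"
    using pr(4) unfolding prime_in_def by (auto dest: proper_ideal_max)
  then have P2: "P 2 \<noteq> span2 R u v" using lt by auto
  have i: "ideal_in R (P 1)" "ideal_in R (P 2)" using pr by (auto simp: prime_in_def)
  have prim: "a \<in> P 1 \<or> b \<in> P 1" if "a \<in> R" "b \<in> R" "a * b \<in> P 1" for a b
    using pr(2) that by (auto simp: prime_in_def)
  have "0 \<in> P 0" using pr(1) by (auto simp: prime_in_def ideal_in_def)
  then obtain f where f: "f \<in> P 1" "f \<noteq> 0" using lt(1) by blast
  have fR: "f \<in> R" using f ideal_inD(1)[OF i(1)] by auto
  have key: False if h: "h \<in> P 1" "h \<notin> principal R v" for h
  proof -
    have hR: "h \<in> R" using h ideal_inD(1)[OF i(1)] by auto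
    obtain c n k where c: "c \<in> R" "inverse c \<in> R" "c \<noteq> 0" "k \<in> R" "h = c * u ^ n + v * k"
      using expansion[OF hR h(2)] by blast
    have eq: "u ^ n = v * (- (inverse c * k)) + h * inverse c" using c by (simp add: field_simps)
    show False
      by (rule height_one[OF pr(2) pr(3) lt(2) P2 h(1) _ _ eq]) (use c in \<open>auto intro: closed\<close>)
  qed
  then have sub_v: "P 1 \<subseteq> principal R v" by blast
  show False
  proof (cases "v \<in> P 1")
    case True
    obtain h where h: "h \<in> P 2" "h \<notin> P 1" using lt(2) by blast
    have hR: "h \<in> R" using h ideal_inD(1)[OF i(2)] by auto
    have "h \<notin> principal R v"
      using h True ideal_inD(4)[OF i(1)] by (auto elim!: principalE)
    then obtain c n k where c: "c \<in> R" "inverse c \<in> R" "c \<noteq> 0" "k \<in> R" "h = c * u ^ n + v * k"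
      using expansion[OF hR] by blast
    have vP: "v \<in> P 2" using True lt(2) by blast
    have "u ^ n = (- (inverse c * k)) * v + inverse c * h" using c by (simp add: field_simps)
    also have "\<dots> \<in> P 2" using c h vP by (intro ideal_inD(3,4)[OF i(2)]) (auto intro: closed)
    finally have un: "u ^ n \<in> P 2" .
    have "1 \<notin> P 2" using pr(3) ideal_in_eq_ring[OF sub i(2)] by (auto simp: prime_in_def)
    then have "u \<in> P 2"
      using un by (induction n) (use pr(3) u in \<open>auto simp: prime_in_def intro: closed\<close>)
    then have "span2 R u v \<subseteq> P 2"
      using vP by (auto elim!: span2E intro!: ideal_inD(3,4)[OF i(2)])
    then show False using P3 lt(3) by auto
  next
    case False
    obtain n s where s: "s \<in> R" "s \<notin> principal R v" "f = v ^ n * s"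
      using v_adic[OF fR f(2)] by blast
    have "v ^ n * s \<in> P 1 \<Longrightarrow> s \<in> P 1"
    proof (induction n)
      case (Suc n)
      then show ?case using prim[of v "v ^ n * s"] False v s by (auto intro: closed simp: mult.assoc)
    qed simp
    then show False using f s key by blast
  qed
qed

lemma krull_dim: "krull_dim_eq R 2"
proof -
  define P where "P i = (if i = 0 then {0} else if i = 1 then principal R v else span2 R u v)" for i :: nat
  have "v \<in> principal R v" using principalI(1)[OF closed(2), of v] by simp
  moreover have "u \<in> span2 R u v" using in_max(1)[OF closed(2)] by simp
  moreover have "u \<notin> principal R v" using u_pow[of 1] by simp
  ultimately have "{0} \<subset> principal R v" "principal R v \<subset> span2 R u v"
    using v0 principal_max ideal_inD(2)[OF ideal_v] by auto
  then have "\<forall>i<2. P i \<subset> P (Suc i)" by (auto simp: P_def less_2_cases_iff)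
  moreover have "\<forall>i\<le>2. prime_in R (P i)"
    by (auto simp: P_def prime_in_zero prime_in_principal_v prime_in_max)
  ultimately have "prime_chain R 2" unfolding prime_chain_def by blast
  then show ?thesis using no_prime_chain_3 by (simp add: krull_dim_eq_def numeral_eq_Suc)
qed

lemma regular_local2: "regular_local2 R"
proof -
  have "local_ring R" "max_ideal R = span2 R u v"
    using local_ring_of_units[OF sub ideal_max proper unit] by blast+
  then show ?thesis
    unfolding regular_local2_def using krull_dim noeth u v ideal_gen_pair[OF sub u v] by blast
qed

end

text \<open>If a power of one generator were a multiple of the other, \<open>height_one\<close> over
  the prime \<open>{0}\<close> would exclude the middle prime of a chain of length two. Hence no
  such power exists, and the generators form a regular sequence. Any pair of generators is allowed
  because each branch uses its own.\<close>

lemma regular2_of_regular_local2: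
  assumes R: "regular_local2 R" and uv: "u \<in> R" "v \<in> R" "max_ideal R = ideal_gen R {u, v}"
  shows "regular2 R u v"
proof -
  have n: "noetherian R" and l: "local_ring R" and chain: "prime_chain R 2"
    using R by (auto simp: regular_local2_def krull_dim_eq_def)
  note sR = noetherian_subring[OF n]
  have loc: "local2 R a b" if ab: "a \<in> R" "b \<in> R" "max_ideal R = span2 R a b" for a b
  proof
    show "noetherian R" "a \<in> R" "b \<in> R" using n that by auto
    show "inverse r \<in> R" if "r \<in> R" "r \<notin> span2 R a b" for r
      using noetherian_local_units[OF n l] that ab(3) by auto
    show "1 \<notin> span2 R a b"
      using local_ring_maximal[OF l] ideal_in_eq_ring[OF sR] that unfolding maximal_in_def by auto
  qed
  have zero: "ideal_in R {0}" using ideal_in_zero[OF sR] .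
  have prime0: "prime_in R {0}"
    unfolding prime_in_def using zero subring_one[OF sR] by force
  have pow: "a ^ d \<notin> principal R b" if "a \<in> R" "b \<in> R" "max_ideal R = span2 R a b" for a b d
  proof
    interpret local2 R a b using loc that by blast
    assume "a ^ d \<in> principal R b"
    \<comment> \<open>The summand \<open>0 * 0\<close> is the element of the lower prime
      \<open>{0}\<close> in the shape that \<open>height_one\<close> expects.\<close>
    then obtain t where t: "t \<in> R" "a ^ d = b * t + 0 * 0" by (auto elim!: principalE)
    obtain P where P: "\<forall>i\<le>2. prime_in R (P i)" "\<forall>i<2. P i \<subset> P (Suc i)"
      using chain unfolding prime_chain_def by blast
    have lt: "P 0 \<subset> P 1" "P 1 \<subset> P 2"
      using P(2)[rule_format, of 0] P(2)[rule_format, of 1] by (auto simp: numeral_eq_Suc)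
    have pr: "prime_in R (P 0)" "prime_in R (P 1)" "prime_in R (P 2)" using P(1) by auto
    have P2: "P 2 \<subseteq> span2 R a b"
      using pr(3) unfolding prime_in_def by (auto dest: proper_ideal_max)
    have "0 \<in> P 0" using pr(1) by (auto simp: prime_in_def ideal_in_def)
    then have "{0} \<subseteq> P 0" by simp
    then have "{0} \<subset> P 1" using lt(1) by (rule subset_psubset_trans)
    moreover have "P 1 \<noteq> span2 R a b" using lt P2 by auto
    ultimately show False
      by (rule height_one[OF prime0 pr(2) _ _ _ t(1) _ t(2)]) (use closed(1) in auto)
  qed
  have M: "max_ideal R = span2 R u v" using ideal_gen_pair[OF sR uv(1,2)] uv(3) by simp
  then have M': "max_ideal R = span2 R v u" by (simp add: span2_commute)
  interpret local2 R u v using loc uv M by blast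
  show ?thesis
  proof
    show "v \<noteq> 0"
      using pow[OF uv(2,1) M', of 1] ideal_inD(2)[OF ideal_in_principal[OF sR u]] by auto
    show "s \<in> principal R v" if "s \<in> R" "u * s \<in> principal R v" for s
      using prime_principal_of_powers[OF pow[OF uv(1,2) M] u that] pow[OF uv(1,2) M, of 1] by auto
  qed
qed

context regular2 begin

text \<open>The denominators of \<^term>\<open>f\<close> form a principal ideal: modulo \<^term>\<open>v\<close> the pairs
  \<^term>\<open>(s, s * f)\<close> form a rank one module over a discrete valuation ring.\<close>

lemma reduced_denominator:
  assumes q: "q \<in> R" "q \<noteq> 0" "q * f \<in> R"
  shows "\<exists>q\<in>R. q \<noteq> 0 \<and> q * f \<in> R \<and> (\<forall>s\<in>R. s * f \<in> R \<longrightarrow> s \<in> principal R q)"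
proof -
  define J where "J = {s\<in>R. s * f \<in> R}"
  \<comment> \<open>\<open>E r n\<close> says that r has order n in the discrete valuation ring R /
    vR.\<close>
  define E where "E r n \<longleftrightarrow> (\<exists>e h. e \<in> R \<and> inverse e \<in> R \<and> e \<noteq> 0 \<and> h \<in> R \<and> r = e * u ^ n + v * h)" for r n
  \<comment> \<open>If s and \<open>s * f\<close> were always both divisible by v, dividing s by v
    would stay inside \<open>J\<close>, and the descent would give \<open>J = {0}\<close>.\<close>
  have ex: "\<exists>n. \<exists>s\<in>J. E s n \<or> E (s * f) n"
  proof (rule ccontr)
    assume no: "\<nexists>n. \<exists>s\<in>J. E s n \<or> E (s * f) n"
    have "J \<subseteq> {0}"
    proof (rule descent[where w = v, OF ideal_in_zero[OF sub]])
      fix s assume s: "s \<in> J"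
      then have "s \<in> principal R v" "s * f \<in> principal R v"
        using no expansion[of s] expansion[of "s * f"] unfolding E_def J_def by blast+
      then obtain a b where "a \<in> R" "b \<in> R" "s = a * v" "s * f = b * v" by (auto elim!: principalE)
      then have "a * f = b" using v0 by auto
      then show "\<exists>x'\<in>J. s - v * x' \<in> {0}"
        using \<open>a \<in> R\<close> \<open>b \<in> R\<close> \<open>s = a * v\<close> by (intro bexI[of _ a]) (auto simp: J_def)
    qed (auto simp: J_def)
    then show False using q by (auto simp: J_def)
  qed
  define n where "n = (LEAST n. \<exists>s\<in>J. E s n \<or> E (s * f) n)"
  obtain q0 where q0: "q0 \<in> J" "E q0 n \<or> E (q0 * f) n"
    using LeastI_ex[OF ex] unfolding n_def by blast
  have low: "\<exists>a h. a \<in> R \<and> h \<in> R \<and> r = a * u ^ n + v * h" if s: "s \<in> J" "r = s \<or> r = s * f" for r s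
  proof (cases "r \<in> principal R v")
    case True
    then obtain a where "a \<in> R" "r = 0 * u ^ n + v * a" by (auto elim!: principalE)
    then show ?thesis using closed by blast
  next
    case False
    have "r \<in> R" using s by (auto simp: J_def)
    then obtain e m h where e: "e \<in> R" "inverse e \<in> R" "e \<noteq> 0" "h \<in> R" "r = e * u ^ m + v * h"
      using expansion False by blast
    then have "E r m" unfolding E_def by blast
    then have "\<exists>s\<in>J. E s m \<or> E (s * f) m" using s by blast
    then have "n \<le> m" unfolding n_def by (rule Least_le)
    then have "r = (e * u ^ (m - n)) * u ^ n + v * h" using e by (simp add: mult.assoc flip: power_add)
    moreover have "e * u ^ (m - n) \<in> R" using e u by (auto intro: closed)
    ultimately show ?thesis using e by blast
  qed
  have En: "r \<notin> principal R v" if E: "E r n" for r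
  proof
    assume "r \<in> principal R v"
    then obtain a where a: "a \<in> R" "r = a * v" by (rule principalE)
    obtain e h where e: "e \<in> R" "inverse e \<in> R" "e \<noteq> 0" "h \<in> R" "r = e * u ^ n + v * h"
      using E unfolding E_def by blast
    have "u ^ n = (inverse e * (a - h)) * v" using a e by (simp add: field_simps)
    moreover have "inverse e * (a - h) \<in> R" using a e by (intro closed)
    ultimately show False using u_pow[of n] principalI(1) by metis
  qed
  have sub_c: "\<exists>c\<in>R. r - c * r0 \<in> principal R v"
    if E: "E r0 n" and r: "a \<in> R" "k \<in> R" "r = a * u ^ n + v * k" for r0 r a k
  proof -
    obtain e h where e: "e \<in> R" "inverse e \<in> R" "e \<noteq> 0" "h \<in> R" "r0 = e * u ^ n + v * h"
      using E unfolding E_def by blast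
    define c where "c = a * inverse e"
    have "r - c * r0 = (k - c * h) * v" using e r by (simp add: c_def field_simps)
    moreover have "c \<in> R" using e r by (auto simp: c_def intro: closed)
    moreover have "k - c * h \<in> R" using calculation e r by (intro closed)
    ultimately show ?thesis
      using principalI(1)[of "k - c * h" R v] by (intro bexI[of _ c]) auto
  qed
  have q0R: "q0 \<in> R" "q0 * f \<in> R" using q0 by (auto simp: J_def)
  have "J \<subseteq> principal R q0"
  proof (rule descent[where w = v, OF ideal_in_principal[OF sub q0R(1)]])
    fix s assume s: "s \<in> J"
    have sR: "s \<in> R" "s * f \<in> R" using s by (auto simp: J_def)
    \<comment> \<open>The pair of \<open>q0\<close> has an entry of least order, so a multiple of it
      removes the corresponding entry of the pair of s modulo v. The other entry follows from
      proportionality of the pairs and primality of v. Dividing by v then leads back into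
      \<open>J\<close>.\<close>
    have "\<exists>c\<in>R. s - c * q0 \<in> principal R v \<and> s * f - c * (q0 * f) \<in> principal R v"
      using q0(2)
    proof
      assume E: "E q0 n"
      obtain a k where ak: "a \<in> R" "k \<in> R" "s = a * u ^ n + v * k" using low[OF s, of s] by blast
      obtain c where c: "c \<in> R" "s - c * q0 \<in> principal R v" using sub_c[OF E ak] by blast
      have "q0 * (s * f - c * (q0 * f)) = (q0 * f) * (s - c * q0)" by (simp add: algebra_simps)
      then have "q0 * (s * f - c * (q0 * f)) \<in> principal R v"
        using c ideal_inD(4)[OF ideal_v q0R(2)] by metis
      moreover have "s * f - c * (q0 * f) \<in> R" using c sR q0R by (auto intro: closed)
      ultimately show ?thesis
        using v_prime[of q0 "s * f - c * (q0 * f)"] En[OF E] c q0R by blast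
    next
      assume E: "E (q0 * f) n"
      obtain a k where ak: "a \<in> R" "k \<in> R" "s * f = a * u ^ n + v * k" using low[OF s, of "s * f"] by blast
      obtain c where c: "c \<in> R" "s * f - c * (q0 * f) \<in> principal R v" using sub_c[OF E ak] by blast
      have "(q0 * f) * (s - c * q0) = q0 * (s * f - c * (q0 * f))" by (simp add: algebra_simps)
      then have "(q0 * f) * (s - c * q0) \<in> principal R v"
        using c ideal_inD(4)[OF ideal_v q0R(1)] by metis
      moreover have "s - c * q0 \<in> R" using c sR q0R by (auto intro: closed)
      ultimately show ?thesis
        using v_prime[of "q0 * f" "s - c * q0"] En[OF E] c q0R by blast
    qed
    then obtain c a b where c: "c \<in> R" "a \<in> R" "b \<in> R" "s - c * q0 = a * v" "s * f - c * (q0 * f) = b * v"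
      by (auto elim!: principalE)
    have "(a * f) * v = b * v" using c(4,5) by (metis left_diff_distrib mult.assoc mult.commute)
    then have "a * f = b" using v0 by simp
    then have "a \<in> J" using c by (auto simp: J_def)
    moreover have "s - v * a = c * q0" using c(4) by (simp add: algebra_simps)
    ultimately show "\<exists>x'\<in>J. s - v * x' \<in> principal R q0"
      using c principalI(1)[of c R q0] by (intro bexI[of _ a]) auto
  qed (auto simp: J_def)
  moreover have "q0 \<noteq> 0" using calculation q by (auto simp: J_def elim!: principalE)
  ultimately show ?thesis using q0R by (auto simp: J_def)
qed

end

section \<open>Polynomials over a subring and the Hilbert basis theorem\<close>

definition polys :: "'a::field set \<Rightarrow> 'a poly set" where
  "polys R = {p. \<forall>i. coeff p i \<in> R}"

lemma subring_sum: "subring R \<Longrightarrow> (\<And>i. i \<in> S \<Longrightarrow> f i \<in> R) \<Longrightarrow> sum f S \<in> R"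
  by (induction S rule: infinite_finite_induct) (auto intro: subring_closed)

lemma polys_add: "subring R \<Longrightarrow> p \<in> polys R \<Longrightarrow> q \<in> polys R \<Longrightarrow> p + q \<in> polys R"
  and polys_diff: "subring R \<Longrightarrow> p \<in> polys R \<Longrightarrow> q \<in> polys R \<Longrightarrow> p - q \<in> polys R"
  and polys_mult: "subring R \<Longrightarrow> p \<in> polys R \<Longrightarrow> q \<in> polys R \<Longrightarrow> p * q \<in> polys R"
  and polys_smult: "subring R \<Longrightarrow> c \<in> R \<Longrightarrow> p \<in> polys R \<Longrightarrow> smult c p \<in> polys R"
  and polys_monom: "subring R \<Longrightarrow> c \<in> R \<Longrightarrow> monom c n \<in> polys R"
  and polys_zero: "subring R \<Longrightarrow> 0 \<in> polys R"
  by (auto simp: polys_def coeff_mult intro: subring_closed subring_sum)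

lemma polys_pCons: "subring R \<Longrightarrow> pCons c p \<in> polys R \<longleftrightarrow> c \<in> R \<and> p \<in> polys R"
  by (auto simp: polys_def coeff_pCons split: nat.splits)

lemma polys_one: "subring R \<Longrightarrow> 1 \<in> polys R"
  using polys_monom[of R 1 0] subring_one[of R] by (simp add: monom_0 one_pCons)

lemma poly_in_subring: "subring T \<Longrightarrow> p \<in> polys T \<Longrightarrow> w \<in> T \<Longrightarrow> poly p w \<in> T"
  by (induction p) (auto simp: polys_pCons intro: subring_closed)

lemma polys_mono: "R \<subseteq> T \<Longrightarrow> polys R \<subseteq> polys T"
  by (auto simp: polys_def)

lemma adjoin_superset: "R \<union> S \<subseteq> adjoin R S"
  by (auto simp: adjoin_def)

lemma adjoin_least: "subring T \<Longrightarrow> R \<subseteq> T \<Longrightarrow> S \<subseteq> T \<Longrightarrow> adjoin R S \<subseteq> T"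
  by (auto simp: adjoin_def)

lemma subring_adjoin: "subring (adjoin R S)"
  unfolding subring_def adjoin_def by (auto intro: subring_closed)

lemma adjoin_singleton:
  assumes R: "subring R"
  shows "adjoin R {w} = (\<lambda>p. poly p w) ` polys R"
proof
  have "subring ((\<lambda>p. poly p w) ` polys R)"
    unfolding subring_def
  proof (intro conjI ballI)
    show "0 \<in> (\<lambda>p. poly p w) ` polys R" using polys_zero[OF R] by force
    show "1 \<in> (\<lambda>p. poly p w) ` polys R" using polys_one[OF R] by force
    fix a b assume "a \<in> (\<lambda>p. poly p w) ` polys R" "b \<in> (\<lambda>p. poly p w) ` polys R"
    then obtain p q where "p \<in> polys R" "q \<in> polys R" "a = poly p w" "b = poly q w" by auto
    then have "a + b = poly (p + q) w" "a - b = poly (p - q) w" "a * b = poly (p * q) w"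
      "p + q \<in> polys R" "p - q \<in> polys R" "p * q \<in> polys R"
      using polys_add[OF R, of p q] polys_diff[OF R, of p q] polys_mult[OF R, of p q] by auto
    then show "a + b \<in> (\<lambda>p. poly p w) ` polys R" "a - b \<in> (\<lambda>p. poly p w) ` polys R"
      "a * b \<in> (\<lambda>p. poly p w) ` polys R"
      by blast+
  qed
  moreover have "R \<subseteq> (\<lambda>p. poly p w) ` polys R"
  proof
    fix r assume "r \<in> R"
    then show "r \<in> (\<lambda>p. poly p w) ` polys R"
      using R by (intro image_eqI[where x = "[:r:]"]) (auto simp: polys_pCons polys_zero)
  qed
  moreover have "w \<in> (\<lambda>p. poly p w) ` polys R"
    using R by (intro image_eqI[where x = "[:0, 1:]"]) (auto simp: polys_pCons polys_zero intro: subring_closed)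
  ultimately show "adjoin R {w} \<subseteq> (\<lambda>p. poly p w) ` polys R"
    by (intro adjoin_least) auto
  have "R \<subseteq> adjoin R {w}" "w \<in> adjoin R {w}" using adjoin_superset[of R "{w}"] by auto
  then show "(\<lambda>p. poly p w) ` polys R \<subseteq> adjoin R {w}"
    using polys_mono[of R "adjoin R {w}"] poly_in_subring[OF subring_adjoin] by blast
qed

text \<open>Hilbert's argument is run on the polynomials whose value at w lies in the ideal, since
  evaluation at w need not be injective.\<close>

lemma noetherian_adjoin:
  assumes R: "noetherian R"
  shows "noetherian (adjoin R {w})"
proof -
  note sR = noetherian_subring[OF R]
  define A where "A = adjoin R {w}"
  have sA: "subring A" unfolding A_def by (rule subring_adjoin)
  have RA: "r \<in> A" if "r \<in> R" for r using that adjoin_superset[of R "{w}"] by (auto simp: A_def)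
  have wA: "w \<in> A" using adjoin_superset[of R "{w}"] by (auto simp: A_def)
  have "\<exists>S. finite S \<and> S \<subseteq> A \<and> I = ideal_gen A S" if I: "ideal_in A I" for I
  proof -
    define J where "J = {p\<in>polys R. poly p w \<in> I}"
    \<comment> \<open>Polynomials of degree at most n are allowed, so that 0 and sums with
      cancelling leading terms need no special treatment.\<close>
    define L where "L n = {coeff p n | p. p \<in> J \<and> degree p \<le> n}" for n
    have LI: "coeff p n \<in> L n" if "p \<in> J" "degree p \<le> n" for p n
      using that by (auto simp: L_def)
    have iL: "ideal_in R (L n)" for n
      unfolding ideal_in_def
    proof (intro conjI ballI)
      show "L n \<subseteq> R" by (auto simp: L_def J_def polys_def)
      show "0 \<in> L n" using LI[of 0 n] ideal_inD(2)[OF I] polys_zero[OF sR] by (simp add: J_def)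
    next
      fix a b assume "a \<in> L n" "b \<in> L n"
      then obtain p q where p: "p \<in> J" "degree p \<le> n" "a = coeff p n" and q: "q \<in> J" "degree q \<le> n" "b = coeff q n"
        by (auto simp: L_def)
      have "p + q \<in> J" using p q polys_add[OF sR] ideal_inD(3)[OF I] by (auto simp: J_def)
      then show "a + b \<in> L n" using LI[of "p + q" n] p q by (simp add: degree_add_le)
    next
      fix r a assume r: "r \<in> R" and "a \<in> L n"
      then obtain p where p: "p \<in> J" "degree p \<le> n" "a = coeff p n"
        by (auto simp: L_def)
      have "smult r p \<in> J"
        using p r polys_smult[OF sR] ideal_inD(4)[OF I] RA by (auto simp: J_def)
      then show "r * a \<in> L n"
        using LI[of "smult r p" n] p by (simp add: le_trans[OF degree_smult_le])
    qed
    have mono: "L n \<subseteq> L (Suc n)" for n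
    proof
      fix a assume "a \<in> L n"
      then obtain p where p: "p \<in> J" "degree p \<le> n" "a = coeff p n"
        by (auto simp: L_def)
      have "pCons 0 p \<in> J"
        using p ideal_inD(4)[OF I wA] subring_zero[OF sR] by (auto simp: J_def polys_pCons[OF sR])
      then show "a \<in> L (Suc n)"
        using LI[of "pCons 0 p" "Suc n"] p by (simp add: le_trans[OF degree_pCons_le])
    qed
    obtain N where N: "\<forall>n\<ge>N. L n = L N"
      using noetherian_acc[of R L, OF R iL mono] by blast
    have "\<forall>i. \<exists>S. finite S \<and> L i = ideal_gen R S"
      using R iL unfolding noetherian_def by blast
    then obtain S where S: "\<And>i. finite (S i)" "\<And>i. L i = ideal_gen R (S i)" by metis
    have "\<forall>i. \<forall>s\<in>S i. \<exists>p. p \<in> J \<and> degree p \<le> i \<and> coeff p i = s"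
    proof (intro allI ballI)
      fix i s assume "s \<in> S i"
      then have "s \<in> L i" using S(2) ideal_gen_superset by blast
      then show "\<exists>p. p \<in> J \<and> degree p \<le> i \<and> coeff p i = s" by (auto simp: L_def)
    qed
    then obtain pk where pk: "\<And>i s. s \<in> S i \<Longrightarrow> pk i s \<in> J \<and> degree (pk i s) \<le> i \<and> coeff (pk i s) i = s"
      by metis
    define B where "B = (\<Union>i\<le>N. (\<lambda>s. poly (pk i s) w) ` S i)"
    have "finite B" using S(1) by (auto simp: B_def)
    have BI: "B \<subseteq> I" using pk by (auto simp: B_def J_def)
    then have BA: "B \<subseteq> A" using ideal_inD(1)[OF I] by auto
    define G where "G = ideal_gen A B"
    have iG: "ideal_in A G" unfolding G_def using sA BA by (rule ideal_in_ideal_gen)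
    have GI: "G \<subseteq> I" unfolding G_def using I BI by (rule ideal_gen_least)
    have main: "poly p w \<in> G" if "p \<in> J" for p
      using that
    proof (induction "degree p" arbitrary: p rule: less_induct)
      case less
      define d where "d = degree p"
      \<comment> \<open>Above N the coefficient ideals no longer change, so the generators chosen
        for degree N serve after multiplication by a power of the variable.\<close>
      define i where "i = min d N"
      have "L d = L i" using N[rule_format, of d] by (cases "N \<le> d") (simp_all add: i_def min_def)
      then have "coeff p d \<in> ideal_gen R (S i)"
        using LI[OF less.prems, of d] S(2)[of i] by (simp add: d_def)
      \<comment> \<open>These are the coefficients in degree d that can be cancelled by a polynomial
        with value in \<open>G\<close>. They form an ideal containing the generators
        \<open>S i\<close>, hence all of \<open>L i\<close>.\<close>
      define K where "K = {c\<in>R. \<exists>q\<in>polys R. degree q \<le> d \<and> coeff q d = c \<and> poly q w \<in> G}"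
      have "ideal_in R K"
        unfolding ideal_in_def
      proof (intro conjI ballI)
        show "K \<subseteq> R" by (auto simp: K_def)
        show "0 \<in> K" unfolding K_def
          using ideal_inD(2)[OF iG] polys_zero[OF sR] subring_zero[OF sR]
          by (auto intro!: bexI[of _ 0])
      next
        fix a b assume "a \<in> K" "b \<in> K"
        then obtain p q where "p \<in> polys R" "q \<in> polys R" "degree p \<le> d" "degree q \<le> d"
          "a \<in> R" "b \<in> R" "coeff p d = a" "coeff q d = b" "poly p w \<in> G" "poly q w \<in> G"
          by (auto simp: K_def)
        then show "a + b \<in> K"
          unfolding K_def using ideal_inD(3)[OF iG]
          by (auto intro!: bexI[of _ "p + q"] polys_add[OF sR] subring_add[OF sR] degree_add_le)
      next
        fix r a assume "r \<in> R" "a \<in> K"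
        then obtain p where "p \<in> polys R" "degree p \<le> d"
          "a \<in> R" "coeff p d = a" "poly p w \<in> G"
          by (auto simp: K_def)
        then show "r * a \<in> K"
          unfolding K_def using ideal_inD(4)[OF iG, of r] RA \<open>r \<in> R\<close>
          by (auto intro!: bexI[of _ "smult r p"] polys_smult[OF sR] subring_mult[OF sR]
              order_trans[OF degree_smult_le])
      qed
      moreover have "S i \<subseteq> K"
      proof
        fix s assume s: "s \<in> S i"
        define q where "q = monom 1 (d - i) * pk i s"
        have id: "i \<le> d" by (simp add: i_def)
        have "q \<in> polys R"
          unfolding q_def using pk[OF s] subring_one[OF sR]
          by (intro polys_mult[OF sR] polys_monom[OF sR]) (auto simp: J_def)
        moreover have "degree q \<le> d"
          using pk[OF s] id degree_mult_le[of "monom 1 (d - i)" "pk i s"] unfolding q_def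
          by (auto simp: degree_monom_eq)
        moreover have "coeff q d = s"
          using pk[OF s] id by (simp add: q_def coeff_monom_mult)
        moreover have "i \<le> N" by (simp add: i_def)
        then have "poly (pk i s) w \<in> B" using s unfolding B_def by blast
        then have "poly (pk i s) w \<in> G" using ideal_gen_superset[of B A] unfolding G_def by blast
        then have "poly q w \<in> G"
          unfolding q_def using ideal_inD(4)[OF iG subring_power[OF sA wA]] by (simp add: poly_monom)
        moreover have "pk i s \<in> polys R" using pk[OF s] by (simp add: J_def)
        then have "coeff (pk i s) i \<in> R" by (simp add: polys_def)
        then have "s \<in> R" using pk[OF s] by simp
        ultimately show "s \<in> K" unfolding K_def by blast
      qed
      ultimately have "coeff p d \<in> K"
        using ideal_gen_least[of R K "S i"] \<open>coeff p d \<in> ideal_gen R (S i)\<close> by blast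
      then obtain q where q: "q \<in> polys R" "degree q \<le> d" "coeff q d = coeff p d" "poly q w \<in> G"
        by (auto simp: K_def)
      have pq: "p - q \<in> J"
        using less.prems q GI polys_diff[OF sR] ideal_in_diff[OF sA I] by (auto simp: J_def)
      have "poly (p - q) w \<in> G"
      proof (cases "p - q = 0")
        case True
        then show ?thesis using ideal_inD(2)[OF iG] by simp
      next
        case False
        have "degree (p - q) \<le> d" using q by (auto simp: d_def intro: degree_diff_le)
        moreover have "coeff (p - q) d = 0" using q by simp
        then have "degree (p - q) \<noteq> d" using False by (metis leading_coeff_0_iff)
        ultimately show ?thesis using less.hyps[OF _ pq] by (simp add: d_def)
      qed
      then show ?case using ideal_inD(3)[OF iG _ q(4), of "poly (p - q) w"] by simp
    qed
    have "I \<subseteq> G"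
    proof
      fix a assume a: "a \<in> I"
      then have "a \<in> adjoin R {w}" using ideal_inD(1)[OF I] by (auto simp: A_def)
      then obtain p where "p \<in> polys R" "a = poly p w" unfolding adjoin_singleton[OF sR] by auto
      then show "a \<in> G" using main[of p] a by (auto simp: J_def)
    qed
    then show ?thesis using GI \<open>finite B\<close> BA unfolding G_def by blast
  qed
  then show ?thesis using sA unfolding noetherian_def A_def by blast
qed

section \<open>Localization\<close>

lemma localizeI: "r \<in> A \<Longrightarrow> s \<in> A \<Longrightarrow> s \<notin> P \<Longrightarrow> r / s \<in> localize A P"
  by (auto simp: localize_def)

lemma localizeE:
  assumes "f \<in> localize A P"
  obtains r s where "r \<in> A" "s \<in> A" "s \<notin> P" "f = r / s"
  using assms by (auto simp: localize_def)

locale prime_localization =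
  fixes A P :: "'a::field set"
  assumes A: "subring A" and P: "prime_in A P"
begin

lemma ideal_P: "ideal_in A P" using P by (simp add: prime_in_def)

lemma one_P: "1 \<notin> P"
  using P ideal_in_eq_ring[OF A ideal_P] by (auto simp: prime_in_def)

lemma mult_P: "s \<in> A \<Longrightarrow> t \<in> A \<Longrightarrow> s \<notin> P \<Longrightarrow> t \<notin> P \<Longrightarrow> s * t \<notin> P"
  using P by (auto simp: prime_in_def)

lemma nonzero: "s \<notin> P \<Longrightarrow> s \<noteq> 0"
  using ideal_inD(2)[OF ideal_P] by auto

lemma superset: "A \<subseteq> localize A P"
  using localizeI[of _ A 1 P] subring_one[OF A] one_P by auto

lemma inverse_in: "s \<in> A \<Longrightarrow> s \<notin> P \<Longrightarrow> inverse s \<in> localize A P"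
  using localizeI[of 1 A s P] subring_one[OF A] by (simp add: inverse_eq_divide)

lemma subring_localize: "subring (localize A P)"
  unfolding subring_def
proof (intro conjI ballI)
  show "0 \<in> localize A P" "1 \<in> localize A P"
    using superset subring_zero[OF A] subring_one[OF A] by auto
  fix f g assume "f \<in> localize A P" "g \<in> localize A P"
  then obtain a s b t where *: "a \<in> A" "s \<in> A" "s \<notin> P" "f = a / s" "b \<in> A" "t \<in> A" "t \<notin> P" "g = b / t"
    by (auto elim!: localizeE)
  note nz = nonzero[OF *(3)] nonzero[OF *(7)]
  have st: "s * t \<in> A" "s * t \<notin> P" using * mult_P subring_mult[OF A] by auto
  have "f + g = (a * t + b * s) / (s * t)" "f - g = (a * t - b * s) / (s * t)" "f * g = (a * b) / (s * t)"
    using * nz by (auto simp: field_simps)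
  then show "f + g \<in> localize A P" "f - g \<in> localize A P" "f * g \<in> localize A P"
    using * st by (auto intro!: localizeI intro: subring_closed[OF A])
qed

lemma noetherian_localize:
  assumes "noetherian A"
  shows "noetherian (localize A P)"
proof -
  let ?L = "localize A P"
  have "\<exists>S. finite S \<and> S \<subseteq> ?L \<and> I = ideal_gen ?L S" if I: "ideal_in ?L I" for I
  proof -
    have "ideal_in A (I \<inter> A)"
      using ideal_inD(2,3,4)[OF I] superset A unfolding ideal_in_def by (auto intro: subring_closed)
    then obtain S where S: "finite S" "S \<subseteq> A" "I \<inter> A = ideal_gen A S"
      using assms unfolding noetherian_def by blast
    have SL: "S \<subseteq> ?L" using S(2) superset by auto
    have iG: "ideal_in ?L (ideal_gen ?L S)"
      using subring_localize SL by (rule ideal_in_ideal_gen)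
    have "ideal_in A (ideal_gen ?L S \<inter> A)"
      using ideal_inD(2,3,4)[OF iG] superset A unfolding ideal_in_def by (auto intro: subring_closed)
    then have sub: "ideal_gen A S \<subseteq> ideal_gen ?L S"
      using ideal_gen_least[of A "ideal_gen ?L S \<inter> A" S] ideal_gen_superset[of S ?L] S(2) by blast
    have "I \<subseteq> ideal_gen ?L S"
    proof
      fix f assume f: "f \<in> I"
      then obtain r s where rs: "r \<in> A" "s \<in> A" "s \<notin> P" "f = r / s"
        using ideal_inD(1)[OF I] by (auto elim!: localizeE)
      have "r = s * f" using rs nonzero by simp
      then have "r \<in> I \<inter> A" using rs ideal_inD(4)[OF I _ f, of s] superset by auto
      then have "r \<in> ideal_gen ?L S" using S(3) sub by auto
      then have "inverse s * r \<in> ideal_gen ?L S" using ideal_inD(4)[OF iG] inverse_in rs by blast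
      then show "f \<in> ideal_gen ?L S" using rs by (simp add: field_simps)
    qed
    moreover have "S \<subseteq> I" using S ideal_gen_superset[of S A] by blast
    then have "ideal_gen ?L S \<subseteq> I" using ideal_gen_least[OF I] by blast
    ultimately show ?thesis using S SL by blast
  qed
  then show ?thesis using subring_localize unfolding noetherian_def by blast
qed

lemma local_ring_localize: "local_ring (localize A P)"
proof -
  let ?L = "localize A P"
  define M where "M = {r / s | r s. r \<in> P \<and> s \<in> A \<and> s \<notin> P}"
  have PA: "r \<in> A" if "r \<in> P" for r using that ideal_inD(1)[OF ideal_P] by auto
  have MI: "r / s \<in> M" if "r \<in> P" "s \<in> A" "s \<notin> P" for r s using that by (auto simp: M_def)
  have "ideal_in ?L M"
    unfolding ideal_in_def
  proof (intro conjI ballI)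
    show "M \<subseteq> ?L" using PA by (auto simp: M_def intro: localizeI)
    show "0 \<in> M" using MI[of 0 1] ideal_inD(2)[OF ideal_P] subring_one[OF A] one_P by simp
  next
    fix f g assume "f \<in> M" "g \<in> M"
    then obtain a s b t where *: "a \<in> P" "s \<in> A" "s \<notin> P" "f = a / s" "b \<in> P" "t \<in> A" "t \<notin> P" "g = b / t"
      by (auto simp: M_def)
    have "f + g = (t * a + s * b) / (s * t)"
      using * nonzero by (simp add: add_frac_eq ac_simps)
    moreover have "t * a + s * b \<in> P" using * by (intro ideal_inD(3)[OF ideal_P] ideal_inD(4)[OF ideal_P])
    ultimately show "f + g \<in> M" using MI * mult_P subring_mult[OF A] by metis
  next
    fix f g assume "f \<in> ?L" "g \<in> M"
    then obtain a s b t where *: "a \<in> A" "s \<in> A" "s \<notin> P" "f = a / s" "b \<in> P" "t \<in> A" "t \<notin> P" "g = b / t"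
      by (auto simp: M_def elim!: localizeE)
    have "f * g = (a * b) / (s * t)" using * by simp
    moreover have "a * b \<in> P" using * by (intro ideal_inD(4)[OF ideal_P])
    ultimately show "f * g \<in> M" using MI * mult_P subring_mult[OF A] by metis
  qed
  moreover have "1 \<notin> M"
  proof
    assume "1 \<in> M"
    then obtain r s where "r \<in> P" "s \<in> A" "s \<notin> P" "1 = r / s" by (auto simp: M_def)
    then show False using nonzero by auto
  qed
  moreover have "inverse f \<in> ?L" if f: "f \<in> ?L" "f \<notin> M" for f
  proof -
    obtain r s where rs: "r \<in> A" "s \<in> A" "s \<notin> P" "f = r / s" using f(1) by (rule localizeE)
    then have "r \<notin> P" using f MI by auto
    then show ?thesis using rs localizeI[of s A r P] by simp
  qed
  ultimately show ?thesis by (rule local_ring_of_units[OF subring_localize])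
qed

end

section \<open>Quadratic transforms\<close>

text \<open>The local ring, on the chart of the blow-up where v generates the exceptional curve, of
  the point where that curve meets the strict transform of u = 0.\<close>

definition quadratic :: "'a::field set \<Rightarrow> 'a \<Rightarrow> 'a \<Rightarrow> 'a set" where
  "quadratic R u v = localize (adjoin R {u / v}) (ideal_gen (adjoin R {u / v}) {v, u / v})"

context regular2 begin

definition "slope = u / v"
definition "chart = adjoin R {slope}"
definition "centre = span2 chart v slope"

lemma slope0: "slope \<noteq> 0" and v_slope: "v * slope = u"
  using u0 v0 by (auto simp: slope_def)

lemma sub_chart: "subring chart" by (simp add: chart_def subring_adjoin)

lemmas chart_closed = subring_closed[OF sub_chart]

lemma R_chart: "r \<in> R \<Longrightarrow> r \<in> chart" and slope_chart: "slope \<in> chart"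
  using adjoin_superset[of R "{slope}"] by (auto simp: chart_def)

lemma ideal_centre: "ideal_in chart centre"
  unfolding centre_def using sub_chart R_chart[OF v] slope_chart by (rule ideal_in_span2)

lemma quadratic_eq: "quadratic R u v = localize chart centre"
  using ideal_gen_pair[OF sub_chart R_chart[OF v] slope_chart] by (simp add: quadratic_def chart_def centre_def slope_def)

lemma clear_denominator:
  assumes "q \<in> chart"
  shows "\<exists>n. v ^ n * q \<in> R"
proof -
  define T where "T = {q. \<exists>n. v ^ n * q \<in> R}"
  have up: "v ^ (n + m) * q \<in> R" if "v ^ n * q \<in> R" for n m q
  proof -
    have "v ^ m * (v ^ n * q) \<in> R" using that v by (simp add: closed(5,7))
    then show ?thesis by (simp add: power_add ac_simps)
  qed
  have "subring T"
    unfolding subring_def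
  proof (intro conjI ballI)
    show "0 \<in> T" using closed by (auto simp: T_def)
    show "1 \<in> T" using closed unfolding T_def by (auto intro!: exI[of _ 0])
    fix a b assume "a \<in> T" "b \<in> T"
    then obtain n m where nm: "v ^ n * a \<in> R" "v ^ m * b \<in> R" by (auto simp: T_def)
    have "v ^ (n + m) * a \<in> R" "v ^ (n + m) * b \<in> R"
      using up[OF nm(1), of m] up[OF nm(2), of n] by (auto simp: add.commute)
    then have "v ^ (n + m) * a + v ^ (n + m) * b \<in> R" "v ^ (n + m) * a - v ^ (n + m) * b \<in> R"
      by (auto intro: closed)
    then show "a + b \<in> T" "a - b \<in> T"
      unfolding T_def by (auto simp: algebra_simps intro!: exI[of _ "n + m"])
    have "(v ^ n * a) * (v ^ m * b) \<in> R" using nm by (rule closed)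
    then show "a * b \<in> T"
      unfolding T_def by (auto simp: power_add algebra_simps intro!: exI[of _ "n + m"])
  qed
  moreover have "R \<subseteq> T" unfolding T_def by (auto intro!: exI[of _ 0])
  moreover have "slope \<in> T" unfolding T_def using u v_slope by (auto intro!: exI[of _ 1])
  ultimately have "chart \<subseteq> T" unfolding chart_def by (intro adjoin_least) auto
  then show ?thesis using assms by (auto simp: T_def)
qed

lemma split_chart:
  assumes "q \<in> chart"
  shows "\<exists>r\<in>R. \<exists>q'\<in>chart. q = r + slope * q'"
proof -
  define T where "T = {r + slope * q' | r q'. r \<in> R \<and> q' \<in> chart}"
  have TI: "r + slope * q' \<in> T" if "r \<in> R" "q' \<in> chart" for r q' using that by (auto simp: T_def)
  have "subring T"
    unfolding subring_def
  proof (intro conjI ballI)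
    show "0 \<in> T" "1 \<in> T" using TI[of 0 0] TI[of 1 0] closed chart_closed by auto
    fix a b assume "a \<in> T" "b \<in> T"
    then obtain r q s p where *: "r \<in> R" "q \<in> chart" "s \<in> R" "p \<in> chart" "a = r + slope * q" "b = s + slope * p"
      by (auto simp: T_def)
    have "a + b = (r + s) + slope * (q + p)" "a - b = (r - s) + slope * (q - p)"
      "a * b = (r * s) + slope * (r * p + q * s + slope * q * p)"
      using * by (auto simp: algebra_simps)
    moreover have "r \<in> chart" "s \<in> chart" using * R_chart by auto
    then have "r + s \<in> R" "r - s \<in> R" "r * s \<in> R" "q + p \<in> chart" "q - p \<in> chart" "r * p + q * s + slope * q * p \<in> chart"
      using * slope_chart by (auto intro: closed chart_closed)
    ultimately show "a + b \<in> T" "a - b \<in> T" "a * b \<in> T"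
      using TI by (metis (no_types))+
  qed
  moreover have "R \<subseteq> T"
  proof
    fix r assume "r \<in> R"
    then show "r \<in> T" using TI[of r 0] chart_closed by simp
  qed
  moreover have "slope \<in> T" using TI[of 0 1] closed chart_closed by auto
  ultimately have "chart \<subseteq> T" unfolding chart_def by (intro adjoin_least) auto
  then have "q \<in> T" using assms by blast
  then show ?thesis unfolding T_def by blast
qed

text \<open>Clearing denominators turns \<open>r = slope * q\<close> into a power of v times r lying
  in u R, and v is a non-zero-divisor modulo u.\<close>

lemma contract_slope:
  assumes "r \<in> R" "q \<in> chart" "r = slope * q"
  shows "r \<in> principal R u"
proof -
  obtain n where n: "v ^ n * q \<in> R" using clear_denominator[OF assms(2)] by blast
  have "v ^ Suc n * r = v ^ n * q * u" using assms(3) v_slope by (simp add: ac_simps)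
  then have "v ^ Suc n * r \<in> principal R u" using n principalI(1) by metis
  moreover have "v ^ m * r \<in> principal R u \<Longrightarrow> r \<in> principal R u" for m
  proof (induction m)
    case (Suc m)
    then show ?case
      using regular2.regular[OF swap, of "v ^ m * r"] assms(1) v by (auto simp: mult.assoc intro: closed)
  qed simp
  ultimately show ?thesis by blast
qed

text \<open>Membership depends only on the constant term: the quotient of \<open>chart\<close> by
  \<open>centre\<close> is the residue field of R. The direction from left to right rests on
  \<open>contract_slope\<close>.\<close>

lemma in_centre_iff:
  assumes "r \<in> R" "q \<in> chart"
  shows "r + slope * q \<in> centre \<longleftrightarrow> r \<in> span2 R u v"
proof
  assume "r + slope * q \<in> centre"
  then obtain a b where ab: "a \<in> chart" "b \<in> chart" "r + slope * q = a * v + b * slope"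
    unfolding centre_def by (rule span2E)
  obtain a0 a1 where a: "a0 \<in> R" "a1 \<in> chart" "a = a0 + slope * a1" using split_chart[OF ab(1)] by blast
  have eq: "r - a0 * v = slope * (a1 * v + b - q)" using ab(3) a(3) by (simp add: algebra_simps)
  have "r - a0 * v \<in> principal R u"
    by (rule contract_slope[OF _ _ eq]) (use a ab assms v R_chart[OF v] in \<open>auto intro: closed chart_closed\<close>)
  then obtain c where "c \<in> R" "r = c * u + a0 * v" by (auto elim!: principalE simp: algebra_simps)
  then show "r \<in> span2 R u v" using a by (auto intro: span2I)
next
  assume "r \<in> span2 R u v"
  then obtain a b where ab: "a \<in> R" "b \<in> R" "r = a * u + b * v" by (rule span2E)
  moreover have "(a * v + q) * slope = a * u + q * slope" by (simp add: distrib_right mult.assoc v_slope)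
  ultimately have "r + slope * q = b * v + (a * v + q) * slope" by (simp add: mult.commute)
  moreover have "b * v + (a * v + q) * slope \<in> centre"
    unfolding centre_def using ab assms R_chart v by (intro span2I) (auto intro: chart_closed)
  ultimately show "r + slope * q \<in> centre" by simp
qed

lemma prime_centre: "prime_in chart centre"
proof -
  have "a \<in> centre \<or> b \<in> centre" if "a \<in> chart" "b \<in> chart" "a * b \<in> centre" for a b
  proof -
    obtain r q where r: "r \<in> R" "q \<in> chart" "a = r + slope * q" using split_chart[OF \<open>a \<in> chart\<close>] by blast
    obtain s p where s: "s \<in> R" "p \<in> chart" "b = s + slope * p" using split_chart[OF \<open>b \<in> chart\<close>] by blast
    have "a * b = r * s + slope * (r * p + q * s + slope * q * p)" using r s by (auto simp: algebra_simps)
    moreover have "r * p + q * s + slope * q * p \<in> chart" using r s R_chart slope_chart by (auto intro: chart_closed)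
    ultimately have "r * s \<in> span2 R u v"
      using in_centre_iff[of "r * s"] that(3) r s by (auto intro: closed)
    then have "r \<in> span2 R u v \<or> s \<in> span2 R u v"
      using prime_in_max r s by (auto simp: prime_in_def)
    then show ?thesis using in_centre_iff r s by auto
  qed
  moreover have "1 \<notin> centre"
    using in_centre_iff[of 1 0] proper closed chart_closed by auto
  ultimately show ?thesis
    using ideal_centre chart_closed(2) unfolding prime_in_def by auto
qed

sublocale loc: prime_localization chart centre
  using sub_chart prime_centre by unfold_locales

lemma R_quadratic: "R \<subseteq> quadratic R u v"
  using R_chart loc.superset by (auto simp: quadratic_eq)

text \<open>The substantial point is that v is a non-zero-divisor modulo slope. After clearing
  denominators and taking the constant term r of the numerator this becomes: v r in u R implies r in
  u R.\<close>

lemma regular2_quadratic: "regular2 (quadratic R u v) v (u / v)"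
  unfolding quadratic_eq slope_def[symmetric]
proof
  let ?L = "localize chart centre"
  show "noetherian ?L"
    using noetherian_adjoin[OF noeth, of slope] by (intro loc.noetherian_localize) (simp add: chart_def)
  show "v \<in> ?L" "slope \<in> ?L" using R_chart[OF v] slope_chart loc.superset by auto
  show "slope \<noteq> 0" by (rule slope0)
  show "inverse r \<in> ?L" if r: "r \<in> ?L" "r \<notin> span2 ?L v slope" for r
  proof -
    obtain a s where as: "a \<in> chart" "s \<in> chart" "s \<notin> centre" "r = a / s" using r(1) by (rule localizeE)
    have "a \<notin> centre"
    proof
      assume "a \<in> centre"
      then obtain b c where bc: "b \<in> chart" "c \<in> chart" "a = b * v + c * slope" unfolding centre_def by (rule span2E)
      have "r = (b / s) * v + (c / s) * slope" using bc as by (simp add: add_divide_distrib)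
      also have "\<dots> \<in> span2 ?L v slope" using bc as by (intro span2I localizeI)
      finally show False using r(2) by simp
    qed
    then show ?thesis using as localizeI[of s chart a centre] by simp
  qed
  show "1 \<notin> span2 ?L v slope"
  proof
    assume "1 \<in> span2 ?L v slope"
    then obtain f g where "f \<in> ?L" "g \<in> ?L" "1 = f * v + g * slope" by (rule span2E)
    then obtain a s b t where *: "a \<in> chart" "s \<in> chart" "s \<notin> centre" "b \<in> chart" "t \<in> chart" "t \<notin> centre"
      "1 = a / s * v + b / t * slope" by (auto elim!: localizeE)
    then have "s * t = (a * t) * v + (b * s) * slope"
      using loc.nonzero[of s] loc.nonzero[of t] by (simp add: field_simps)
    moreover have "(a * t) * v + (b * s) * slope \<in> centre"
      unfolding centre_def using * by (auto intro!: span2I intro: chart_closed)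
    ultimately show False using loc.mult_P[of s t] * by auto
  qed
  show "f \<in> principal ?L slope" if f: "f \<in> ?L" "v * f \<in> principal ?L slope" for f
  proof -
    obtain a s where as: "a \<in> chart" "s \<in> chart" "s \<notin> centre" "f = a / s" using f(1) by (rule localizeE)
    obtain b t where bt: "b \<in> chart" "t \<in> chart" "t \<notin> centre" "v * f = b / t * slope"
      using f(2) by (auto elim!: localizeE principalE)
    have nz: "s \<noteq> 0" "t \<noteq> 0" using as bt loc.nonzero by auto
    have "v * (a * t) = s * t * (v * f)" using as(4) nz by simp
    also have "\<dots> = slope * (b * s)" unfolding bt(4) using nz by simp
    finally have eq: "v * (a * t) = slope * (b * s)" .
    obtain r q where r: "r \<in> R" "q \<in> chart" "a * t = r + slope * q"
      using split_chart[OF chart_closed(5)[OF as(1) bt(2)]] by blast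
    have eq': "v * r = slope * (b * s - v * q)" using eq unfolding r(3) by (simp add: algebra_simps)
    have "v * r \<in> principal R u"
      by (rule contract_slope[OF _ _ eq']) (use r as bt R_chart[OF v] v in \<open>auto intro: closed chart_closed\<close>)
    then have "r \<in> principal R u" using regular2.regular[OF swap] r by blast
    then obtain c where c: "c \<in> R" "r = c * u" by (rule principalE)
    have "(c * v + q) * slope = c * u + q * slope" by (simp add: distrib_right mult.assoc v_slope)
    then have "a * t = (c * v + q) * slope" using r c by (simp add: mult.commute)
    moreover have "f = (a * t) / (s * t)" using as(4) nz by simp
    ultimately have "f = ((c * v + q) / (s * t)) * slope" by simp
    moreover have "(c * v + q) / (s * t) \<in> ?L"
      using c r as bt R_chart[OF v] R_chart[OF c(1)] loc.mult_P by (intro localizeI) (auto intro: chart_closed)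
    ultimately show ?thesis using principalI(1) by metis
  qed
qed

text \<open>In \<open>f = a / s\<close> the denominator s is a unit of the transform, and powers of
  v bring both a and s into R. Hence f has a denominator in R that is a unit times a power of
  v.\<close>

lemma quadratic_denominator:
  assumes "f \<in> quadratic R u v"
  shows "\<exists>c n e. c \<in> R \<and> c \<noteq> 0 \<and> c * f \<in> R \<and> c = v ^ n * e \<and> e \<in> quadratic R u v \<and> inverse e \<in> quadratic R u v"
proof -
  obtain a s where as: "a \<in> chart" "s \<in> chart" "s \<notin> centre" "f = a / s"
    using assms unfolding quadratic_eq by (rule localizeE)
  obtain n m where nm: "v ^ n * a \<in> R" "v ^ m * s \<in> R"
    using clear_denominator[OF as(1)] clear_denominator[OF as(2)] by blast
  define c where "c = v ^ (n + m) * s"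
  have s0: "s \<noteq> 0" using as loc.nonzero by auto
  have "v ^ n * (v ^ m * s) \<in> R" "v ^ m * (v ^ n * a) \<in> R" using nm v by (auto intro: closed)
  then have "c \<in> R" "c * f \<in> R" using as s0 by (auto simp: c_def power_add ac_simps)
  moreover have "c \<noteq> 0" using s0 v0 by (simp add: c_def)
  moreover have "s \<in> quadratic R u v" "inverse s \<in> quadratic R u v"
    using as loc.superset loc.inverse_in by (auto simp: quadratic_eq)
  ultimately show ?thesis unfolding c_def by blast
qed

end

section \<open>Two successive quadratic transforms\<close>

definition unit_of :: "'a::field set \<Rightarrow> 'a \<Rightarrow> bool" where
  "unit_of T e \<longleftrightarrow> e \<in> T \<and> inverse e \<in> T \<and> e \<noteq> 0"

lemma unit_of_mult: "subring T \<Longrightarrow> unit_of T a \<Longrightarrow> unit_of T b \<Longrightarrow> unit_of T (a * b)"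
  by (auto simp: unit_of_def intro: subring_closed)

lemma unit_of_inverse: "unit_of T a \<Longrightarrow> unit_of T (inverse a)"
  by (auto simp: unit_of_def)

lemma poly_factor_X:
  fixes Q :: "'a::field poly"
  assumes "Q \<noteq> 0"
  shows "\<exists>s Q1. Q = monom 1 s * Q1 \<and> coeff Q1 0 \<noteq> 0"
  using assms
proof (induction Q)
  case (pCons a Q)
  show ?case
  proof (cases "a = 0")
    case True
    then have "Q \<noteq> 0" using pCons by auto
    then obtain s Q1 where "Q = monom 1 s * Q1" "coeff Q1 0 \<noteq> 0" using pCons.IH by blast
    then show ?thesis using True
      by (intro exI[of _ "Suc s"] exI[of _ Q1]) (simp add: monom_Suc)
  next
    case False
    then show ?thesis by (intro exI[of _ 0] exI[of _ "pCons a Q"]) (simp add: monom_0 flip: one_pCons)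
  qed
qed simp

text \<open>The n-th power of the ideal (x, y) R, written so that inductions split off a single
  factor x or y.\<close>

primrec mpow :: "'a::field set \<Rightarrow> 'a \<Rightarrow> 'a \<Rightarrow> nat \<Rightarrow> 'a set" where
  "mpow R x y 0 = R"
| "mpow R x y (Suc n) = {x * a + y * b | a b. a \<in> mpow R x y n \<and> b \<in> mpow R x y n}"

text \<open>One ring of the intersection. For parameters \<open>(x + a * y, y)\<close> of D,
  \<open>S\<close> and \<open>B\<close> are the rings alpha and beta at a; for \<open>(y, x)\<close>
  they are the two primed rings.\<close>

locale branch = regular2 +
  fixes k :: "'a set"
  assumes k: "subfield k" "k \<subseteq> R"
begin

text \<open>\<^term>\<open>slope\<close> and \<open>z\<close> are local equations of the two exceptional curves, which meet in the
  closed point of \<open>B\<close>.\<close>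

definition "S = quadratic R u v"
definition "B = quadratic S v slope"
definition "z = v / slope"

sublocale al: regular2 S v slope
  unfolding S_def slope_def by (rule regular2_quadratic)

sublocale be: regular2 B slope z
  unfolding B_def z_def by (rule al.regular2_quadratic)

lemma slope_z: "slope * z = v" using slope0 by (simp add: z_def)

lemma v_power: "v ^ n = slope ^ n * z ^ n"
  by (simp add: slope_z flip: power_mult_distrib)

lemma RS: "r \<in> R \<Longrightarrow> r \<in> S" using R_quadratic by (auto simp: S_def)
lemma SB: "s \<in> S \<Longrightarrow> s \<in> B" using al.R_quadratic by (auto simp: B_def)
lemma RB: "r \<in> R \<Longrightarrow> r \<in> B" using RS SB by blast

lemma unit_SB: "unit_of S e \<Longrightarrow> unit_of B e"
  using SB by (auto simp: unit_of_def)

text \<open>The value is its constant term, a nonzero element of the field k, modulo slope.\<close>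

lemma poly_unit:
  assumes Q: "Q \<in> polys k" "coeff Q 0 \<noteq> 0"
  shows "unit_of S (poly Q slope)"
proof -
  obtain c Q' where Q': "Q = pCons c Q'" by (cases Q)
  have sk: "subring k" using k by (simp add: subfield_def)
  have kS: "k \<subseteq> S" using k RS by auto
  have c: "c \<in> k" "c \<noteq> 0" "Q' \<in> polys k" using Q by (auto simp: Q' polys_pCons[OF sk])
  then have "inverse c \<in> S" "c \<in> S" using k kS by (auto simp: subfield_def)
  then have "c \<notin> span2 S v slope" using al.nonunit_max c by blast
  have p: "poly Q' slope \<in> S"
    using c polys_mono[OF kS] by (intro poly_in_subring[OF al.sub] al.v) auto
  then have m: "poly Q' slope * slope \<in> span2 S v slope" by (rule al.in_max)
  have "poly Q slope \<notin> span2 S v slope"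
  proof
    assume "poly Q slope \<in> span2 S v slope"
    then have "poly Q slope - poly Q' slope * slope \<in> span2 S v slope"
      using m by (rule ideal_in_diff[OF al.sub al.ideal_max])
    then show False using \<open>c \<notin> _\<close> by (simp add: Q' mult.commute)
  qed
  moreover have "poly Q slope \<in> S"
    using p \<open>c \<in> S\<close> al.v by (auto simp: Q' intro: al.closed)
  ultimately show ?thesis using al.nonunit_max by (auto simp: unit_of_def)
qed

lemma poly_slope:
  assumes Q: "Q \<in> polys k" "Q \<noteq> 0"
  shows "\<exists>s e. unit_of B e \<and> poly Q slope = slope ^ s * e \<and> monom 1 s dvd Q \<and> (\<forall>n. monom 1 n dvd Q \<longrightarrow> n \<le> s)"
proof -
  obtain s Q1 where Q1: "Q = monom 1 s * Q1" "coeff Q1 0 \<noteq> 0" using poly_factor_X[OF Q(2)] by blast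
  have "coeff Q1 i \<in> k" for i
    using Q(1) unfolding polys_def Q1(1) by (auto simp: coeff_monom_mult dest!: spec[of _ "i + s"])
  then have "unit_of B (poly Q1 slope)" using Q1(2) by (intro unit_SB poly_unit) (auto simp: polys_def)
  moreover have "n \<le> s" if "monom 1 n dvd Q" for n
    using that Q1 unfolding monom_1_dvd_iff' by (metis coeff_monom_mult diff_self_eq_0 le_refl mult_1 not_le)
  ultimately show ?thesis using Q1
    by (intro exI[of _ s] exI[of _ "poly Q1 slope"]) (auto simp: poly_monom)
qed

lemma poly_slope_nonzero: "Q \<in> polys k \<Longrightarrow> Q \<noteq> 0 \<Longrightarrow> poly Q slope \<noteq> 0"
  using poly_slope[of Q] slope0 by (auto simp: unit_of_def)

lemma unit_not_max: "unit_of B e \<Longrightarrow> e \<notin> span2 B slope z"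
  using be.nonunit_max by (auto simp: unit_of_def)

lemma slope_unit_z:
  assumes "unit_of B e"
  shows "slope ^ n * e \<notin> principal B z"
proof
  assume "slope ^ n * e \<in> principal B z"
  then have "e \<in> principal B z"
    using be.v_prime[of "slope ^ n" e] be.u_pow assms be.u by (auto simp: unit_of_def intro: be.closed)
  then show False using unit_not_max[OF assms] be.principal_max by auto
qed

text \<open>Comparison of orders in B / zB, a discrete valuation ring with parameter slope.\<close>

lemma slope_exponent:
  assumes e: "unit_of B e" and hd: "h \<in> B" "d \<in> B" and eq: "slope ^ a * e = slope ^ b * h + z * d"
  shows "b \<le> a"
proof (rule ccontr)
  assume "\<not> b \<le> a"
  then obtain c where c: "b = a + Suc c" using less_imp_Suc_add by (metis add_Suc_right not_le)
  have eB: "e \<in> B" using e by (simp add: unit_of_def)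
  define h' where "h' = slope ^ c * h"
  have h': "h' \<in> B" using hd be.u by (auto simp: h'_def intro: be.closed)
  have "slope ^ a * (e - h' * slope) = d * z"
    using eq by (simp add: c h'_def power_add algebra_simps)
  then have "slope ^ a * (e - h' * slope) \<in> principal B z" using principalI(1)[OF hd(2)] by simp
  then have "e - h' * slope \<in> principal B z"
    using be.v_prime[of "slope ^ a" "e - h' * slope"] be.u_pow[of a] h' eB be.u by (auto intro: be.closed)
  then have "e - h' * slope \<in> span2 B slope z" using be.principal_max by auto
  then have "(e - h' * slope) + h' * slope \<in> span2 B slope z"
    using be.in_max(1)[OF h'] by (intro ideal_inD(3)[OF be.ideal_max])
  then show False using unit_not_max[OF e] by simp
qed

text \<open>z is prime and does not divide a unit times a power of slope, so each factor z on the
  left must come from X.\<close>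

lemma z_power_dvd:
  assumes "X \<in> B" "a \<in> B" "unit_of B e" "z ^ r * a = slope ^ s * e * X"
  shows "\<exists>Y\<in>B. X = z ^ r * Y"
  using assms
proof (induction r arbitrary: X)
  case (Suc r)
  have eB: "e \<in> B" using Suc.prems by (simp add: unit_of_def)
  have "slope ^ s * e * X = z ^ r * a * z" using Suc.prems by (simp add: ac_simps)
  moreover have "z ^ r * a \<in> B" using be.v Suc.prems by (auto intro: be.closed)
  ultimately have "slope ^ s * e * X \<in> principal B z" using principalI(1) by metis
  moreover have "slope ^ s * e \<in> B" using eB be.u by (auto intro: be.closed)
  ultimately have "X \<in> principal B z"
    using be.v_prime[of "slope ^ s * e" X] slope_unit_z[OF Suc.prems(3)] Suc.prems(1) by blast
  then obtain X' where X': "X' \<in> B" "X = X' * z" by (rule principalE)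
  have "z * (z ^ r * a) = z * (slope ^ s * e * X')" using Suc.prems X' by (simp add: ac_simps)
  then have "z ^ r * a = slope ^ s * e * X'" using be.v0 by simp
  then obtain Y where "Y \<in> B" "X' = z ^ r * Y" using Suc.IH X' Suc.prems by blast
  then show ?case using X' by (auto intro!: bexI[of _ Y])
qed auto

text \<open>Put v = slope * z. If j < e, then P(slope) would be divisible by z, which a unit times a
  power of slope is not. If e is at most j, set r = j - e: after cancelling \<open>v ^ e\<close> and
  \<open>z ^ r\<close>, reading the equation modulo z gives ord Q at most r + ord P for the orders
  at 0. The r is the order of \<open>v ^ r\<close> along slope = 0.\<close>

lemma initial_form_dvd:
  assumes P: "P \<in> polys k" and Q: "Q \<in> polys k" "Q \<noteq> 0" and dl: "dl \<in> S"
    and f: "v ^ j * (poly P slope + v * dl) / (v ^ e * poly Q slope) \<in> B"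
  shows "j < e \<Longrightarrow> P = 0"
    and "e \<le> j \<Longrightarrow> monom 1 (j - e + n) dvd Q \<Longrightarrow> monom 1 n dvd P"
proof -
  define X where "X = v ^ j * (poly P slope + v * dl) / (v ^ e * poly Q slope)"
  have X: "X \<in> B" using f by (simp add: X_def)
  have dB: "dl \<in> B" using dl SB by blast
  obtain s eq where Qs: "unit_of B eq" "poly Q slope = slope ^ s * eq" "monom 1 s dvd Q"
      "\<forall>n. monom 1 n dvd Q \<longrightarrow> n \<le> s"
    using poly_slope[OF Q] by blast
  have eqB: "eq \<in> B" "eq \<noteq> 0" using Qs by (auto simp: unit_of_def)
  have main: "v ^ j * (poly P slope + v * dl) = v ^ e * (slope ^ s * eq) * X"
    using poly_slope_nonzero[OF Q] v0 by (simp add: X_def Qs(2))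
  note cl = eqB X dB be.u be.v
  { assume je: "j < e" show "P = 0"
  proof (rule ccontr)
    assume "P \<noteq> 0"
    then obtain l ep where Pl: "unit_of B ep" "poly P slope = slope ^ l * ep"
      using poly_slope[OF P] by blast
    obtain c where c: "e = j + Suc c" using je less_imp_Suc_add by (metis add_Suc_right)
    have "v ^ j * (poly P slope + v * dl) = v ^ j * (v * (v ^ c * slope ^ s * eq * X))"
      unfolding main by (simp add: c power_add ac_simps)
    then have "poly P slope + v * dl = v * (v ^ c * slope ^ s * eq * X)" using v0 by simp
    then have "slope ^ l * ep = v * (v ^ c * slope ^ s * eq * X - dl)"
      using Pl by (simp add: algebra_simps)
    also have "\<dots> = slope * (v ^ c * slope ^ s * eq * X - dl) * z"
      using slope_z by (metis mult.commute mult.left_commute)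
    finally have "slope ^ l * ep = slope * (v ^ c * slope ^ s * eq * X - dl) * z" .
    moreover have "slope * (v ^ c * slope ^ s * eq * X - dl) \<in> B"
      using cl RB[OF v] by (intro be.closed)
    ultimately have "slope ^ l * ep \<in> principal B z" using principalI(1) by metis
    then show False using slope_unit_z[OF Pl(1)] by blast
  qed }
  { assume ej: "e \<le> j" and n: "monom 1 (j - e + n) dvd Q"
    show "monom 1 n dvd P"
    proof (cases "P = 0")
      case False
      then obtain l ep where Pl: "unit_of B ep" "poly P slope = slope ^ l * ep" "monom 1 l dvd P"
        using poly_slope[OF P] by blast
      have epB: "ep \<in> B" using Pl by (simp add: unit_of_def)
      define r where "r = j - e"
      have j: "j = e + r" using ej by (simp add: r_def)
      have "v ^ e * (v ^ r * (slope ^ l * ep + v * dl)) = v ^ e * (slope ^ s * eq * X)"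
        using main by (simp add: j power_add Pl(2) ac_simps)
      then have "v ^ r * (slope ^ l * ep + v * dl) = slope ^ s * eq * X" using v0 by simp
      then have zr: "z ^ r * (slope ^ r * (slope ^ l * ep + v * dl)) = slope ^ s * eq * X"
        by (simp add: v_power ac_simps)
      moreover have "slope ^ r * (slope ^ l * ep + v * dl) \<in> B"
        using cl epB RB[OF v] by (intro be.closed)
      ultimately obtain Y where Y: "Y \<in> B" "X = z ^ r * Y"
        using z_power_dvd[OF X _ Qs(1)] by blast
      have "z ^ r * (slope ^ r * (slope ^ l * ep + v * dl)) = z ^ r * (slope ^ s * eq * Y)"
        using zr Y by (simp add: ac_simps)
      then have "slope ^ r * (slope ^ l * ep + v * dl) = slope ^ s * (eq * Y)"
        using be.v0 by (simp add: ac_simps)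
      then have "slope ^ r * (slope ^ l * ep + slope * z * dl) = slope ^ s * (eq * Y)"
        unfolding slope_z .
      then have "slope ^ (r + l) * ep = slope ^ s * (eq * Y) + z * (- (slope ^ Suc r * dl))"
        by (simp add: power_add algebra_simps)
      then have "s \<le> r + l"
        by (rule slope_exponent[OF Pl(1), rotated 2]) (use Y cl in \<open>auto intro!: be.closed\<close>)
      then have "n \<le> l" using Qs(4) n by (auto simp: r_def)
      then show ?thesis using Pl(3) by (simp add: monom_1_dvd_iff')
    qed simp }
qed

text \<open>The quotient is 1 + v dl / Q(slope), which in general may have slope in its denominator.
  Since the numerator is a monomial, comparing powers of z gives j = e, and then comparing powers of
  slope modulo z gives i = e + ord Q, so only units remain.\<close>

lemma initial_form_unit:
  assumes Q: "Q \<in> polys k" "Q \<noteq> 0" and dl: "dl \<in> S" and et: "unit_of B et"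
    and q: "v ^ e * (poly Q slope + v * dl) = slope ^ i * z ^ j * et"
  shows "unit_of B (v ^ e * (poly Q slope + v * dl) / (v ^ e * poly Q slope))"
proof -
  have dB: "dl \<in> B" using dl SB by blast
  obtain s ep where Qs: "unit_of B ep" "poly Q slope = slope ^ s * ep"
    using poly_slope[OF Q] by blast
  have un: "ep \<in> B" "ep \<noteq> 0" "et \<in> B" "et \<noteq> 0" using Qs et by (auto simp: unit_of_def)
  note cl = un dB be.u be.v
  have main: "z ^ e * (slope ^ (e + s) * ep + z * (slope ^ Suc e * dl)) = z ^ j * (slope ^ i * et)"
  proof -
    have "slope ^ e * z ^ e * (slope ^ s * ep + slope * z * dl) = slope ^ i * z ^ j * et"
      unfolding slope_z using q by (simp add: Qs(2) v_power)
    then show ?thesis by (simp add: power_add algebra_simps)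
  qed
  have "\<not> j < e"
  proof
    assume "j < e"
    then obtain c where c: "e = j + Suc c" using less_imp_Suc_add by (metis add_Suc_right)
    have "z ^ j * (slope ^ i * et) = z ^ j * ((z ^ c * (slope ^ (e + s) * ep + z * (slope ^ Suc e * dl))) * z)"
      unfolding main[symmetric] by (simp add: c power_add ac_simps)
    then have "slope ^ i * et = (z ^ c * (slope ^ (e + s) * ep + z * (slope ^ Suc e * dl))) * z"
      using be.v0 by simp
    moreover have "z ^ c * (slope ^ (e + s) * ep + z * (slope ^ Suc e * dl)) \<in> B"
      using cl by (intro be.closed)
    ultimately have "slope ^ i * et \<in> principal B z" using principalI(1) by metis
    then show False using slope_unit_z[OF et] by blast
  qed
  moreover have "\<not> e < j"
  proof
    assume "e < j"
    then obtain c where c: "j = e + Suc c" using less_imp_Suc_add by (metis add_Suc_right)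
    have "z ^ e * (slope ^ (e + s) * ep + z * (slope ^ Suc e * dl)) = z ^ e * (z ^ c * (slope ^ i * et) * z)"
      unfolding main by (simp add: c power_add ac_simps)
    then have "slope ^ (e + s) * ep + z * (slope ^ Suc e * dl) = z ^ c * (slope ^ i * et) * z"
      using be.v0 by simp
    then have "slope ^ (e + s) * ep = (z ^ c * (slope ^ i * et) - slope ^ Suc e * dl) * z"
      by (simp add: algebra_simps)
    moreover have "z ^ c * (slope ^ i * et) - slope ^ Suc e * dl \<in> B"
      using cl by (intro be.closed)
    ultimately have "slope ^ (e + s) * ep \<in> principal B z" using principalI(1) by metis
    then show False using slope_unit_z[OF Qs(1)] by blast
  qed
  ultimately have je: "j = e" by simp
  then have eq: "slope ^ (e + s) * ep + z * (slope ^ Suc e * dl) = slope ^ i * et"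
    using main be.v0 by simp
  have "e + s \<le> i"
    by (rule slope_exponent[OF et _ _ eq[symmetric]]) (use cl in \<open>auto intro!: be.closed\<close>)
  moreover have "slope ^ (e + s) * ep = slope ^ i * et + z * (- (slope ^ Suc e * dl))"
    using eq by (simp add: algebra_simps)
  then have "i \<le> e + s"
    by (rule slope_exponent[OF Qs(1), rotated 2]) (use cl in \<open>auto intro!: be.closed\<close>)
  ultimately have i: "i = e + s" by simp
  have "v ^ e * (poly Q slope + v * dl) / (v ^ e * poly Q slope) = et * inverse ep"
    unfolding q using be.v0 slope0 un
    by (simp add: je i Qs(2) power_add v_power field_simps)
  then show ?thesis using unit_of_mult[OF be.sub et unit_of_inverse[OF Qs(1)]] by simp
qed

lemma B_denominator:
  assumes f: "f \<in> B"
  shows "\<exists>c\<in>R. c * f \<in> R \<and> (\<exists>i j e. unit_of B e \<and> c = slope ^ i * z ^ j * e)"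
proof -
  obtain c1 n e1 where c1: "c1 \<in> S" "c1 * f \<in> S" "c1 = slope ^ n * e1" "e1 \<in> B" "inverse e1 \<in> B" "c1 \<noteq> 0"
    using al.quadratic_denominator[of f] f unfolding B_def by blast
  obtain c2 m e2 where c2: "c2 \<in> R" "c2 * c1 \<in> R" "c2 = v ^ m * e2" "e2 \<in> S" "inverse e2 \<in> S" "c2 \<noteq> 0"
    using quadratic_denominator[of c1] c1 unfolding S_def by blast
  obtain c3 l e3 where c3: "c3 \<in> R" "c3 * (c1 * f) \<in> R" "c3 = v ^ l * e3" "e3 \<in> S" "inverse e3 \<in> S" "c3 \<noteq> 0"
    using quadratic_denominator[of "c1 * f"] c1 unfolding S_def by blast
  \<comment> \<open>\<open>c1\<close> clears f only into \<open>S\<close>. Both \<open>c1\<close>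
    and \<open>c1 * f\<close> must still be brought into R, by \<open>c2\<close> and
    \<open>c3\<close>; each factor is a unit of B times a power of slope or of v = slope *
    z.\<close>
  define c where "c = c3 * (c2 * c1)"
  have "c \<in> R" using c2 c3 by (auto simp: c_def intro: closed)
  moreover have "c2 * (c3 * (c1 * f)) \<in> R" using c2(1) c3(2) by (rule closed)
  then have "c * f \<in> R" by (simp add: c_def ac_simps)
  moreover have "unit_of B (e1 * (e2 * e3))"
    using c1 c2 c3 SB by (intro unit_of_mult[OF be.sub]) (auto simp: unit_of_def)
  moreover have "c = slope ^ (n + m + l) * z ^ (m + l) * (e1 * (e2 * e3))"
    by (simp add: c_def c1(3) c2(3) c3(3) power_add v_power ac_simps)
  ultimately show ?thesis by blast
qed

text \<open>slope and z are both prime in B, so the factors of the monomial can be distributed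
  between a and b one at a time.\<close>

lemma monomial_divisor:
  assumes "a \<in> B" "b \<in> B" "unit_of B e" "a * b = slope ^ i * z ^ j * e"
  shows "\<exists>i j e. unit_of B e \<and> a = slope ^ i * z ^ j * e"
  using assms
proof (induction "i + j" arbitrary: i j a b)
  case 0
  then have ab: "a * b = e" by simp
  then have "a \<noteq> 0" "b \<noteq> 0" using 0 by (auto simp: unit_of_def)
  then have "inverse a = b * inverse e" using ab by (auto simp: field_simps)
  then have "unit_of B a" using 0 \<open>a \<noteq> 0\<close> by (auto simp: unit_of_def intro: be.closed)
  then show ?case by (intro exI[of _ 0] exI[of _ a]) simp
next
  case (Suc m)
  note e = Suc.prems(3)
  have eB: "e \<in> B" using e by (simp add: unit_of_def)
  have step: "\<exists>i j e. unit_of B e \<and> a = slope ^ i * z ^ j * e"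
    if t: "t = slope \<or> t = z" "t \<noteq> 0" and ij: "m = i' + j'" "a * b = t * (slope ^ i' * z ^ j' * e)"
      and prime: "\<And>a b. a \<in> B \<Longrightarrow> b \<in> B \<Longrightarrow> a * b \<in> principal B t \<Longrightarrow> a \<in> principal B t \<or> b \<in> principal B t"
    for t i' j'
  proof -
    have "slope ^ i' * z ^ j' * e \<in> B" using be.u be.v eB by (intro be.closed)
    then have "a * b \<in> principal B t" unfolding ij(2) by (rule principalI)
    then consider "a \<in> principal B t" | "b \<in> principal B t" using prime Suc.prems by blast
    then show ?thesis
    proof cases
      case 1
      then obtain a' where a': "a' \<in> B" "a = a' * t" by (rule principalE)
      then have "a' * b = slope ^ i' * z ^ j' * e" using ij(2) t(2) by (simp add: ac_simps)
      then obtain i j e' where ije: "unit_of B e'" "a' = slope ^ i * z ^ j * e'"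
        using Suc.hyps(1)[OF ij(1) a'(1) Suc.prems(2) e] by blast
      then have "a = slope ^ Suc i * z ^ j * e' \<or> a = slope ^ i * z ^ Suc j * e'"
        using t(1) a'(2) by (auto simp: ac_simps)
      then show ?thesis using ije by blast
    next
      case 2
      then obtain b' where b': "b' \<in> B" "b = b' * t" by (rule principalE)
      then have "a * b' = slope ^ i' * z ^ j' * e" using ij(2) t(2) by (simp add: ac_simps)
      then show ?thesis using Suc.hyps(1)[OF ij(1) Suc.prems(1) b'(1) e] by blast
    qed
  qed
  show ?case
  proof (cases i)
    case (Suc i')
    then show ?thesis
      using step[of slope i' j] Suc.hyps(2) Suc.prems(4) slope0 regular2.v_prime[OF be.swap]
      by (simp add: ac_simps)
  next
    case 0
    then obtain j' where "j = Suc j'" using Suc.hyps(2) by (cases j) auto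
    then show ?thesis
      using step[of z 0 j'] Suc.hyps(2) Suc.prems(4) 0 be.v0 be.v_prime by (simp add: ac_simps)
  qed
qed

text \<open>f has some denominator in R that is monomial in B, and by minimality q divides
  it.\<close>

lemma reduced_denominator_monomial:
  assumes "f \<in> B" "q \<in> R" "\<forall>s\<in>R. s * f \<in> R \<longrightarrow> s \<in> principal R q"
  shows "\<exists>i j e. unit_of B e \<and> q = slope ^ i * z ^ j * e"
proof -
  obtain c i j e where c: "c \<in> R" "c * f \<in> R" "unit_of B e" "c = slope ^ i * z ^ j * e"
    using B_denominator[OF assms(1)] by blast
  then obtain b where "b \<in> R" "q * b = slope ^ i * z ^ j * e"
    using assms(3) by (auto elim!: principalE simp: mult.commute)
  then show ?thesis using monomial_divisor[of q b] c RB assms(2) by blast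
qed

lemma mpow_v:
  assumes xy: "x' \<in> S" "y' \<in> S" and p: "p \<in> mpow R (v * x') (v * y') n"
  shows "\<exists>dl\<in>S. p = v ^ n * dl"
  using p
proof (induction n arbitrary: p)
  case 0
  then show ?case using RS by auto
next
  case (Suc n)
  then obtain a b where ab: "a \<in> mpow R (v * x') (v * y') n" "b \<in> mpow R (v * x') (v * y') n"
    "p = v * x' * a + v * y' * b" by auto
  obtain c d where "c \<in> S" "d \<in> S" "a = v ^ n * c" "b = v ^ n * d" using Suc.IH[OF ab(1)] Suc.IH[OF ab(2)] by blast
  then have "p = v ^ Suc n * (x' * c + y' * d)" "x' * c + y' * d \<in> S"
    using ab(3) xy by (auto simp: algebra_simps intro: al.closed)
  then show ?case by blast
qed

text \<open>The n-th power of the ideal lies in \<open>v ^ n\<close> times \<open>S\<close>, and a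
  nonzero element has finite v-order there.\<close>

lemma finite_order:
  assumes "x' \<in> S" "y' \<in> S" "p \<in> R" "p \<noteq> 0"
  shows "\<exists>n. p \<notin> mpow R (v * x') (v * y') n"
proof (rule ccontr)
  assume no: "\<nexists>n. p \<notin> mpow R (v * x') (v * y') n"
  obtain n s where s: "s \<in> S" "s \<notin> principal S v" "p = v ^ n * s"
    \<comment> \<open>\<open>S\<close> has the parameters v and slope in this order, so the v-adic
      statement comes from the swapped instance.\<close>
    using regular2.v_adic[OF al.swap RS[OF assms(3)] assms(4)] by blast
  obtain dl where dl: "dl \<in> S" "p = v ^ Suc n * dl" using mpow_v[OF assms(1,2)] no by blast
  then have "s = dl * v" using s v0 by simp
  then show False using s dl principalI(1) by metis
qed

end

section \<open>Partial fractions\<close>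

text \<open>As the divisor is monic, the coefficients of H are determined from the top down without
  division. The counter m is 0 above the degree of H, where they vanish.\<close>

lemma polys_divide_linear:
  fixes H :: "'a::field poly"
  assumes k: "subring k" "a \<in> k" and H: "[:a, 1:] * H \<in> polys k"
  shows "H \<in> polys k"
proof -
  have "coeff H i \<in> k" if "m = Suc (degree H) - i" for m i
    using that
  proof (induction m arbitrary: i)
    case 0
    then show ?case using k by (simp add: coeff_eq_0 subring_zero)
  next
    case (Suc m)
    have "coeff H i = coeff ([:a, 1:] * H) (Suc i) - a * coeff H (Suc i)" by simp
    moreover have "coeff H (Suc i) \<in> k" using Suc by auto
    moreover have "coeff ([:a, 1:] * H) (Suc i) \<in> k" using H unfolding polys_def by blast
    ultimately show ?case using k by (simp only: subring_diff subring_mult)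
  qed
  then show ?thesis by (auto simp: polys_def)
qed

lemma polys_divide_linear_power:
  fixes H :: "'a::field poly"
  assumes k: "subring k" "a \<in> k"
  shows "[:a, 1:] ^ n * H \<in> polys k \<Longrightarrow> H \<in> polys k"
proof (induction n)
  case (Suc n)
  then show ?case
    using polys_divide_linear[OF k, of "[:a, 1:] ^ n * H"] by (simp only: power_Suc mult.assoc)
qed simp

lemma linear_power_dvd_cancel:
  fixes X :: "'a::field poly"
  assumes "a \<noteq> b" and dvd: "[:b, 1:] ^ n dvd [:a, 1:] ^ l * X"
  shows "[:b, 1:] ^ n dvd X"
proof (cases "X = 0")
  case False
  have nz: "[:a, 1:] ^ l * X \<noteq> 0" using False by simp
  have "poly ([:a, 1:] ^ l) (- b) \<noteq> 0" using assms(1) by (simp add: poly_power)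
  then have "order (- b) ([:a, 1:] ^ l) = 0" by (rule order_0I)
  then have "order (- b) ([:a, 1:] ^ l * X) = order (- b) X" using nz by (simp add: order_mult)
  then show ?thesis using dvd nz False order_divides[of "- b" n] by (metis minus_minus)
qed simp

text \<open>Each step lowers deg Q by removing one root -a, which lies in k as k is algebraically
  closed. If P vanishes there too, the factor cancels. Otherwise the leading polar term at -a is
  subtracted; the pole condition bounds its order by r, so the term is a product of
  generators.\<close>

lemma partial_fractions:
  fixes A k :: "'a::field set"
  assumes A: "subring A" and k: "alg_closed_subfield k" "k \<subseteq> A"
    and trans: "\<And>Q. Q \<in> polys k \<Longrightarrow> Q \<noteq> 0 \<Longrightarrow> poly Q t \<noteq> 0"
    and gens: "y \<in> A" "y * t \<in> A" "y * t ^ 2 \<in> A" "\<And>a. a \<in> k \<Longrightarrow> y / (t + a) \<in> A"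
    and P: "P \<in> polys k" and Q: "Q \<in> polys k" "Q \<noteq> 0"
    and pole: "\<And>a n. a \<in> k \<Longrightarrow> [:a, 1:] ^ (r + n) dvd Q \<Longrightarrow> [:a, 1:] ^ n dvd P"
    and deg: "degree P \<le> degree Q + 2 * r"
  shows "y ^ r * poly P t / poly Q t \<in> A"
  using P Q pole deg
proof (induction "degree Q" arbitrary: P Q)
  have fk: "subfield k" using k by (simp add: alg_closed_subfield_def)
  then have sk: "subring k" by (simp add: subfield_def)
  have inv: "inverse c \<in> k" if "c \<in> k" for c
    using fk that subring_zero[OF sk] by (cases "c = 0") (auto simp: subfield_def)
  note cl = subring_closed[OF A]
  {
    case 0
    obtain q where q: "Q = [:q:]" using 0(1) by (metis degree_eq_zeroE)
    have "q \<in> k" using 0 by (simp add: q polys_pCons[OF sk])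
    \<comment> \<open>Up to exponent r the factors y and y t suffice; beyond it, i - r factors y t^2
      and 2 r - i factors y t have total degree r in y and i in t.\<close>
    have pw: "y ^ r * t ^ i \<in> A" if "i \<le> 2 * r" for i
    proof (cases "i \<le> r")
      case True
      have "y ^ (r - i) * (y * t) ^ i \<in> A" by (rule cl(5)[OF cl(7)[OF gens(1)] cl(7)[OF gens(2)]])
      moreover have "y ^ (r - i) * y ^ i = y ^ r" using True by (simp flip: power_add)
      ultimately show ?thesis by (simp add: power_mult_distrib flip: mult.assoc)
    next
      case False
      have "(y * t ^ 2) ^ (i - r) * (y * t) ^ (2 * r - i) \<in> A"
        by (rule cl(5)[OF cl(7)[OF gens(3)] cl(7)[OF gens(2)]])
      also have "(y * t ^ 2) ^ (i - r) * (y * t) ^ (2 * r - i)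
        = y ^ ((i - r) + (2 * r - i)) * t ^ (2 * (i - r) + (2 * r - i))"
        by (simp only: power_mult_distrib power_add power_mult) (simp only: ac_simps)
      also have "(i - r) + (2 * r - i) = r" using False that by auto
      also have "2 * (i - r) + (2 * r - i) = i" using False that by auto
      finally show ?thesis .
    qed
    have "y ^ r * poly P t / poly Q t = (\<Sum>i\<le>degree P. (inverse q * coeff P i) * (y ^ r * t ^ i))"
      by (simp add: q poly_altdef sum_distrib_left sum_divide_distrib field_simps)
    also have "\<dots> \<in> A"
    proof (rule subring_sum[OF A])
      fix i assume "i \<in> {..degree P}"
      then have "i \<le> 2 * r" using 0 by auto
      moreover have "coeff P i \<in> A" "inverse q \<in> A"
        using 0(2) inv[OF \<open>q \<in> k\<close>] k(2) by (auto simp: polys_def)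
      ultimately show "inverse q * coeff P i * (y ^ r * t ^ i) \<in> A" by (intro cl(5)[OF cl(5) pw])
    qed
    finally show ?case .
  next
    case (Suc d)
    have "\<forall>i. coeff Q i \<in> k" "degree Q > 0" using Suc.prems(2) Suc.hyps(2) by (auto simp: polys_def)
    then obtain c where c: "c \<in> k" "poly Q c = 0"
      using k(1) unfolding alg_closed_subfield_def by blast
    define a where "a = - c"
    have ak: "a \<in> k" using c sk by (auto simp: a_def intro: subring_closed)
    have ca: "c = - a" by (simp add: a_def)
    obtain Q2 where Q2: "Q = [:a, 1:] * Q2"
      using c(2) by (auto simp: poly_eq_0_iff_dvd ca)
    have Q2k: "Q2 \<in> polys k" using Suc.prems(2) unfolding Q2 by (rule polys_divide_linear[OF sk ak])
    have Q20: "Q2 \<noteq> 0" using Suc.prems(3) Q2 by auto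
    have degQ: "degree Q = Suc (degree Q2)"
      using Q20 unfolding Q2 by (subst degree_mult_eq) auto
    then have d: "d = degree Q2" using Suc.hyps(2) by simp
    have nz: "t + a \<noteq> 0" "poly Q2 t \<noteq> 0"
      using trans[of "[:a, 1:]"] trans[OF Q2k Q20] ak sk
      by (auto simp: polys_pCons polys_zero subring_one add.commute)
    have cancel: "y ^ r * poly ([:a, 1:] * H) t / poly Q t = y ^ r * poly H t / poly Q2 t" for H
    proof -
      have "poly ([:a, 1:] * H) t = (t + a) * poly H t" for H by (simp add: algebra_simps)
      then show ?thesis using nz unfolding Q2 by (metis mult.left_commute mult_divide_mult_cancel_left)
    qed
    show ?case
    proof (cases "[:a, 1:] dvd P")
      case True
      then obtain P2 where P2: "P = [:a, 1:] * P2" by (auto elim: dvdE)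
      have "y ^ r * poly P2 t / poly Q2 t \<in> A"
      proof (rule Suc.hyps(1)[OF d _ Q2k Q20])
        show "P2 \<in> polys k" using Suc.prems(1) unfolding P2 by (rule polys_divide_linear[OF sk ak])
        show "degree P2 \<le> degree Q2 + 2 * r"
        proof (cases "P2 = 0")
          case False
          then have "degree P = Suc (degree P2)" unfolding P2 by (subst degree_mult_eq) auto
          then show ?thesis using Suc.prems(5) degQ by simp
        qed simp
        fix b n assume b: "b \<in> k" "[:b, 1:] ^ (r + n) dvd Q2"
        show "[:b, 1:] ^ n dvd P2"
        proof (cases "a = b")
          case True
          have "[:b, 1:] ^ (r + Suc n) dvd Q" using b(2) unfolding Q2 True add_Suc_right power_Suc by (rule mult_dvd_mono[OF dvd_refl])
          then have "[:b, 1:] ^ Suc n dvd P" by (rule Suc.prems(4)[OF b(1)])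
          then show ?thesis unfolding P2 True power_Suc by (subst (asm) dvd_mult_cancel_left) auto
        next
          case False
          have "[:b, 1:] ^ (r + n) dvd Q" using b(2) unfolding Q2 by (rule dvd_mult)
          then have "[:b, 1:] ^ n dvd P" by (rule Suc.prems(4)[OF b(1)])
          then show ?thesis using linear_power_dvd_cancel[OF False, of n 1 P2] by (simp add: P2)
        qed
      qed
      moreover have "y ^ r * poly P t / poly Q t = y ^ r * poly P2 t / poly Q2 t"
        unfolding P2 by (rule cancel)
      ultimately show ?thesis by simp
    next
      case False
      define l where "l = order c Q"
      obtain Q1 where Q1: "Q = [:a, 1:] ^ l * Q1" "\<not> [:a, 1:] dvd Q1"
        using order_decomp[OF Suc.prems(3), of c] by (auto simp: l_def a_def)
      have Q1k: "Q1 \<in> polys k" using Suc.prems(2) unfolding Q1(1) by (rule polys_divide_linear_power[OF sk ak])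
      have Q1a: "poly Q1 c \<noteq> 0" using Q1(2) by (simp add: poly_eq_0_iff_dvd ca)
      \<comment> \<open>A pole of order above r would satisfy the pole condition with n = 1 and
        force P to vanish at -a.\<close>
      have "l \<le> r"
      proof (rule ccontr)
        assume "\<not> l \<le> r"
        then have "[:a, 1:] ^ (r + 1) dvd [:a, 1:] ^ l" by (intro le_imp_power_dvd) simp
        then have "[:a, 1:] ^ (r + 1) dvd Q" unfolding Q1(1) by (rule dvd_mult2)
        then have "[:a, 1:] ^ 1 dvd P" by (rule Suc.prems(4)[OF ak])
        then show False using False by simp
      qed
      \<comment> \<open>\<open>la\<close> is the coefficient of the leading polar term: it makes
        \<open>P - la * Q1\<close> vanish at c = -a, so that one factor of the denominator
        cancels.\<close>
      define la where "la = poly P c * inverse (poly Q1 c)"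
      have lak: "la \<in> k"
        unfolding la_def using Suc.prems(1) Q1k c(1)
        by (intro subring_mult[OF sk] inv poly_in_subring[OF sk])
      define N where "N = P - smult la Q1"
      have "poly N c = 0" using Q1a by (simp add: N_def la_def)
      then obtain P2 where P2: "N = [:a, 1:] * P2" by (auto simp: poly_eq_0_iff_dvd ca)
      have Nk: "N \<in> polys k" unfolding N_def using Suc.prems(1) Q1k lak
        by (intro polys_diff[OF sk] polys_smult[OF sk])
      have "y ^ r * poly P2 t / poly Q2 t \<in> A"
      proof (rule Suc.hyps(1)[OF d _ Q2k Q20])
        show "P2 \<in> polys k" using Nk unfolding P2 by (rule polys_divide_linear[OF sk ak])
        show "degree P2 \<le> degree Q2 + 2 * r"
        proof (cases "P2 = 0")
          case False
          then have "degree N = Suc (degree P2)" unfolding P2 by (subst degree_mult_eq) auto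
          moreover have "Q1 \<noteq> 0" using Q1a by auto
          then have "degree Q1 \<le> degree Q" unfolding Q1(1) by (subst degree_mult_eq) auto
          then have "degree N \<le> degree Q + 2 * r"
            unfolding N_def using Suc.prems(5) degree_smult_le[of la Q1] by (intro degree_diff_le) linarith+
          ultimately show ?thesis using degQ by simp
        qed simp
        fix b n assume b: "b \<in> k" "[:b, 1:] ^ (r + n) dvd Q2"
        show "[:b, 1:] ^ n dvd P2"
        proof (cases "a = b")
          case True
          \<comment> \<open>At b = a the premise cannot hold: together with the removed factor it
            would give Q a zero of order above r, contradicting that P does not vanish
            there.\<close>
          have "[:b, 1:] ^ (r + Suc n) dvd Q" using b(2) unfolding Q2 True add_Suc_right power_Suc by (rule mult_dvd_mono[OF dvd_refl])
          then have "[:b, 1:] ^ Suc n dvd P" by (rule Suc.prems(4)[OF b(1)])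
          then have "[:b, 1:] dvd P" unfolding power_Suc by (rule dvd_mult_left)
          then show ?thesis using \<open>\<not> [:a, 1:] dvd P\<close> True by simp
        next
          case False
          have Qb: "[:b, 1:] ^ (r + n) dvd Q" using b(2) unfolding Q2 by (rule dvd_mult)
          then have "[:b, 1:] ^ n dvd P" by (rule Suc.prems(4)[OF b(1)])
          moreover have "[:b, 1:] ^ n dvd Q" using Qb unfolding power_add by (rule dvd_mult_right)
          then have "[:b, 1:] ^ n dvd Q1" unfolding Q1(1) by (rule linear_power_dvd_cancel[OF False])
          ultimately have "[:b, 1:] ^ n dvd N" unfolding N_def by (intro dvd_diff dvd_smult)
          then show ?thesis using linear_power_dvd_cancel[OF False, of n 1 P2] by (simp add: P2)
        qed
      qed
      moreover have "la * y ^ (r - l) * (y / (t + a)) ^ l \<in> A"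
        using lak k(2) cl(5)[OF cl(5)[OF _ cl(7)[OF gens(1)]] cl(7)[OF gens(4)[OF ak]]] by blast
      ultimately have "y ^ r * poly P2 t / poly Q2 t + la * y ^ (r - l) * (y / (t + a)) ^ l \<in> A" by (rule cl)
      moreover have "y ^ r * poly P t / poly Q t = y ^ r * poly P2 t / poly Q2 t + la * y ^ (r - l) * (y / (t + a)) ^ l"
      proof -
        have "Q1 \<noteq> 0" using Q1a by auto
        then have Q1t: "poly Q t = (t + a) ^ l * poly Q1 t" "poly Q1 t \<noteq> 0"
          using trans[OF Q1k] unfolding Q1(1) by (auto simp: poly_power add.commute)
        have "la * y ^ (r - l) * (y / (t + a)) ^ l = la * y ^ r / (t + a) ^ l"
          using \<open>l \<le> r\<close> by (simp add: power_divide flip: power_add)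
        also have "\<dots> = y ^ r * (la * poly Q1 t) / poly Q t"
          using Q1t nz by simp
        also have "y ^ r * poly P2 t / poly Q2 t = y ^ r * poly N t / poly Q t"
          unfolding P2 by (rule cancel[symmetric])
        moreover have "poly P t = poly N t + la * poly Q1 t" by (simp add: N_def)
        ultimately show ?thesis by (simp add: distrib_left add_divide_distrib)
      qed
      ultimately show ?thesis by simp
    qed
  }
qed

section \<open>Binary forms as univariate polynomials\<close>

lemma polys_pcompose: "subring k \<Longrightarrow> P \<in> polys k \<Longrightarrow> L \<in> polys k \<Longrightarrow> pcompose P L \<in> polys k"
  by (induction P) (auto simp: pcompose_pCons polys_pCons intro!: polys_add polys_mult polys_zero)

lemma pcompose_power: "pcompose (p ^ n) L = pcompose p L ^ n" for p :: "'a::field poly"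
  by (induction n) (simp_all add: pcompose_mult pcompose_1)

lemma monom_dvd_shift:
  fixes P :: "'a::field poly"
  shows "monom 1 n dvd pcompose P [:- a, 1:] \<longleftrightarrow> [:a, 1:] ^ n dvd P"
proof
  assume "[:a, 1:] ^ n dvd P"
  then obtain H where "P = [:a, 1:] ^ n * H" by (auto elim: dvdE)
  then have "pcompose P [:- a, 1:] = monom 1 n * pcompose H [:- a, 1:]"
    by (simp add: pcompose_mult pcompose_power pcompose_pCons monom_altdef)
  then show "monom 1 n dvd pcompose P [:- a, 1:]" by simp
next
  assume "monom 1 n dvd pcompose P [:- a, 1:]"
  then obtain H where H: "pcompose P [:- a, 1:] = [:0, 1:] ^ n * H" by (auto elim: dvdE simp: monom_altdef)
  have "P = pcompose (pcompose P [:- a, 1:]) [:a, 1:]"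
    by (simp add: pcompose_pCons flip: pcompose_assoc)
  also have "\<dots> = [:a, 1:] ^ n * pcompose H [:a, 1:]"
    unfolding H by (simp add: pcompose_mult pcompose_power pcompose_pCons)
  finally show "[:a, 1:] ^ n dvd P" by (metis dvd_triv_left)
qed

text \<open>The coefficients of a binary form of degree j read in the opposite direction. Reversal
  is relative to j rather than to the degree of P, since the form may lack its top powers of
  x.\<close>

definition flip_poly :: "nat \<Rightarrow> 'a::field poly \<Rightarrow> 'a poly" where
  "flip_poly j P = (\<Sum>i\<le>j. monom (coeff P i) (j - i))"

lemma coeff_flip_poly: "coeff (flip_poly j P) m = (if m \<le> j then coeff P (j - m) else 0)"
proof -
  have "coeff (flip_poly j P) m = (\<Sum>i\<le>j. if j - i = m then coeff P i else 0)"
    by (simp add: flip_poly_def coeff_sum)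
  also have "\<dots> = (\<Sum>i\<le>j. if i = j - m then (if m \<le> j then coeff P i else 0) else 0)"
    by (intro sum.cong) auto
  also have "\<dots> = (if m \<le> j then coeff P (j - m) else 0)" by (subst sum.delta) auto
  finally show ?thesis .
qed

lemma poly_flip_poly:
  assumes "degree P \<le> j" "x \<noteq> 0" "y \<noteq> 0"
  shows "y ^ j * poly P (x / y) = x ^ j * poly (flip_poly j P) (y / x)"
proof -
  have "poly P (x / y) = (\<Sum>i\<le>j. coeff P i * (x / y) ^ i)"
    unfolding poly_altdef using assms(1) by (intro sum.mono_neutral_left) (auto simp: coeff_eq_0)
  then have "y ^ j * poly P (x / y) = (\<Sum>i\<le>j. coeff P i * (y ^ j * (x / y) ^ i))"
    by (simp add: sum_distrib_left ac_simps)
  also have "\<dots> = (\<Sum>i\<le>j. coeff P i * (x ^ j * (y / x) ^ (j - i)))"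
  proof (rule sum.cong[OF refl])
    fix i assume "i \<in> {..j}"
    then have "i + (j - i) = j" by simp
    then have "y ^ j = y ^ i * y ^ (j - i)" "x ^ j = x ^ i * x ^ (j - i)" by (simp_all flip: power_add)
    then show "coeff P i * (y ^ j * (x / y) ^ i) = coeff P i * (x ^ j * (y / x) ^ (j - i))"
      using assms by (simp add: power_divide)
  qed
  also have "\<dots> = x ^ j * poly (flip_poly j P) (y / x)"
    by (simp add: flip_poly_def poly_sum poly_monom sum_distrib_left ac_simps)
  finally show ?thesis .
qed

text \<open>For finite k, 1 plus the product of all X - c would have no root in k.\<close>

lemma infinite_alg_closed:
  assumes "alg_closed_subfield k"
  shows "infinite k"
proof
  assume fin: "finite k"
  have sk: "subring k" using assms by (simp add: alg_closed_subfield_def subfield_def)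
  define p where "p = (\<Prod>c\<in>k. [:- c, 1:])"
  have "(\<Prod>c\<in>K. [:- c, 1:]) \<in> polys k" if "K \<subseteq> k" for K
    using finite_subset[OF that fin] that
    by (induction K rule: finite_induct)
      (auto intro!: polys_mult[OF sk] simp: polys_one[OF sk] polys_pCons[OF sk] polys_zero[OF sk]
        subring_one[OF sk] subring_uminus[OF sk] simp del: mult_pCons_left)
  then have "p + 1 \<in> polys k" unfolding p_def by (intro polys_add[OF sk] polys_one[OF sk]) auto
  moreover have "degree p = card k" unfolding p_def by (subst degree_prod_eq_sum_degree) auto
  then have "degree p > 0" using fin subring_zero[OF sk] by (auto simp: card_gt_0_iff)
  then have "degree (p + 1) > 0" by (simp add: degree_add_eq_left)
  ultimately obtain c where c: "c \<in> k" "poly (p + 1) c = 0"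
    using assms unfolding alg_closed_subfield_def polys_def by blast
  have "poly p c = 0" unfolding p_def poly_prod using fin c(1) by (auto intro!: bexI[of _ c])
  then show False using c by simp
qed

section \<open>The intersection of the second transforms\<close>

locale fan =
  fixes D k :: "'a::field set" and x y :: 'a
  assumes D: "regular_local2 D"
    and quot: "quotient_field_is_univ D"
    and x: "x \<in> D" and y: "y \<in> D"
    and max: "max_ideal D = ideal_gen D {x, y}"
    and coeff: "coefficient_field D k"
    and alg: "alg_closed_subfield k"
begin

lemma subD: "subring D"
  using D noetherian_subring by (auto simp: regular_local2_def)

lemma fk: "subfield k" and kD: "k \<subseteq> D"
  using coeff by (auto simp: coefficient_field_def)

lemma sk: "subring k"
  using fk by (simp add: subfield_def)

lemma kD': "a \<in> k \<Longrightarrow> a \<in> D" using kD by auto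

lemma max_span: "max_ideal D = span2 D x y"
  using max ideal_gen_pair[OF subD x y] by simp

lemma branch_shift: 
  assumes "a \<in> k"
  shows "branch D (x + a * y) y k"
proof -
  have aD: "a \<in> D" using assms kD' by simp
  have xa: "x + a * y \<in> D" using x y aD by (intro subring_closed[OF subD])
  have "span2 D (x + a * y) y = span2 D x y"
  proof (intro equalityI subsetI)
    fix r assume "r \<in> span2 D (x + a * y) y"
    then obtain p q where pq: "p \<in> D" "q \<in> D" "r = p * (x + a * y) + q * y" by (rule span2E)
    then have "r = p * x + (p * a + q) * y" by (simp add: algebra_simps)
    moreover have "p * a + q \<in> D" using pq aD by (intro subring_closed[OF subD])
    ultimately show "r \<in> span2 D x y" using pq span2I by metis
  next
    fix r assume "r \<in> span2 D x y"
    then obtain p q where pq: "p \<in> D" "q \<in> D" "r = p * x + q * y" by (rule span2E)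
    then have "r = p * (x + a * y) + (q - p * a) * y" by (simp add: algebra_simps)
    moreover have "q - p * a \<in> D" using pq aD by (intro subring_closed[OF subD])
    ultimately show "r \<in> span2 D (x + a * y) y" using pq span2I by metis
  qed
  then have "max_ideal D = ideal_gen D {x + a * y, y}"
    using max_span ideal_gen_pair[OF subD xa y] by simp
  then have "regular2 D (x + a * y) y" by (rule regular2_of_regular_local2[OF D xa y])
  then show ?thesis using fk kD by (simp add: branch_def branch_axioms_def)
qed

lemma branch_flip: "branch D y x k"
proof -
  have "max_ideal D = ideal_gen D {y, x}" using max by (simp add: insert_commute)
  then have "regular2 D y x" by (rule regular2_of_regular_local2[OF D y x])
  then show ?thesis using fk kD by (simp add: branch_def branch_axioms_def)
qed

lemma x0: "x \<noteq> 0" and y0: "y \<noteq> 0"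
proof -
  interpret branch D y x k by (rule branch_flip)
  show "x \<noteq> 0" "y \<noteq> 0" by (rule v0, rule u0)
qed

lemma xa0: "a \<in> k \<Longrightarrow> x + a * y \<noteq> 0"
proof -
  assume "a \<in> k"
  then interpret branch D "x + a * y" y k by (rule branch_shift)
  show "x + a * y \<noteq> 0" by (rule u0)
qed

text \<open>The points of the exceptional curve over k, namely infinity and the elements of k, each
  given by its parameters, so that all rings of the intersection are handled uniformly.\<close>

definition "pairs = insert (y, x) ((\<lambda>a. (x + a * y, y)) ` k)"

lemma branch_pairs: "(u, v) \<in> pairs \<Longrightarrow> branch D u v k"
  using branch_shift branch_flip by (auto simp: pairs_def)

section \<open>The ring A and its ideal m inside each ring of the intersection\<close>

abbreviation "beta u v \<equiv> branch.B D u v"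

definition "T = (\<Inter>(u, v)\<in>pairs. beta u v)"

definition "G = {y\<^sup>2 / (x + a * y) | a. a \<in> k} \<union> {x\<^sup>2 / y}"
definition "A = adjoin D G"
definition "m = ideal_gen A ({x, y} \<union> G)"
definition "C = localize A m"

lemma subA: "subring A" by (simp add: A_def subring_adjoin)

lemma DA: "d \<in> D \<Longrightarrow> d \<in> A" and GA: "g \<in> G \<Longrightarrow> g \<in> A"
  using adjoin_superset[of D G] by (auto simp: A_def)

lemma kA: "k \<subseteq> A" using kD DA by auto

lemma ideal_m: "ideal_in A m"
  unfolding m_def using DA GA x y by (intro ideal_in_ideal_gen[OF subA]) auto

lemma gens_m: "x \<in> m" "y \<in> m" "g \<in> G \<Longrightarrow> g \<in> m"
  using ideal_gen_superset[of "{x, y} \<union> G" A] by (auto simp: m_def)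

text \<open>Blowing up makes the maximal ideal of D principal, generated by v.\<close>

lemma coordinates:
  assumes "(u, v) \<in> pairs"
  shows "\<exists>x' y'. x' \<in> branch.S D u v \<and> y' \<in> branch.S D u v \<and> x = v * x' \<and> y = v * y'"
proof -
  interpret branch D u v k using assms by (rule branch_pairs)
  consider "u = y" "v = x" | a where "a \<in> k" "u = x + a * y" "v = y"
    using assms by (auto simp: pairs_def)
  then show ?thesis
  proof cases
    case 1
    have "y = x * slope" using v_slope 1 by simp
    then show ?thesis using al.closed(2) al.v 1 by (intro exI[of _ 1] exI[of _ slope]) auto
  next
    case 2
    have "v * (slope - a) = u - v * a" using v_slope by (simp add: algebra_simps)
    then have "x = v * (slope - a)" using 2 by (simp add: algebra_simps)
    moreover have "slope - a \<in> S" using al.v RS kD' 2 by (intro al.closed) auto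
    ultimately show ?thesis using al.closed(2) 2 by (intro exI[of _ "slope - a"] exI[of _ 1]) auto
  qed
qed

lemma linear_unit:
  assumes "(u, v) \<in> pairs" "a \<in> k" "b \<in> k" "a \<noteq> 0"
  shows "unit_of (branch.S D u v) (a + b * (u / v))"
proof -
  interpret branch D u v k using assms by (auto intro: branch_pairs)
  have "unit_of S (poly [:a, b:] slope)"
    using assms by (intro poly_unit) (auto simp: polys_pCons[OF sk] polys_zero[OF sk])
  then show ?thesis by (simp add: slope_def mult.commute)
qed

text \<open>x + b y is y times (b - a) + slope, a unit for b different from a: the direction of b
  does not pass through the point a.\<close>

lemma shift_gen:
  assumes a: "a \<in> k" and b: "b \<in> k" "b \<noteq> a"
  shows "y\<^sup>2 / (x + b * y) \<in> principal (beta (x + a * y) y) y"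
proof -
  interpret branch D "x + a * y" y k using a by (rule branch_shift)
  have pr: "(x + a * y, y) \<in> pairs" using a by (auto simp: pairs_def)
  define e where "e = (b - a) + 1 * ((x + a * y) / y)"
  have e: "unit_of S e"
    unfolding e_def using a b sk by (intro linear_unit pr) (auto intro: subring_closed)
  have "y * e = x + b * y" using y0 by (simp add: e_def field_simps)
  then have "y\<^sup>2 / (x + b * y) = y\<^sup>2 / (y * e)" by simp
  also have "\<dots> = inverse e * y" using y0 by (simp add: power2_eq_square divide_inverse)
  finally show ?thesis using principalI(1)[of "inverse e" B y] e SB by (auto simp: unit_of_def)
qed

text \<open>The generator of \<open>G\<close> belonging to the branch is z itself. All the others,
  like x and y, are multiples of v = slope * z.\<close>

lemma gens_z:
  assumes "(u, v) \<in> pairs" "g \<in> {x, y} \<union> G"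
  shows "g \<in> principal (beta u v) (branch.z u v)"
proof -
  interpret branch D u v k using assms by (auto intro: branch_pairs)
  have zI: "b * z \<in> principal B z" if "b \<in> B" for b using that by (rule principalI)
  have z_eq: "z = v\<^sup>2 / u" by (simp add: z_def slope_def power2_eq_square)
  have vI: "v * b \<in> principal B z" if "b \<in> B" for b
  proof -
    have "(slope * b) * z \<in> principal B z" using that be.u by (intro zI be.closed)
    then show ?thesis by (metis mult.assoc mult.commute slope_z)
  qed
  obtain x' y' where xy: "x' \<in> S" "y' \<in> S" "x = v * x'" "y = v * y'"
    using coordinates[OF assms(1)] by blast
  consider "g = x \<or> g = y" | "g = x\<^sup>2 / y" | b where "b \<in> k" "g = y\<^sup>2 / (x + b * y)"
    using assms(2) by (auto simp: G_def)
  then show ?thesis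
  proof cases
    case 1
    then show ?thesis using vI SB xy by auto
  next
    case 2
    consider "u = y" "v = x" | a where "a \<in> k" "u = x + a * y" "v = y"
      using assms(1) by (auto simp: pairs_def)
    then show ?thesis
    proof cases
      case 1
      have "g = 1 * z" unfolding z_eq using 2 1 by simp
      then show ?thesis using zI be.closed(2) by metis
    next
      case (2 a)
      have "g = (v * x')\<^sup>2 / v" using \<open>g = x\<^sup>2 / y\<close> 2(3) xy(3) by simp
      also have "\<dots> = v * (x' * x')" using v0 by (simp add: power2_eq_square)
      finally show ?thesis using vI[of "x' * x'"] be.closed(5) SB xy(1) by simp
    qed
  next
    case (3 b)
    consider "u = y" "v = x" | a where "a \<in> k" "u = x + a * y" "v = y"
      using assms(1) by (auto simp: pairs_def)
    then show ?thesis
    proof cases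
      case 1
      define e where "e = 1 + b * (u / v)"
      have e: "unit_of S e"
        unfolding e_def using assms(1) 3 sk by (intro linear_unit) (auto intro: subring_closed)
      have "x + b * y = v * e" using 1 x0 by (simp add: e_def field_simps)
      then have "g = (v * y')\<^sup>2 / (v * e)" using 3(2) xy(4) by simp
      also have "\<dots> = v * (y' * y' * inverse e)" using v0 by (simp add: power2_eq_square divide_inverse)
      finally have "g = v * (y' * y' * inverse e)" .
      moreover have "y' * y' * inverse e \<in> B" using e xy SB by (auto simp: unit_of_def intro!: be.closed)
      ultimately show ?thesis using vI by simp
    next
      case (2 a)
      show ?thesis
      proof (cases "b = a")
        case True
        have "g = 1 * z" unfolding z_eq using 3 2 True by simp
        then show ?thesis using zI be.closed(2) by metis
      next
        case False
        then obtain h where "h \<in> B" "g = h * v"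
          using shift_gen[OF 2(1) 3(1)] 3 2 by (auto elim: principalE)
        then show ?thesis using vI[of h] by (simp add: mult.commute)
      qed
    qed
  qed
qed

lemma A_beta:
  assumes "(u, v) \<in> pairs"
  shows "A \<subseteq> beta u v"
proof -
  interpret branch D u v k using assms by (rule branch_pairs)
  have "g \<in> B" if "g \<in> G" for g
    using gens_z[OF assms, of g] that principal_subset[OF be.sub be.v] by auto
  then show ?thesis unfolding A_def using RB by (intro adjoin_least be.sub) auto
qed

lemma m_beta:
  assumes "(u, v) \<in> pairs"
  shows "m \<subseteq> principal (beta u v) (branch.z u v)"
proof -
  interpret branch D u v k using assms by (rule branch_pairs)
  note p = ideal_in_principal[OF be.sub be.v]
  have "ideal_in A (principal B z \<inter> A)"
    using ideal_inD(2,3)[OF p] ideal_inD(4)[OF p subsetD[OF A_beta[OF assms]]] subring_closed(1,3,5)[OF subA]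
    unfolding ideal_in_def by auto
  moreover have "{x, y} \<union> G \<subseteq> principal B z \<inter> A"
    using gens_z[OF assms] DA GA x y by blast
  ultimately show ?thesis unfolding m_def using ideal_gen_least by blast
qed

lemma one_m: "1 \<notin> m"
proof -
  interpret branch D y x k by (rule branch_flip)
  show ?thesis using m_beta[of y x] be.one_notin_v by (auto simp: pairs_def)
qed

text \<open>The elements congruent to a constant modulo m form a subring, and it contains D and all
  of \<open>G\<close>. Thus A / m is k.\<close>

lemma residue: "s \<in> A \<Longrightarrow> \<exists>c\<in>k. s - c \<in> m"
proof -
  define U where "U = {s\<in>A. \<exists>c\<in>k. s - c \<in> m}"
  have UI: "s \<in> U" if "s \<in> A" "c \<in> k" "s - c \<in> m" for s c using that by (auto simp: U_def)
  have "subring U"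
    unfolding subring_def
  proof (intro conjI ballI)
    show "0 \<in> U" "1 \<in> U"
      using UI[of 0 0] UI[of 1 1] subring_closed(1,2)[OF subA] subring_closed(1,2)[OF sk] ideal_inD(2)[OF ideal_m] by auto
    fix a b assume "a \<in> U" "b \<in> U"
    then obtain c d where *: "a \<in> A" "c \<in> k" "a - c \<in> m" "b \<in> A" "d \<in> k" "b - d \<in> m"
      by (auto simp: U_def)
    have "(a + b) - (c + d) = (a - c) + (b - d)" "(a - b) - (c - d) = (a - c) - (b - d)"
      "a * b - c * d = a * (b - d) + d * (a - c)" by (auto simp: algebra_simps)
    moreover have "d \<in> A" using * kA by auto
    ultimately have "(a + b) - (c + d) \<in> m" "(a - b) - (c - d) \<in> m" "a * b - c * d \<in> m"
      using * ideal_inD(3,4)[OF ideal_m] ideal_in_diff[OF subA ideal_m] by metis+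
    then show "a + b \<in> U" "a - b \<in> U" "a * b \<in> U"
      using * UI subring_closed(3,4,5)[OF subA] subring_closed(3,4,5)[OF sk] by metis+
  qed
  moreover have "D \<subseteq> U"
  proof
    fix d assume dD: "d \<in> D"
    then obtain c where c: "c \<in> k" "d - c \<in> max_ideal D"
      using coeff unfolding coefficient_field_def by blast
    then obtain p q where "p \<in> D" "q \<in> D" "d - c = p * x + q * y" unfolding max_span by (auto elim: span2E)
    then have "d - c \<in> m" using gens_m DA ideal_inD(3,4)[OF ideal_m] by metis
    then show "d \<in> U" using UI DA dD c by blast
  qed
  moreover have "G \<subseteq> U"
  proof
    fix g assume "g \<in> G"
    then show "g \<in> U" using UI[of g 0] GA gens_m subring_zero[OF sk] by simp
  qed
  ultimately have "A \<subseteq> U" unfolding A_def by (intro adjoin_least)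
  then show "s \<in> A \<Longrightarrow> \<exists>c\<in>k. s - c \<in> m" by (auto simp: U_def)
qed

lemma const_m:
  assumes "c \<in> k" "c \<in> m"
  shows "c = 0"
proof (rule ccontr)
  assume "c \<noteq> 0"
  then have "inverse c \<in> A" using assms fk kA by (auto simp: subfield_def)
  then have "inverse c * c \<in> m" using assms by (intro ideal_inD(4)[OF ideal_m])
  then show False using one_m \<open>c \<noteq> 0\<close> by simp
qed

lemma prime_m: "prime_in A m"
proof -
  have "a \<in> m \<or> b \<in> m" if ab: "a \<in> A" "b \<in> A" "a * b \<in> m" for a b
  proof -
    obtain c d where *: "c \<in> k" "a - c \<in> m" "d \<in> k" "b - d \<in> m" using residue ab by blast
    have "c * d = a * b - (a * (b - d) + d * (a - c))" by (simp add: algebra_simps)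
    moreover have "a * (b - d) + d * (a - c) \<in> m"
      using * ab kA by (intro ideal_inD(3)[OF ideal_m] ideal_inD(4)[OF ideal_m]) auto
    ultimately have "c * d \<in> m" using ab ideal_in_diff[OF subA ideal_m] by metis
    then have "c * d = 0" using * const_m subring_mult[OF sk] by blast
    then show ?thesis using * by auto
  qed
  then show ?thesis
    unfolding prime_in_def using ideal_m one_m subring_one[OF subA] by auto
qed

sublocale prime_localization A m
  using subA prime_m by unfold_locales

text \<open>s is a nonzero constant modulo m, and m lies in the maximal ideal of the ring of the
  branch.\<close>

lemma unit_outside_m:
  assumes "(u, v) \<in> pairs" "s \<in> A" "s \<notin> m"
  shows "inverse s \<in> beta u v"
proof -
  interpret branch D u v k using assms by (auto intro: branch_pairs)
  obtain c where c: "c \<in> k" "s - c \<in> m" using residue assms by blast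
  have "c \<noteq> 0" using c assms by auto
  then have "unit_of B c" using c fk RB kD' by (auto simp: unit_of_def subfield_def)
  then have cB: "c \<notin> span2 B slope z" by (rule unit_not_max)
  have "s - c \<in> span2 B slope z" using m_beta[OF assms(1)] c be.principal_max by auto
  then have "s \<notin> span2 B slope z"
    using cB ideal_in_diff[OF be.sub be.ideal_max, of s "s - c"] by auto
  then show ?thesis using be.unit A_beta[OF assms(1)] assms(2) by auto
qed

lemma C_beta:
  assumes "(u, v) \<in> pairs"
  shows "C \<subseteq> beta u v"
proof
  interpret branch D u v k using assms by (rule branch_pairs)
  fix f assume "f \<in> C"
  then obtain r s where rs: "r \<in> A" "s \<in> A" "s \<notin> m" "f = r / s" unfolding C_def by (rule localizeE)
  then show "f \<in> B"
    using unit_outside_m[OF assms rs(2,3)] A_beta[OF assms] by (auto simp: divide_inverse intro!: be.closed)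
qed

lemma C_T: "C \<subseteq> T"
  using C_beta by (auto simp: T_def)

section \<open>Initial forms and their shape in each branch\<close>

abbreviation "mp \<equiv> mpow D x y"

lemma initial_form:
  "p \<in> mp n \<Longrightarrow> \<exists>P\<in>polys k. degree P \<le> n \<and> p - y ^ n * poly P (x / y) \<in> mp (Suc n)"
proof (induction n arbitrary: p)
  case 0
  then obtain c where c: "c \<in> k" "p - c \<in> max_ideal D"
    using coeff unfolding coefficient_field_def by auto
  then obtain a b where "a \<in> D" "b \<in> D" "p - c = x * a + y * b"
    unfolding max_span by (auto elim!: span2E simp: mult.commute)
  then show ?case using c(1) by (intro bexI[of _ "[:c:]"]) (auto simp: polys_pCons[OF sk] polys_zero[OF sk])
next
  case (Suc n)
  then obtain a b where ab: "a \<in> mp n" "b \<in> mp n" "p = x * a + y * b" by auto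
  obtain P where P: "P \<in> polys k" "degree P \<le> n" "a - y ^ n * poly P (x / y) \<in> mp (Suc n)"
    using Suc.IH[OF ab(1)] by blast
  obtain Q where Q: "Q \<in> polys k" "degree Q \<le> n" "b - y ^ n * poly Q (x / y) \<in> mp (Suc n)"
    using Suc.IH[OF ab(2)] by blast
  \<comment> \<open>Multiplying a form by x shifts its coefficients, while multiplying by y only
    raises the formal degree.\<close>
  have "p - y ^ Suc n * poly (pCons 0 P + Q) (x / y)
    = x * (a - y ^ n * poly P (x / y)) + y * (b - y ^ n * poly Q (x / y))"
    using ab(3) y0 by (simp add: algebra_simps)
  then have "p - y ^ Suc n * poly (pCons 0 P + Q) (x / y) \<in> mp (Suc (Suc n))"
    unfolding mpow.simps(2)[of D x y "Suc n"] using P(3) Q(3) by blast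
  moreover have "pCons 0 P + Q \<in> polys k"
    using P Q by (intro polys_add[OF sk]) (auto simp: polys_pCons[OF sk] subring_zero[OF sk])
  moreover have "degree (pCons 0 P + Q) \<le> Suc n"
    using P Q degree_pCons_le[of 0 P] by (intro degree_add_le) auto
  ultimately show ?case by blast
qed

text \<open>\<^term>\<open>P'\<close> represents the binary form given by \<^term>\<open>P\<close> in the coordinates \<^term>\<open>(u, v)\<close>.\<close>

definition "local_form u v j P P' \<longleftrightarrow> u = y \<and> v = x \<and> P' = flip_poly j P \<or>
  (\<exists>a\<in>k. u = x + a * y \<and> v = y \<and> P' = pcompose P [:- a, 1:])"

lemma local_form_exists: "(u, v) \<in> pairs \<Longrightarrow> \<exists>P'. local_form u v j P P'"
  by (auto simp: pairs_def local_form_def)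

lemma local_form_pairs: "local_form u v j P P' \<Longrightarrow> (u, v) \<in> pairs"
  by (auto simp: pairs_def local_form_def)

lemma local_form_eq:
  assumes "local_form u v j P P'" "P \<in> polys k" "degree P \<le> j"
  shows "P' \<in> polys k" "P' = 0 \<longleftrightarrow> P = 0" "y ^ j * poly P (x / y) = v ^ j * poly P' (u / v)"
proof -
  consider "u = y" "v = x" "P' = flip_poly j P"
    | a where "a \<in> k" "u = x + a * y" "v = y" "P' = pcompose P [:- a, 1:]"
    using assms(1) by (auto simp: local_form_def)
  then have "P' \<in> polys k \<and> (P' = 0 \<longleftrightarrow> P = 0) \<and> y ^ j * poly P (x / y) = v ^ j * poly P' (u / v)"
  proof cases
    case 1
    have "P = 0" if "flip_poly j P = 0"
    proof (rule poly_eqI)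
      fix i
      show "coeff P i = coeff 0 i"
        using coeff_flip_poly[of j P "j - i"] that assms(3) by (cases "i \<le> j") (auto simp: coeff_eq_0)
    qed
    moreover have "flip_poly j P \<in> polys k"
      using assms(2) subring_zero[OF sk] by (auto simp: polys_def coeff_flip_poly)
    ultimately show ?thesis
      using poly_flip_poly[OF assms(3) x0 y0] 1 by (auto simp: flip_poly_def)
  next
    case 2
    have "poly P' (u / v) = poly P (x / y)"
      using 2 y0 by (simp add: poly_pcompose add_divide_distrib)
    moreover have "P' \<in> polys k"
      unfolding 2(4) using 2(1) assms(2)
      by (intro polys_pcompose[OF sk])
        (auto simp: polys_pCons[OF sk] polys_zero[OF sk] subring_one[OF sk] subring_uminus[OF sk])
    moreover have "P' = 0 \<longleftrightarrow> P = 0" unfolding 2(4) by (simp add: pcompose_eq_0_iff)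
    ultimately show ?thesis using 2 by simp
  qed
  then show "P' \<in> polys k" "P' = 0 \<longleftrightarrow> P = 0" "y ^ j * poly P (x / y) = v ^ j * poly P' (u / v)"
    by auto
qed

text \<open>The error term has order above j, so in \<open>S\<close> it is divisible by one more
  power of v than the form.\<close>

lemma local_expansion:
  assumes f: "local_form u v j P P'" "P \<in> polys k" "degree P \<le> j"
    and p: "p - y ^ j * poly P (x / y) \<in> mp (Suc j)"
  shows "\<exists>dl\<in>branch.S D u v. p = v ^ j * (poly P' (u / v) + v * dl)"
proof -
  interpret branch D u v k using f local_form_pairs branch_pairs by blast
  obtain x' y' where xy: "x' \<in> S" "y' \<in> S" "x = v * x'" "y = v * y'"
    using coordinates[OF local_form_pairs[OF f(1)]] by blast
  have "p - y ^ j * poly P (x / y) \<in> mpow D (v * x') (v * y') (Suc j)"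
    using p unfolding xy(3,4)[symmetric] .
  then obtain dl where dl: "dl \<in> S" "p - y ^ j * poly P (x / y) = v ^ Suc j * dl"
    using mpow_v[OF xy(1,2)] by blast
  then have "p = v ^ j * (poly P' (u / v) + v * dl)"
    using local_form_eq(3)[OF f] by (simp add: algebra_simps)
  then show ?thesis using dl by blast
qed

lemma form_nonzero:
  assumes "Q \<in> polys k" "Q \<noteq> 0"
  shows "poly Q (x / y) \<noteq> 0"
proof -
  have 0: "0 \<in> k" using sk by (rule subring_zero)
  \<comment> \<open>For a = 0 the slope is x / y.\<close>
  interpret branch D "x + 0 * y" y k using branch_shift[OF 0] .
  show ?thesis using poly_slope_nonzero[OF assms] unfolding slope_def by simp
qed

lemma order_exists:
  assumes "q \<in> D" "q \<noteq> 0"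
  shows "\<exists>e. q \<in> mp e \<and> q \<notin> mp (Suc e)"
proof -
  interpret branch D y x k by (rule branch_flip)
  have "(y, x) \<in> pairs" by (simp add: pairs_def)
  then obtain x' y' where xy: "x' \<in> S" "y' \<in> S" "x = x * x'" "y = x * y'"
    using coordinates by blast
  have "\<exists>n. q \<notin> mp n" using finite_order[OF xy(1,2) assms] unfolding xy(3,4)[symmetric] .
  define n where "n = (LEAST n. q \<notin> mp n)"
  have "q \<notin> mp n" unfolding n_def using \<open>\<exists>n. q \<notin> mp n\<close> by (rule LeastI_ex)
  then obtain e where e: "n = Suc e" using assms by (cases n) auto
  then have "q \<in> mp e" using not_less_Least[of e "\<lambda>n. q \<notin> mp n"] by (auto simp: n_def)
  then show ?thesis using \<open>q \<notin> mp n\<close> e by blast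
qed

section \<open>Fractions whose denominator is a form\<close>

context
  fixes Q e
  assumes Q: "Q \<in> polys k" "Q \<noteq> 0" "degree Q \<le> e"
begin

lemma form_over_form_in_A:
  assumes P: "P \<in> polys k"
    and pole: "\<And>a n. a \<in> k \<Longrightarrow> [:a, 1:] ^ (r + n) dvd Q \<Longrightarrow> [:a, 1:] ^ n dvd P"
    and deg: "degree P \<le> degree Q + 2 * r"
  shows "y ^ (e + r) * poly P (x / y) / (y ^ e * poly Q (x / y)) \<in> A"
proof -
  have "y ^ r * poly P (x / y) / poly Q (x / y) \<in> A"
  proof (rule partial_fractions[OF subA alg kA form_nonzero _ _ _ _ P Q(1,2) pole deg])
    show "y \<in> A" using DA y by simp
    show "y * (x / y) \<in> A" using DA x y0 by simp
    have "y * (x / y)\<^sup>2 = x\<^sup>2 / y" using y0 by (simp add: power2_eq_square)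
    then show "y * (x / y)\<^sup>2 \<in> A" using GA by (simp add: G_def)
    fix a assume a: "a \<in> k"
    have "y / (x / y + a) = y\<^sup>2 / (x + a * y)"
      using y0 xa0[OF a] by (simp add: power2_eq_square field_simps)
    then show "y / (x / y + a) \<in> A" using GA a by (auto simp: G_def)
  qed
  then show ?thesis using y0 by (simp add: power_add)
qed

text \<open>This ends the expansion into forms. p is a combination over D of monomials of degree n;
  i and l collect the factors split off so far, until a single monomial of degree e + r over the
  form remains. Such a monomial needs no cancellation, since Q has no zero of order above e.\<close>

lemma high_order_in_A:
  assumes "e \<le> r" "p \<in> mp n" "n + i + l = e + r"
  shows "p * x ^ i * y ^ l / (y ^ e * poly Q (x / y)) \<in> A"
  using assms(2,3)
proof (induction n arbitrary: p i l)
  case 0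
  have 1: "1 \<in> k" using sk by (rule subring_one)
  have "y ^ (e + r) * poly (monom 1 i) (x / y) / (y ^ e * poly Q (x / y)) \<in> A"
  proof (rule form_over_form_in_A)
    show "monom 1 i \<in> polys k" using 1 by (rule polys_monom[OF sk])
    \<comment> \<open>The exponent i is at most e + r and e is at most r.\<close>
    show "degree (monom (1::'a) i) \<le> degree Q + 2 * r" using 0(2) assms(1) degree_monom_le[of "1::'a" i] by linarith
    fix a n assume "[:a, 1:] ^ (r + n) dvd Q"
    then have "degree ([:a, 1:] ^ (r + n)) \<le> degree Q" using Q(2) by (rule dvd_imp_degree_le)
    then have "r + n \<le> e" using Q(3) by (simp add: degree_linear_power)
    then have "n = 0" using assms(1) by simp
    then show "[:a, 1:] ^ n dvd monom 1 i" by simp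
  qed
  moreover have "y ^ (e + r) * (x / y) ^ i = x ^ i * y ^ l"
    using 0 y0 by (simp add: power_divide power_add flip: 0(2))
  ultimately have "x ^ i * y ^ l / (y ^ e * poly Q (x / y)) \<in> A" by (simp add: poly_monom)
  moreover have "p \<in> A" using 0 DA by simp
  ultimately have "p * (x ^ i * y ^ l / (y ^ e * poly Q (x / y))) \<in> A" by (intro subring_mult[OF subA])
  then show ?case by (simp add: ac_simps)
next
  case (Suc n)
  then obtain a b where ab: "a \<in> mp n" "b \<in> mp n" "p = x * a + y * b" by auto
  have "a * x ^ Suc i * y ^ l / (y ^ e * poly Q (x / y)) \<in> A"
    using Suc.prems(2) by (intro Suc.IH[OF ab(1)]) simp
  moreover have "b * x ^ i * y ^ Suc l / (y ^ e * poly Q (x / y)) \<in> A"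
    using Suc.prems(2) by (intro Suc.IH[OF ab(2)]) simp
  ultimately have "a * x ^ Suc i * y ^ l / (y ^ e * poly Q (x / y)) + b * x ^ i * y ^ Suc l / (y ^ e * poly Q (x / y)) \<in> A"
    by (rule subring_add[OF subA])
  then show ?case unfolding ab(3) by (simp add: algebra_simps add_divide_distrib)
qed

text \<open>The branch at infinity yields the vanishing below degree e and the bound on the degree;
  the branch at a yields the pole condition at -a.\<close>

lemma initial_form_conditions:
  assumes P: "P \<in> polys k" "degree P \<le> j" and p: "p - y ^ j * poly P (x / y) \<in> mp (Suc j)"
    and T: "p / (y ^ e * poly Q (x / y)) \<in> T"
  shows "j < e \<Longrightarrow> P = 0"
    and "e \<le> j \<Longrightarrow> a \<in> k \<Longrightarrow> [:a, 1:] ^ (j - e + n) dvd Q \<Longrightarrow> [:a, 1:] ^ n dvd P"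
    and "e \<le> j \<Longrightarrow> degree P \<le> degree Q + 2 * (j - e)"
proof -
  have flip: "local_form y x j P (flip_poly j P)" "local_form y x e Q (flip_poly e Q)"
    by (auto simp: local_form_def)
  have fx: "(y, x) \<in> pairs" by (simp add: pairs_def)
  interpret fl: branch D y x k by (rule branch_flip)
  note PF = local_form_eq[OF flip(1) P] and QF = local_form_eq[OF flip(2) Q(1,3)]
  obtain dl where dl: "dl \<in> fl.S" "p = x ^ j * (poly (flip_poly j P) (y / x) + x * dl)"
    using local_expansion[OF flip(1) P p] by blast
  have "p / (y ^ e * poly Q (x / y)) \<in> fl.B" using T fx by (auto simp: T_def)
  then have "x ^ j * (poly (flip_poly j P) fl.slope + x * dl) / (x ^ e * poly (flip_poly e Q) fl.slope) \<in> fl.B"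
    unfolding QF(3) fl.slope_def by (simp add: dl(2))
  note fd = fl.initial_form_dvd[OF PF(1) QF(1) _ dl(1) this]
  { assume "j < e" then show "P = 0" using fd(1) PF(2) QF(2) Q(2) by blast }
  { assume ej: "e \<le> j"
    show "degree P \<le> degree Q + 2 * (j - e)"
    proof (rule degree_le, intro allI impI)
      fix i assume i: "degree Q + 2 * (j - e) < i"
      show "coeff P i = 0"
      proof (cases "i \<le> j")
        case False
        then show ?thesis using P(2) by (simp add: coeff_eq_0)
      next
        case True
        \<comment> \<open>The coefficient of index i sits at j - i in the flipped polynomial, so
          divisibility by the power one higher makes it vanish. The excess of i over the bound is
          exactly what makes the flipped Q divisible by the power required.\<close>
        define n where "n = Suc (j - i)"
        have "monom 1 (j - e + n) dvd flip_poly e Q"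
          unfolding monom_1_dvd_iff' coeff_flip_poly
          using i True ej Q(3) by (auto simp: n_def intro!: coeff_eq_0)
        then have "monom 1 n dvd flip_poly j P" using fd(2)[OF _ ej] QF(2) Q(2) by blast
        then have "coeff (flip_poly j P) (j - i) = 0" unfolding monom_1_dvd_iff' by (simp add: n_def)
        then show ?thesis using True by (simp add: coeff_flip_poly)
      qed
    qed }
  { assume ej: "e \<le> j" and a: "a \<in> k" and dvd: "[:a, 1:] ^ (j - e + n) dvd Q"
    interpret sh: branch D "x + a * y" y k using a by (rule branch_shift)
    have sx: "(x + a * y, y) \<in> pairs" using a by (auto simp: pairs_def)
    have shift: "local_form (x + a * y) y j P (pcompose P [:- a, 1:])"
      "local_form (x + a * y) y e Q (pcompose Q [:- a, 1:])"
      using a by (auto simp: local_form_def)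
    note PS = local_form_eq[OF shift(1) P] and QS = local_form_eq[OF shift(2) Q(1,3)]
    obtain dl where dl: "dl \<in> sh.S" "p = y ^ j * (poly (pcompose P [:- a, 1:]) ((x + a * y) / y) + y * dl)"
      using local_expansion[OF shift(1) P p] by blast
    have "p / (y ^ e * poly Q (x / y)) \<in> sh.B" using T sx by (auto simp: T_def)
    then have "y ^ j * (poly (pcompose P [:- a, 1:]) sh.slope + y * dl) / (y ^ e * poly (pcompose Q [:- a, 1:]) sh.slope) \<in> sh.B"
      unfolding QS(3) sh.slope_def dl(2) .
    from sh.initial_form_dvd(2)[OF PS(1) QS(1) _ dl(1) this ej] show "[:a, 1:] ^ n dvd P"
      using dvd QS(2) Q(2) by (simp add: monom_dvd_shift) }
qed

text \<open>Forms of degree below e vanish. From degree e on, the initial form over the denominator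
  is in A, hence in \<open>T\<close>, and can be subtracted without leaving \<open>T\<close>; the
  order rises until \<open>high_order_in_A\<close> applies.\<close>

lemma over_form_in_A:
  assumes "p \<in> D" "p / (y ^ e * poly Q (x / y)) \<in> T"
  shows "p / (y ^ e * poly Q (x / y)) \<in> A"
proof -
  let ?g = "y ^ e * poly Q (x / y)"
  have "p \<in> mp j" if "j \<le> e" for j
    using that
  proof (induction j)
    case (Suc j)
    then have "p \<in> mp j" by simp
    then obtain P where P: "P \<in> polys k" "degree P \<le> j" "p - y ^ j * poly P (x / y) \<in> mp (Suc j)"
      using initial_form by blast
    then have "P = 0" using initial_form_conditions(1)[OF P assms(2)] Suc.prems by simp
    then show ?case using P(3) by simp
  qed (use assms in simp)
  \<comment> \<open>The truncated difference d is 0 exactly when r has reached e, where the order is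
    at least 2 e.\<close>
  moreover have "p / ?g \<in> A" if "d = e - r" "p \<in> mp (e + r)" "p / ?g \<in> T" for d r p
    using that
  proof (induction d arbitrary: r p)
    case 0
    then show ?case using high_order_in_A[of r p "e + r" 0 0] by simp
  next
    case (Suc d)
    obtain P where P: "P \<in> polys k" "degree P \<le> e + r" "p - y ^ (e + r) * poly P (x / y) \<in> mp (Suc (e + r))"
      using initial_form[OF Suc.prems(2)] by blast
    note c = initial_form_conditions[OF P Suc.prems(3)]
    define h where "h = y ^ (e + r) * poly P (x / y) / ?g"
    have hA: "h \<in> A" unfolding h_def by (rule form_over_form_in_A[OF P(1)]) (use c in auto)
    have "p / ?g - h \<in> T"
      unfolding T_def
    proof (clarify)
      fix u v assume uv: "(u, v) \<in> pairs"
      interpret branch D u v k using uv by (rule branch_pairs)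
      show "p / ?g - h \<in> B"
        using Suc.prems(3) hA A_beta[OF uv] uv by (intro be.closed) (auto simp: T_def)
    qed
    moreover have eq: "p / ?g - h = (p - y ^ (e + r) * poly P (x / y)) / ?g"
      by (simp add: h_def diff_divide_distrib)
    ultimately have "p / ?g - h \<in> A"
      using Suc.IH[of "Suc r" "p - y ^ (e + r) * poly P (x / y)"] P(3) Suc.prems(1) by simp
    then have "(p / ?g - h) + h \<in> A" using hA by (rule subring_add[OF subA])
    then show ?case by simp
  qed
  from this[of e 0 p] show ?thesis using calculation[of e] assms by simp
qed

end

lemma T_C: "T \<subseteq> C"
proof
  fix f assume f: "f \<in> T"
  interpret fl: branch D y x k by (rule branch_flip)
  obtain a b where "a \<in> D" "b \<in> D" "b \<noteq> 0" "f = a / b"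
    using quot unfolding quotient_field_is_univ_def by blast
  \<comment> \<open>q generates the ideal of denominators of f, which replaces a factorization into
    primes.\<close>
  then obtain q where q: "q \<in> D" "q \<noteq> 0" "q * f \<in> D" "\<forall>s\<in>D. s * f \<in> D \<longrightarrow> s \<in> principal D q"
    using fl.reduced_denominator[of b f] by auto
  obtain e where e: "q \<in> mp e" "q \<notin> mp (Suc e)" using order_exists[OF q(1,2)] by blast
  obtain Q where Q: "Q \<in> polys k" "degree Q \<le> e" "q - y ^ e * poly Q (x / y) \<in> mp (Suc e)"
    using initial_form[OF e(1)] by blast
  \<comment> \<open>Otherwise q would have order above e.\<close>
  have Q0: "Q \<noteq> 0" using Q(3) e(2) by auto
  define g where "g = y ^ e * poly Q (x / y)"
  have g0: "g \<noteq> 0" using form_nonzero[OF Q(1) Q0] y0 by (simp add: g_def)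
  have un: "unit_of (beta u v) (q / g)" if uv: "(u, v) \<in> pairs" for u v
  proof -
    interpret branch D u v k using uv by (rule branch_pairs)
    obtain Q' where Q': "local_form u v e Q Q'" using local_form_exists[OF uv] by blast
    note QQ = local_form_eq[OF Q' Q(1,2)]
    obtain dl where dl: "dl \<in> S" "q = v ^ e * (poly Q' (u / v) + v * dl)"
      using local_expansion[OF Q' Q] by blast
    have "f \<in> B" using f uv by (auto simp: T_def)
    then obtain i j et where et: "unit_of B et" "q = slope ^ i * z ^ j * et"
      using reduced_denominator_monomial[OF _ q(1,4)] by blast
    have "unit_of B (v ^ e * (poly Q' slope + v * dl) / (v ^ e * poly Q' slope))"
    proof (rule initial_form_unit[OF QQ(1) _ dl(1) et(1)])
      show "Q' \<noteq> 0" using QQ(2) Q0 by simp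
      show "v ^ e * (poly Q' slope + v * dl) = slope ^ i * z ^ j * et"
        using dl(2) et(2) by (simp add: slope_def[symmetric])
    qed
    then show ?thesis using dl(2) QQ(3) by (simp add: g_def slope_def[symmetric])
  qed
  have "q / g \<in> T" using un by (auto simp: T_def unit_of_def)
  then have qA: "q / g \<in> A" using over_form_in_A[OF Q(1) Q0 Q(2) q(1)] by (simp add: g_def)
  have "q * f / g \<in> T"
    unfolding T_def
  proof clarify
    fix u v assume uv: "(u, v) \<in> pairs"
    interpret branch D u v k using uv by (rule branch_pairs)
    have "(q / g) * f \<in> B" using un[OF uv] f uv by (intro be.closed) (auto simp: T_def unit_of_def)
    then show "q * f / g \<in> B" by simp
  qed
  then have pA: "q * f / g \<in> A" using over_form_in_A[OF Q(1) Q0 Q(2) q(3)] by (simp add: g_def)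
  \<comment> \<open>A unit of the ring at infinity cannot lie in m, which is contained in the
    maximal ideal there.\<close>
  have "q / g \<notin> m"
  proof
    assume "q / g \<in> m"
    moreover have "(y, x) \<in> pairs" by (simp add: pairs_def)
    ultimately show False
      using m_beta[of y x] fl.unit_not_max[OF un[of y x]] fl.be.principal_max by blast
  qed
  then have "(q * f / g) / (q / g) \<in> C" unfolding C_def using qA pA by (intro localizeI)
  then show "f \<in> C" using g0 q(2) by simp
qed

lemma C_eq_T: "C = T" using C_T T_C by blast

lemma not_noetherian_C: "\<not> noetherian C"
proof
  assume n: "noetherian C"
  have sC: "subring C" unfolding C_def by (rule subring_localize)
  define N where "N a = principal (beta (x + a * y) y) y" for a
  have pr: "(x + a * y, y) \<in> pairs" if "a \<in> k" for a using that by (auto simp: pairs_def)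
  have N: "0 \<in> N a" "c \<in> N a \<Longrightarrow> d \<in> N a \<Longrightarrow> c + d \<in> N a" "r \<in> C \<Longrightarrow> c \<in> N a \<Longrightarrow> r * c \<in> N a"
    if a: "a \<in> k" for a c d r
  proof -
    interpret branch D "x + a * y" y k using a by (rule branch_shift)
    have i: "ideal_in B (N a)" unfolding N_def using RB[OF v] by (rule ideal_in_principal[OF be.sub])
    show "0 \<in> N a" "c \<in> N a \<Longrightarrow> d \<in> N a \<Longrightarrow> c + d \<in> N a" "r \<in> C \<Longrightarrow> c \<in> N a \<Longrightarrow> r * c \<in> N a"
      using ideal_inD(2,3,4)[OF i] C_beta[OF pr[OF a]] by auto
  qed
  \<comment> \<open>Elements that y divides in the rings of all but finitely many a.\<close>
  define J where "J = {c\<in>C. finite {a\<in>k. c \<notin> N a}}"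
  have "ideal_in C J"
    unfolding ideal_in_def
  proof (intro conjI ballI)
    show "J \<subseteq> C" by (auto simp: J_def)
    have "{a \<in> k. 0 \<notin> N a} = {}" using N(1) by auto
    then show "0 \<in> J" using subring_zero[OF sC] unfolding J_def by (simp only: mem_Collect_eq) simp
  next
    fix c d assume "c \<in> J" "d \<in> J"
    moreover have "{a\<in>k. c + d \<notin> N a} \<subseteq> {a\<in>k. c \<notin> N a} \<union> {a\<in>k. d \<notin> N a}" using N(2) by auto
    ultimately show "c + d \<in> J"
      using subring_add[OF sC] unfolding J_def by (auto intro: finite_subset)
  next
    fix r c assume "r \<in> C" "c \<in> J"
    moreover have "{a\<in>k. r * c \<notin> N a} \<subseteq> {a\<in>k. c \<notin> N a}" using N(3) \<open>r \<in> C\<close> by auto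
    ultimately show "r * c \<in> J"
      using subring_mult[OF sC] unfolding J_def by (auto intro: finite_subset)
  qed
  then obtain S where S: "finite S" "S \<subseteq> C" "J = ideal_gen C S"
    using n unfolding noetherian_def by blast
  have "S \<subseteq> J" unfolding S(3) by (rule ideal_gen_superset)
  then have "finite (\<Union>s\<in>S. {a\<in>k. s \<notin> N a})" using S(1) by (auto simp: J_def)
  \<comment> \<open>A finite generating set has only finitely many exceptional points altogether.
    Since k is infinite, some a is exceptional for no generator, and then for no element of
    \<open>J\<close>.\<close>
  then obtain a where a: "a \<in> k" "a \<notin> (\<Union>s\<in>S. {a\<in>k. s \<notin> N a})"
    using infinite_alg_closed[OF alg] by (meson finite_subset subsetI)
  have "ideal_in C (N a \<inter> C)"
    unfolding ideal_in_def using N[OF a(1)] subring_closed(1,3,5)[OF sC] by auto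
  moreover have "S \<subseteq> N a \<inter> C" using a S(2) by auto
  ultimately have JN: "J \<subseteq> N a" unfolding S(3) using ideal_gen_least by blast
  have "y\<^sup>2 / (x + a * y) \<in> N b" if "b \<in> k" "b \<noteq> a" for b
    unfolding N_def using shift_gen[of b a] that a by auto
  then have "{b\<in>k. y\<^sup>2 / (x + a * y) \<notin> N b} \<subseteq> {a}" by auto
  moreover have "y\<^sup>2 / (x + a * y) \<in> C" using GA superset a(1) by (auto simp: G_def C_def)
  ultimately have "y\<^sup>2 / (x + a * y) \<in> J" unfolding J_def by (auto intro: finite_subset)
  then have "y\<^sup>2 / (x + a * y) \<in> N a" using JN by blast
  moreover interpret branch D "x + a * y" y k using a(1) by (rule branch_shift)
  \<comment> \<open>The element attached to a is exceptional precisely there: it is z, and z = b y =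
    b * slope * z would make slope a unit.\<close>
  have "z = y\<^sup>2 / (x + a * y)" by (simp add: z_def slope_def power2_eq_square)
  ultimately obtain b where b: "b \<in> B" "z = b * y" unfolding N_def by (auto elim: principalE)
  have "z * (b * slope) = b * (slope * z)" by (simp add: ac_simps)
  also have "\<dots> = z * 1" using b slope_z by simp
  finally have "b * slope = 1" using be.v0 by simp
  then show False using be.in_max(1)[OF b(1)] be.proper by simp
qed

end

text \<open>Since v / (u / v) = v^2 / u, the second transform is the localization appearing in the
  theorem.\<close>

lemma beta_eq:
  assumes "branch D u v k"
  shows "branch.B D u v = localize (adjoin (quadratic D u v) {v\<^sup>2 / u})
    (ideal_gen (adjoin (quadratic D u v) {v\<^sup>2 / u}) {u / v, v\<^sup>2 / u})"
proof -
  interpret branch D u v k by fact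
  have "v / (u / v) = v\<^sup>2 / u" by (simp add: power2_eq_square)
  then show ?thesis unfolding B_def S_def slope_def quadratic_def[of _ v] by (simp only:)
qed

theorem theorem6p17:
  fixes D k :: "'a::field set" and x y :: 'a
  assumes "regular_local2 D"
    and "quotient_field_is_univ D"
    and "x \<in> D" and "y \<in> D"
    and "max_ideal D = ideal_gen D {x, y}"
    and "coefficient_field D k"
    and "alg_closed_subfield k"
  defines "G \<equiv> {y\<^sup>2 / (x + a * y) | a. a \<in> k} \<union> {x\<^sup>2 / y}"
  defines "A \<equiv> adjoin D G"
  defines "m \<equiv> ideal_gen A ({x, y} \<union> G)"
  defines "C \<equiv> localize A m"
  defines "\<alpha> \<equiv> (\<lambda>a. localize (adjoin D {(x + a * y) / y})
                 (ideal_gen (adjoin D {(x + a * y) / y}) {y, (x + a * y) / y}))"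
  defines "\<beta> \<equiv> (\<lambda>a. localize (adjoin (\<alpha> a) {y\<^sup>2 / (x + a * y)})
                 (ideal_gen (adjoin (\<alpha> a) {y\<^sup>2 / (x + a * y)})
                    {(x + a * y) / y, y\<^sup>2 / (x + a * y)}))"
  defines "\<alpha>' \<equiv> localize (adjoin D {y / x}) (ideal_gen (adjoin D {y / x}) {x, y / x})"
  defines "\<beta>' \<equiv> localize (adjoin \<alpha>' {x\<^sup>2 / y})
                 (ideal_gen (adjoin \<alpha>' {x\<^sup>2 / y}) {y / x, x\<^sup>2 / y})"
  shows "C = (\<Inter>a\<in>k. \<beta> a) \<inter> \<beta>'
         \<and> subring C \<and> local_ring C \<and> \<not> noetherian C
         \<and> (\<exists>S. S \<subseteq> Qset D \<and> S \<noteq> {} \<and> C = \<Inter> S)"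
proof -
  interpret F: fan D k x y using assms(1-7) by unfold_locales
  have C: "C = F.C"
    unfolding C_def m_def A_def G_def F.C_def F.m_def F.A_def F.G_def ..
  have beta: "\<beta> a = branch.B D (x + a * y) y" if "a \<in> k" for a
    unfolding beta_eq[OF F.branch_shift[OF that]] \<beta>_def \<alpha>_def quadratic_def ..
  have beta': "\<beta>' = branch.B D y x"
    unfolding beta_eq[OF F.branch_flip] \<beta>'_def \<alpha>'_def quadratic_def ..
  define S where "S = insert \<beta>' (\<beta> ` k)"
  have "F.T = \<beta>' \<inter> (\<Inter>a\<in>k. \<beta> a)"
    unfolding F.T_def F.pairs_def using beta beta' by auto
  then have eq: "C = (\<Inter>a\<in>k. \<beta> a) \<inter> \<beta>'" using C F.C_eq_T by auto
  have Q: "branch.B D u v \<in> Qset D" if "(u, v) \<in> F.pairs" for u v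
  proof -
    interpret branch D u v k using that by (rule F.branch_pairs)
    show ?thesis using RB be.regular_local2 by (auto simp: Qset_def)
  qed
  have "S \<subseteq> Qset D"
    using Q[of y x] Q[of "x + _ * y" y] beta beta' unfolding S_def F.pairs_def by auto
  moreover have "C = \<Inter> S" using eq by (auto simp: S_def)
  moreover have "S \<noteq> {}" by (simp add: S_def)
  moreover have "subring C" "local_ring C" "\<not> noetherian C"
    using F.subring_localize F.local_ring_localize F.not_noetherian_C by (simp_all add: C F.C_def)
  ultimately show ?thesis using eq by blast
qed

end
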